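(* Let $A$ be a unital, simple, separable C$^*$-algebra with $U(A)=U(A)_0$ and such that the canonical map $B_A\colon\pi_1(U(A))\to K_0(A)$ is an isomorphism. Suppose that $A$ admits a tracial state $\tau$ with $SU_\tau(A)=\ker(\Delta_\tau)\cap U(A)_0$ and with $\tau_*\colon K_0(A)\to\mathbb{R}$ injective. Then there is an isomorphism of topological groups $\widetilde U(A)\cong\mathbb{R}\times SU_\tau(A)$.
   Context: $U(A)$ has the norm topology, $U(A)_0$ is the connected component of $1$, and $\widetilde U(A)$ is the universal cover of $U(A)$, i.e. continuous paths $[0,1]\to U(A)$ starting at $1$, modulo based null-homotopic loops. $B_A$ is the composition of $\pi_1(U(A))\to\pi_1(U_\infty(A))$, $U_\infty(A)=\bigcup_nU(M_n(A))$, with the inverse of the Bott isomorphism $K_0(A)\to\pi_1(U_\infty(A))$ (which sends $[p]-[q]$ to the class of $t\mapsto e^{2\pi itp}e^{-2\pi itq}$). $SU_\tau(A)$ is the group of all products $e^{ih_1}\cdots e^{ih_n}$ with $h_j=h_j^*\in A$, $\tau(h_j)=0$, with the group topology having as neighbourhood basis at $1$ the sets $\{e^{ih}:h=h^*\in\ker\tau,\|h\|<\varepsilon\}$, $\varepsilon>0$. $\Delta_\tau\colon U_\infty^{(0)}(A)\to\mathbb{C}/\tau_*(K_0(A))$ is the de la Harpe--Skandalis determinant on the identity component of $U_\infty(A)$: $\Delta_\tau(u)$ is the class of $\frac1{2\pi i}\int_0^1\tau(\xi(t)^{-1}\xi'(t))\,dt$ for any smooth path $\xi$ from $1$ to $u$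 ($\tau$ extended to matrices by summing over the diagonal). *)

theory Defs
  imports "HOL-Analysis.Analysis" "HOL-Algebra.Coset"
begin

section \<open>Unital C*-algebras\<close>

text \<open>The type class of nonzero unital complex C*-algebras. \<open>real_normed_algebra_1\<close> contributes
  the submultiplicative norm with \<open>norm 1 = 1\<close>, which excludes the zero algebra.\<close>

class cstar_algebra = real_normed_algebra_1 + banach +
  fixes scaleC :: "complex \<Rightarrow> 'a \<Rightarrow> 'a" (infixr \<open>*\<^sub>C\<close> 75)
    and adj :: "'a \<Rightarrow> 'a"
  assumes scaleC_add_right: "c *\<^sub>C (x + y) = c *\<^sub>C x + c *\<^sub>C y"
    and scaleC_add_left: "(c + d) *\<^sub>C x = c *\<^sub>C x + d *\<^sub>C x"
    and scaleC_scaleC: "c *\<^sub>C d *\<^sub>C x = (c * d) *\<^sub>C x"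
    and scaleC_of_real: "complex_of_real r *\<^sub>C x = r *\<^sub>R x"
    and mult_scaleC_left: "(c *\<^sub>C x) * y = c *\<^sub>C (x * y)"
    and mult_scaleC_right: "x * (c *\<^sub>C y) = c *\<^sub>C (x * y)"
    and norm_scaleC: "norm (c *\<^sub>C x) = cmod c * norm x"
    and adj_adj: "adj (adj x) = x"
    and adj_add: "adj (x + y) = adj x + adj y"
    and adj_mult: "adj (x * y) = adj y * adj x"
    and adj_scaleC: "adj (c *\<^sub>C x) = cnj c *\<^sub>C adj x"
    and cstar_identity: "norm (adj x * x) = (norm x)\<^sup>2"

definition closed_ideal :: "'a::cstar_algebra set \<Rightarrow> bool" where
  "closed_ideal I \<longleftrightarrow> closed I \<and> 0 \<in> I \<and> (\<forall>x\<in>I. \<forall>y\<in>I. x + y \<in> I) \<and>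
     (\<forall>c. \<forall>x\<in>I. c *\<^sub>C x \<in> I) \<and> (\<forall>a. \<forall>x\<in>I. a * x \<in> I \<and> x * a \<in> I)"

definition simple_cstar :: "'a::cstar_algebra itself \<Rightarrow> bool" where
  "simple_cstar _ \<longleftrightarrow> (\<forall>I :: 'a set. closed_ideal I \<longrightarrow> I = {0} \<or> I = UNIV)"

definition tracial_state :: "('a::cstar_algebra \<Rightarrow> complex) \<Rightarrow> bool" where
  "tracial_state \<tau> \<longleftrightarrow>
     (\<forall>x y. \<tau> (x + y) = \<tau> x + \<tau> y) \<and> (\<forall>c x. \<tau> (c *\<^sub>C x) = c * \<tau> x) \<and>
     (\<forall>x. \<tau> (adj x * x) \<in> \<real>\<^sub>\<ge>\<^sub>0) \<and> \<tau> 1 = 1 \<and> (\<forall>x y. \<tau> (x * y) = \<tau> (y * x))"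

definition unitaries :: "'a::cstar_algebra set" where
  "unitaries = {u. adj u * u = 1 \<and> u * adj u = 1}"


section \<open>Groups and topologies\<close>

definition add_group :: "'a::ab_group_add monoid" where
  "add_group = \<lparr>carrier = UNIV, monoid.mult = (+), one = 0\<rparr>"

text \<open>The quotient topology on a set \<open>Q\<close> of pairwise disjoint subsets covering \<open>X\<close>, such as the
  set of cosets of a subgroup.\<close>

definition partition_topology :: "'a topology \<Rightarrow> 'a set set \<Rightarrow> 'a set topology" where
  "partition_topology X Q = topology (\<lambda>W. W \<subseteq> Q \<and> openin X (\<Union>W))"

lemma openin_partition_topology:
  assumes "disjoint Q"
  shows "openin (partition_topology X Q) W \<longleftrightarrow> W \<subseteq> Q \<and> openin X (\<Union>W)"
proof -
  have "istopology (\<lambda>W. W \<subseteq> Q \<and> openin X (\<Union>W))"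
    unfolding istopology_def
  proof (rule conjI; intro allI impI)
    fix V W assume V: "V \<subseteq> Q \<and> openin X (\<Union>V)" and W: "W \<subseteq> Q \<and> openin X (\<Union>W)"
    have "\<Union>(V \<inter> W) = \<Union>V \<inter> \<Union>W"
    proof
      show "\<Union>V \<inter> \<Union>W \<subseteq> \<Union>(V \<inter> W)"
      proof
        fix x assume "x \<in> \<Union>V \<inter> \<Union>W"
        then obtain C D where "C \<in> V" "x \<in> C" "D \<in> W" "x \<in> D" by blast
        moreover from this have "C = D" using assms V W unfolding disjoint_def by blast
        ultimately show "x \<in> \<Union>(V \<inter> W)" by blast
      qed
    qed blast
    moreover have "openin X (\<Union>V \<inter> \<Union>W)" using V W by (intro openin_Int) simp_all
    ultimately show "V \<inter> W \<subseteq> Q \<and> openin X (\<Union>(V \<inter> W))" using V by auto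
  next
    fix \<K> assume K: "\<forall>K\<in>\<K>. K \<subseteq> Q \<and> openin X (\<Union>K)"
    have "\<Union>(\<Union>\<K>) = (\<Union>K\<in>\<K>. \<Union>K)" by blast
    moreover have "openin X (\<Union>K\<in>\<K>. \<Union>K)" using K by (intro openin_Union) auto
    moreover have "\<Union>\<K> \<subseteq> Q" using K by blast
    ultimately show "\<Union>\<K> \<subseteq> Q \<and> openin X (\<Union>(\<Union>\<K>))" by simp
  qed
  then show ?thesis by (simp only: partition_topology_def topology_inverse')
qed

definition loop_rel :: "'a topology \<Rightarrow> 'a \<Rightarrow> ((real \<Rightarrow> 'a) \<times> (real \<Rightarrow> 'a)) set" where
  "loop_rel X x = {(p, q). homotopic_with (\<lambda>r. r 0 = x \<and> r 1 = x) (top_of_set {0..1}) X p q}"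

definition loops :: "'a topology \<Rightarrow> 'a \<Rightarrow> (real \<Rightarrow> 'a) set" where
  "loops X x = {p. pathin X p \<and> p 0 = x \<and> p 1 = x}"

definition fundamental_group ::
  "'a::topological_space topology \<Rightarrow> 'a \<Rightarrow> (real \<Rightarrow> 'a) set monoid" where
  "fundamental_group X x =
     \<lparr>carrier = loops X x // loop_rel X x,
      monoid.mult = (\<lambda>C D. the_elem ((\<lambda>(p, q). loop_rel X x `` {p +++ q}) ` (C \<times> D))),
      one = loop_rel X x `` {\<lambda>_. x}\<rparr>"

definition induced_pi1 ::
  "'b topology \<Rightarrow> 'b \<Rightarrow> ('a \<Rightarrow> 'b) \<Rightarrow> (real \<Rightarrow> 'a) set \<Rightarrow> (real \<Rightarrow> 'b) set" where
  "induced_pi1 Y y f C = the_elem ((\<lambda>p. loop_rel Y y `` {f \<circ> p}) ` C)"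


section \<open>The universal cover of the unitary group\<close>

definition based_paths :: "(real \<Rightarrow> 'a::cstar_algebra) set" where
  "based_paths = {f \<in> extensional {0..1}.
     continuous_on {0..1} f \<and> f ` {0..1} \<subseteq> unitaries \<and> f 0 = 1}"

text \<open>The uniform metric. The value 0 outside \<open>based_paths\<close> is junk; it is there because
  \<open>Metric_space\<close> demands a nonnegative function on the whole type.\<close>

definition path_dist :: "(real \<Rightarrow> 'a::cstar_algebra) \<Rightarrow> (real \<Rightarrow> 'a) \<Rightarrow> real" where
  "path_dist f g = (if f \<in> based_paths \<and> g \<in> based_paths
     then SUP t\<in>{0..1}. dist (f t) (g t) else 0)"

definition path_topology :: "(real \<Rightarrow> 'a::cstar_algebra) topology" where
  "path_topology = Metric_space.mtopology based_paths path_dist"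

definition path_group :: "(real \<Rightarrow> 'a::cstar_algebra) monoid" where
  "path_group = \<lparr>carrier = based_paths, monoid.mult = (\<lambda>f g. \<lambda>t\<in>{0..1}. f t * g t),
     one = (\<lambda>t\<in>{0..1}. 1)\<rparr>"

definition null_loops :: "(real \<Rightarrow> 'a::cstar_algebra) set" where
  "null_loops = {f \<in> based_paths. homotopic_paths unitaries f (\<lambda>_. 1)}"

definition univ_cover :: "(real \<Rightarrow> 'a::cstar_algebra) set monoid" where
  "univ_cover = path_group Mod null_loops"

definition univ_cover_topology :: "(real \<Rightarrow> 'a::cstar_algebra) set topology" where
  "univ_cover_topology = partition_topology path_topology (rcosets\<^bsub>path_group\<^esub> null_loops)"

lemma Metric_space_based_paths:
  "Metric_space (based_paths :: (real \<Rightarrow> 'a::cstar_algebra) set) path_dist"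
proof
  have bdd: "bdd_above ((\<lambda>t. dist (f t) (g t)) ` {0..1})"
    if "f \<in> based_paths" "g \<in> based_paths" for f g :: "real \<Rightarrow> 'a"
    using that by (intro compact_imp_bounded[THEN bounded_imp_bdd_above] compact_continuous_image
        continuous_on_dist) (auto simp: based_paths_def)
  have upper: "dist (f t) (g t) \<le> path_dist f g"
    if "f \<in> based_paths" "g \<in> based_paths" "t \<in> {0..1}" for f g :: "real \<Rightarrow> 'a" and t
    using cSUP_upper[OF that(3) bdd[OF that(1,2)]] that by (simp add: path_dist_def)
  show "0 \<le> path_dist f g" for f g :: "real \<Rightarrow> 'a"
  proof (cases "f \<in> based_paths \<and> g \<in> based_paths")
    case True
    then show ?thesis using order_trans[OF zero_le_dist upper[of f g 0]] by simp
  qed (simp only: path_dist_def if_False order_refl)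
  show "path_dist f g = path_dist g f" for f g :: "real \<Rightarrow> 'a"
    by (simp add: path_dist_def dist_commute)
  fix f g h :: "real \<Rightarrow> 'a"
  assume f: "f \<in> based_paths" and g: "g \<in> based_paths"
  show "path_dist f g = 0 \<longleftrightarrow> f = g"
  proof
    assume 0: "path_dist f g = 0"
    have "f t = g t" if "t \<in> {0..1}" for t
      using upper[OF f g that] 0 by simp
    then show "f = g"
      using f g by (intro extensionalityI[of f "{0..1}" g]) (auto simp: based_paths_def)
  qed (simp add: path_dist_def)
  assume h: "h \<in> based_paths"
  show "path_dist f h \<le> path_dist f g + path_dist g h"
  proof -
    have "dist (f t) (h t) \<le> path_dist f g + path_dist g h" if "t \<in> {0..1}" for t
      using dist_triangle[of "f t" "h t" "g t"] upper[OF f g that] upper[OF g h that] by linarith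
    then have "(SUP t\<in>{0..1}. dist (f t) (h t)) \<le> path_dist f g + path_dist g h"
      by (intro cSUP_least) auto
    then show ?thesis using f h by (simp add: path_dist_def)
  qed
qed


section \<open>The group \<open>SU\<^sub>\<tau>(A)\<close>\<close>

definition sa_ker :: "('a::cstar_algebra \<Rightarrow> complex) \<Rightarrow> 'a set" where
  "sa_ker \<tau> = {h. adj h = h \<and> \<tau> h = 0}"

definition SU :: "('a::cstar_algebra \<Rightarrow> complex) \<Rightarrow> 'a set" where
  "SU \<tau> = {prod_list (map (\<lambda>h. exp (\<i> *\<^sub>C h)) hs) | hs. set hs \<subseteq> sa_ker \<tau>}"

definition SU_group :: "('a::cstar_algebra \<Rightarrow> complex) \<Rightarrow> 'a monoid" where
  "SU_group \<tau> = \<lparr>carrier = SU \<tau>, monoid.mult = (*), one = 1\<rparr>"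

definition SU_nhd :: "('a::cstar_algebra \<Rightarrow> complex) \<Rightarrow> real \<Rightarrow> 'a set" where
  "SU_nhd \<tau> \<epsilon> = {exp (\<i> *\<^sub>C h) | h. h \<in> sa_ker \<tau> \<and> norm h < \<epsilon>}"

text \<open>In a group topology with neighbourhood basis \<open>SU_nhd \<tau> \<epsilon>\<close> at 1, the translates
  \<open>u \<cdot> SU_nhd \<tau> \<epsilon>\<close> form a neighbourhood basis at \<open>u\<close>, and a set is open iff it is a neighbourhood
  of each of its points.\<close>

definition SU_topology :: "('a::cstar_algebra \<Rightarrow> complex) \<Rightarrow> 'a topology" where
  "SU_topology \<tau> =
     topology (\<lambda>W. W \<subseteq> SU \<tau> \<and> (\<forall>u\<in>W. \<exists>\<epsilon>>0. (\<lambda>v. u * v) ` SU_nhd \<tau> \<epsilon> \<subseteq> W))"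

lemma openin_SU_topology:
  "openin (SU_topology \<tau>) W \<longleftrightarrow>
     W \<subseteq> SU \<tau> \<and> (\<forall>u\<in>W. \<exists>\<epsilon>>0. (\<lambda>v. u * v) ` SU_nhd \<tau> \<epsilon> \<subseteq> W)"
proof -
  let ?P = "\<lambda>W. W \<subseteq> SU \<tau> \<and> (\<forall>u\<in>W. \<exists>\<epsilon>>0. (\<lambda>v. u * v) ` SU_nhd \<tau> \<epsilon> \<subseteq> W)"
  have "istopology ?P"
    unfolding istopology_def
  proof (rule conjI; intro allI impI)
    fix V W assume V: "?P V" and W: "?P W"
    have "\<exists>\<epsilon>>0. (\<lambda>v. u * v) ` SU_nhd \<tau> \<epsilon> \<subseteq> V \<inter> W" if u: "u \<in> V \<inter> W" for u
    proof -
      obtain d e where "d > 0" "(\<lambda>v. u * v) ` SU_nhd \<tau> d \<subseteq> V"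
        "e > 0" "(\<lambda>v. u * v) ` SU_nhd \<tau> e \<subseteq> W" using V W u by blast
      moreover have "SU_nhd \<tau> (min d e) \<subseteq> SU_nhd \<tau> d \<inter> SU_nhd \<tau> e"
        by (auto simp: SU_nhd_def)
      ultimately show ?thesis by (intro exI[of _ "min d e"] conjI) (simp, blast)
    qed
    then show "?P (V \<inter> W)" using V by blast
  next
    fix \<K> assume K: "\<forall>K\<in>\<K>. ?P K"
    have "\<exists>\<epsilon>>0. (\<lambda>v. u * v) ` SU_nhd \<tau> \<epsilon> \<subseteq> \<Union>\<K>" if u: "u \<in> \<Union>\<K>" for u
    proof -
      obtain k where k: "k \<in> \<K>" "u \<in> k" using u by blast
      then obtain e where "e > 0" "(\<lambda>v. u * v) ` SU_nhd \<tau> e \<subseteq> k" using K by blast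
      then show ?thesis using k(1) by (intro exI[of _ e] conjI) (simp, blast)
    qed
    moreover have "\<Union>\<K> \<subseteq> SU \<tau>" using K by blast
    ultimately show "?P (\<Union>\<K>)" by blast
  qed
  then show ?thesis by (simp only: SU_topology_def topology_inverse')
qed


section \<open>Matrices over the algebra\<close>

text \<open>All matrix sizes are handled simultaneously by infinite matrices: \<open>M\<^sub>n(A)\<close> consists of the
  matrices vanishing outside the upper left \<open>n \<times> n\<close> block, while \<open>U(M\<^sub>n(A))\<close> consists of those
  agreeing with the infinite identity matrix outside that block, so that the stabilisation maps
  \<open>a \<mapsto> diag(a,0)\<close> and \<open>u \<mapsto> diag(u,1)\<close> are inclusions. On \<open>M\<^sub>n(A)\<close> the C*-norm topology is
  entrywise convergence, so it is the product topology of the function type.\<close>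

type_synonym 'a imat = "nat \<Rightarrow> nat \<Rightarrow> 'a"

definition mone :: "'a::cstar_algebra imat" where
  "mone i j = (if i = j then 1 else 0)"

text \<open>The sum is finite whenever \<open>a\<close> has finitely supported rows.\<close>

definition mmult :: "'a::cstar_algebra imat \<Rightarrow> 'a imat \<Rightarrow> 'a imat" where
  "mmult a b i j = (\<Sum>k | a i k * b k j \<noteq> 0. a i k * b k j)"

definition madj :: "'a::cstar_algebra imat \<Rightarrow> 'a imat" where
  "madj a i j = adj (a j i)"

definition mscale :: "complex \<Rightarrow> 'a::cstar_algebra imat \<Rightarrow> 'a imat" where
  "mscale c a i j = c *\<^sub>C a i j"

definition mpower :: "'a::cstar_algebra imat \<Rightarrow> nat \<Rightarrow> 'a imat" where
  "mpower a n = (mmult a ^^ n) mone"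

definition mexp :: "'a::cstar_algebra imat \<Rightarrow> 'a imat" where
  "mexp a i j = (\<Sum>n. mpower a n i j /\<^sub>R fact n)"

definition mtrace :: "('a::cstar_algebra \<Rightarrow> complex) \<Rightarrow> 'a imat \<Rightarrow> complex" where
  "mtrace \<tau> a = (\<Sum>i | a i i \<noteq> 0. \<tau> (a i i))"

definition Mat :: "nat \<Rightarrow> 'a::cstar_algebra imat set" where
  "Mat n = {a. \<forall>i j. n \<le> i \<or> n \<le> j \<longrightarrow> a i j = 0}"

definition U_mat :: "nat \<Rightarrow> 'a::cstar_algebra imat set" where
  "U_mat n = {u. (\<forall>i j. n \<le> i \<or> n \<le> j \<longrightarrow> u i j = mone i j) \<and>
     mmult (madj u) u = mone \<and> mmult u (madj u) = mone}"

definition U_inf :: "'a::cstar_algebra imat set" where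
  "U_inf = (\<Union>n. U_mat n)"

text \<open>\<open>U\<^sub>\<infinity>(A)\<close> carries the inductive limit topology.\<close>

definition U_inf_topology :: "'a::cstar_algebra imat topology" where
  "U_inf_topology =
     topology (\<lambda>W. W \<subseteq> U_inf \<and> (\<forall>n. openin (top_of_set (U_mat n)) (W \<inter> U_mat n)))"

lemma openin_U_inf_topology:
  "openin U_inf_topology W \<longleftrightarrow>
     W \<subseteq> U_inf \<and> (\<forall>n. openin (top_of_set (U_mat n)) (W \<inter> U_mat n))"
proof -
  let ?P = "\<lambda>W :: 'a imat set. W \<subseteq> U_inf \<and>
    (\<forall>n. openin (top_of_set (U_mat n)) (W \<inter> U_mat n))"
  have "istopology ?P"
    unfolding istopology_def
  proof (rule conjI; intro allI impI)
    fix V W assume V: "?P V" and W: "?P W"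
    have "V \<inter> W \<inter> U_mat n = (V \<inter> U_mat n) \<inter> (W \<inter> U_mat n)" for n by blast
    moreover have "openin (top_of_set (U_mat n)) ((V \<inter> U_mat n) \<inter> (W \<inter> U_mat n))" for n
      using V W by (intro openin_Int[of _ "V \<inter> U_mat n" "W \<inter> U_mat n"]) simp_all
    ultimately show "?P (V \<inter> W)" using V by auto
  next
    fix \<K> assume K: "\<forall>K\<in>\<K>. ?P K"
    have "\<Union>\<K> \<inter> U_mat n = (\<Union>K\<in>\<K>. K \<inter> U_mat n)" for n by blast
    moreover have "openin (top_of_set (U_mat n)) (\<Union>K\<in>\<K>. K \<inter> U_mat n)" for n
      using K by (intro openin_Union) auto
    moreover have "\<Union>\<K> \<subseteq> U_inf" using K by blast
    ultimately show "?P (\<Union>\<K>)" by simp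
  qed
  then show ?thesis by (simp only: U_inf_topology_def topology_inverse')
qed

definition U_inf0_group :: "'a::cstar_algebra imat monoid" where
  "U_inf0_group = \<lparr>carrier = connected_component_of_set U_inf_topology mone,
     monoid.mult = mmult, one = mone\<rparr>"

definition corner :: "'a::cstar_algebra \<Rightarrow> 'a imat" where
  "corner u i j = (if i = 0 \<and> j = 0 then u else mone i j)"


section \<open>The group \<open>K\<^sub>0(A)\<close> and the map \<open>B\<^sub>A\<close>\<close>

definition projections :: "'a::cstar_algebra imat set" where
  "projections = {p. (\<exists>n. p \<in> Mat n) \<and> madj p = p \<and> mmult p p = p}"

definition mvn_equiv :: "'a::cstar_algebra imat \<Rightarrow> 'a imat \<Rightarrow> bool" where
  "mvn_equiv p q \<longleftrightarrow> (\<exists>n. \<exists>v \<in> Mat n. mmult (madj v) v = p \<and> mmult v (madj v) = q)"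

text \<open>The orthogonal sum of two matrices, with \<open>p\<close> occupying the even and \<open>q\<close> the odd rows and
  columns. For \<open>p, q \<in> M\<^sub>n(A)\<close> it is conjugate to the block matrix \<open>diag(p,q)\<close> by a permutation
  matrix, but its definition does not depend on a choice of \<open>n\<close>.\<close>

definition msum :: "'a::cstar_algebra imat \<Rightarrow> 'a imat \<Rightarrow> 'a imat" where
  "msum p q i j =
     (if even i \<and> even j then p (i div 2) (j div 2)
      else if odd i \<and> odd j then q (i div 2) (j div 2) else 0)"

text \<open>\<open>K\<^sub>0(A)\<close> is the Grothendieck group of the monoid of Murray-von Neumann classes of
  projections; the class of \<open>(p, q)\<close> is \<open>[p] - [q]\<close>.\<close>

definition K0_rel :: "(('a::cstar_algebra imat \<times> 'a imat) \<times> ('a imat \<times> 'a imat)) set" where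
  "K0_rel = {((p, q), (p', q')). p \<in> projections \<and> q \<in> projections \<and>
     p' \<in> projections \<and> q' \<in> projections \<and>
     (\<exists>r \<in> projections. mvn_equiv (msum (msum p q') r) (msum (msum p' q) r))}"

definition K0 :: "('a::cstar_algebra imat \<times> 'a imat) set monoid" where
  "K0 = \<lparr>carrier = (projections \<times> projections) // K0_rel,
     monoid.mult = (\<lambda>X Y. the_elem
       ((\<lambda>((p, q), (p', q')). K0_rel `` {(msum p p', msum q q')}) ` (X \<times> Y))),
     one = K0_rel `` {(\<lambda>_ _. 0, \<lambda>_ _. 0)}\<rparr>"

definition bott_loop :: "'a::cstar_algebra imat \<Rightarrow> 'a imat \<Rightarrow> real \<Rightarrow> 'a imat" where
  "bott_loop p q t =
     mmult (mexp (mscale (2 * pi * \<i> * t) p)) (mexp (mscale (- (2 * pi * \<i> * t)) q))"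

definition bott_map ::
  "('a::cstar_algebra imat \<times> 'a imat) set \<Rightarrow> (real \<Rightarrow> 'a imat) set" where
  "bott_map X = the_elem ((\<lambda>(p, q). loop_rel U_inf_topology mone `` {bott_loop p q}) ` X)"

definition B_map ::
  "(real \<Rightarrow> 'a::cstar_algebra) set \<Rightarrow> ('a imat \<times> 'a imat) set" where
  "B_map = inv_into (carrier K0) bott_map \<circ> induced_pi1 U_inf_topology mone corner"

definition K0_trace ::
  "('a::cstar_algebra \<Rightarrow> complex) \<Rightarrow> ('a imat \<times> 'a imat) set \<Rightarrow> real" where
  "K0_trace \<tau> X = the_elem ((\<lambda>(p, q). Re (mtrace \<tau> p - mtrace \<tau> q)) ` X)"


section \<open>The de la Harpe--Skandalis determinant\<close>

definition smooth_on_unit :: "(real \<Rightarrow> 'a::real_normed_vector) \<Rightarrow> bool" where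
  "smooth_on_unit f \<longleftrightarrow> (\<exists>D :: nat \<Rightarrow> real \<Rightarrow> 'a. D 0 = f \<and>
     (\<forall>k. \<forall>t\<in>{0..1}. (D k has_vector_derivative D (Suc k) t) (at t within {0..1})))"

definition smooth_path_U :: "(real \<Rightarrow> 'a::cstar_algebra imat) \<Rightarrow> bool" where
  "smooth_path_U \<xi> \<longleftrightarrow> (\<exists>n. \<forall>t\<in>{0..1}. \<xi> t \<in> U_mat n) \<and>
     (\<forall>i j. smooth_on_unit (\<lambda>t. \<xi> t i j))"

definition path_deriv :: "(real \<Rightarrow> 'a::cstar_algebra imat) \<Rightarrow> real \<Rightarrow> 'a imat" where
  "path_deriv \<xi> t i j = vector_derivative (\<lambda>s. \<xi> s i j) (at t within {0..1})"

text \<open>Here \<open>\<xi>(t)\<^sup>-\<^sup>1\<close> is the adjoint of the unitary \<open>\<xi>(t)\<close>.\<close>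

definition path_det ::
  "('a::cstar_algebra \<Rightarrow> complex) \<Rightarrow> (real \<Rightarrow> 'a imat) \<Rightarrow> complex" where
  "path_det \<tau> \<xi> = 1 / (2 * pi * \<i>) *
     integral {0..1} (\<lambda>t. mtrace \<tau> (mmult (madj (\<xi> t)) (path_deriv \<xi> t)))"

definition K0_trace_range :: "('a::cstar_algebra \<Rightarrow> complex) \<Rightarrow> complex set" where
  "K0_trace_range \<tau> = (\<lambda>X. complex_of_real (K0_trace \<tau> X)) ` carrier K0"

definition dhs_det ::
  "('a::cstar_algebra \<Rightarrow> complex) \<Rightarrow> 'a imat \<Rightarrow> complex set" where
  "dhs_det \<tau> u = the_elem
     {K0_trace_range \<tau> #>\<^bsub>add_group\<^esub> path_det \<tau> \<xi> | \<xi>.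
        smooth_path_U \<xi> \<and> \<xi> 0 = mone \<and> \<xi> 1 = u}"

end

theory Submission
  imports Defs
begin

text \<open>
  Along a path \<open>f\<close> of unitaries starting at 1, the trace of the logarithm of \<open>f(t)\<close> can be followed
  continuously; its imaginary part at time 1 is a real number \<open>\<theta>(f)\<close>, called the phase of \<open>f\<close> below,
  which is \<open>2\<pi>\<close> times the de la Harpe--Skandalis integral of \<open>f\<close> when \<open>f\<close> is smooth. Since
  \<open>\<tau>(1) = 1\<close>, dividing by the scalar path \<open>exp(i\<theta>(f)t)\<close> makes the phase vanish, and the isomorphism
  is induced by \<open>f \<mapsto> (\<theta>(f), exp(-i\<theta>(f)) f(1))\<close> (\<open>split_phase\<close>).

  This is a homomorphism into \<open>\<real> \<times> SU\<^sub>\<tau>(A)\<close>: the phase is additive on pointwise products because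
  \<open>\<tau>(log(uv)) = \<tau>(log u) + \<tau>(log v)\<close> near 1 (\<open>logtr_mult\<close>), and writing \<open>f(1)\<close> as a product of
  \<open>exp(ih\<^sub>j)\<close> along a subdivision gives \<open>\<theta>(f) = \<Sum> \<tau>(h\<^sub>j)\<close>, so that the second component is the product
  of the \<open>exp(i(h\<^sub>j - \<tau>(h\<^sub>j)))\<close> (\<open>unitary_path_factorization\<close>). It is onto, as is seen on paths
  \<open>t \<mapsto> exp(ith)\<close>. It is continuous and open because near 1 a unitary and its logarithm determine
  each other with uniform bounds (\<open>split_phase_near\<close>, \<open>openin_translate_SU_nhd\<close>).

  The heart of the matter is the kernel: a loop of phase zero must be null-homotopic. Homotopic
  loops in \<open>U\<^sub>\<infinity>(A)\<close> have equal phase, computed in a normed algebra containing all \<open>M\<^sub>n(A)\<close>,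
  and the Bott loop of \<open>(p, q)\<close> has phase \<open>2\<pi>(\<tau>(p) - \<tau>(q))\<close> (\<open>phase_homotopic_bott_loop\<close>). Hence
  \<open>\<theta>(f) = 2\<pi> \<tau>\<^sub>*(B\<^sub>A[f])\<close> whenever \<open>f\<close> is homotopic in \<open>U\<^sub>\<infinity>(A)\<close> to the Bott loop of a
  representative of \<open>B\<^sub>A[f]\<close>. The map \<open>B\<^sub>A\<close> is put together from \<open>the_elem\<close> and \<open>inv_into\<close>, and the
  definitions yield this homotopy unless \<open>B\<^sub>A[f]\<close> is one of three fixed values; as \<open>B\<^sub>A\<close> is
  injective, all but at most three classes satisfy the formula (\<open>B_map_nonexceptional\<close>). Finitely
  many exceptions do no harm: \<open>K\<^sub>0(A)\<close> is infinite, since the trace takes every natural number as a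
  value, hence so is \<open>\<pi>\<^sub>1(U(A))\<close>. So for a loop \<open>g\<close> of phase zero there is a loop \<open>f\<close> such that the
  formula holds for both \<open>f\<close> and \<open>fg\<close>. These have the same phase, and injectivity of \<open>\<tau>\<^sub>*\<close> and of
  \<open>B\<^sub>A\<close> gives \<open>[f] = [fg]\<close>, whence \<open>[g] = 1\<close> (\<open>phase_zero_null\<close>).
\<close>

section \<open>The trace of the logarithm\<close>

text \<open>The functional is real because only the imaginary part of \<open>\<tau>\<close> matters: on logarithms of
  unitaries \<open>\<tau>\<close> is imaginary.\<close>

locale bounded_trace = bounded_linear \<sigma>
  for \<sigma> :: "'b::real_normed_algebra_1 \<Rightarrow> real" +
  assumes trace_commute: "\<sigma> (x * y) = \<sigma> (y * x)"
begin

text \<open>The functional applied to the logarithm series of \<open>u\<close> at 1. As a series of real numbers it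
  converges also in a normed algebra that is not complete, such as the matrix algebra below.\<close>

definition logtr :: "'b \<Rightarrow> real" where
  "logtr u = (\<Sum>k. (-1) ^ k * \<sigma> ((u - 1) ^ Suc k) / Suc k)"

text \<open>The derivative of \<open>logtr\<close> at \<open>u\<close> in the direction \<open>y\<close>, which formally is \<open>\<sigma>(u\<^sup>-\<^sup>1 y)\<close>.\<close>

definition dlog :: "'b \<Rightarrow> 'b \<Rightarrow> real" where
  "dlog u y = (\<Sum>k. (-1) ^ k * \<sigma> ((u - 1) ^ k * y))"

lemma trace_bound: "\<exists>K\<ge>0. \<forall>x. \<bar>\<sigma> x\<bar> \<le> K * norm x"
  using nonneg_bounded by (metis mult.commute real_norm_def)

lemma trace_power_bound:
  assumes "\<And>x. \<bar>\<sigma> x\<bar> \<le> K * norm x" "K \<ge> 0"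
  shows "\<bar>\<sigma> (x ^ k * y)\<bar> \<le> (K * norm y) * norm x ^ k"
proof -
  have "norm (x ^ k * y) \<le> norm x ^ k * norm y"
    by (meson norm_mult_ineq mult_right_mono norm_ge_zero norm_power_ineq order_trans)
  then have "K * norm (x ^ k * y) \<le> K * (norm x ^ k * norm y)"
    using assms(2) by (intro mult_left_mono)
  then show ?thesis using assms(1)[of "x ^ k * y"] by (simp add: mult_ac)
qed

lemma dlog_summable:
  assumes "norm (u - 1) < 1"
  shows "summable (\<lambda>k. (-1) ^ k * \<sigma> ((u - 1) ^ k * y))"
proof -
  obtain K where K: "K \<ge> 0" "\<And>x. \<bar>\<sigma> x\<bar> \<le> K * norm x" using trace_bound by blast
  show ?thesis
  proof (rule summable_comparison_test')
    show "summable (\<lambda>k. (K * norm y) * norm (u - 1) ^ k)"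
      using assms by (intro summable_mult summable_geometric) auto
    show "norm ((-1) ^ k * \<sigma> ((u - 1) ^ k * y)) \<le> (K * norm y) * norm (u - 1) ^ k" for k
      using trace_power_bound[of K "u - 1" k y] K by (simp add: abs_mult power_abs)
  qed
qed

lemma dlog_bound:
  assumes "\<And>x. \<bar>\<sigma> x\<bar> \<le> K * norm x" "K \<ge> 0" "norm (u - 1) < 1"
  shows "\<bar>dlog u y\<bar> \<le> K * norm y / (1 - norm (u - 1))"
proof -
  have "\<bar>dlog u y\<bar> \<le> (\<Sum>k. (K * norm y) * norm (u - 1) ^ k)"
    unfolding dlog_def real_norm_def[symmetric]
    using assms trace_power_bound[OF assms(1,2), of "u - 1" _ y]
    by (intro norm_suminf_le summable_mult summable_geometric) (auto simp: abs_mult power_abs)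
  also have "\<dots> = K * norm y / (1 - norm (u - 1))"
    using assms(3) by (subst suminf_mult) (auto simp: suminf_geometric summable_geometric)
  finally show ?thesis .
qed

lemma dlog_add:
  "norm (u - 1) < 1 \<Longrightarrow> dlog u (y + z) = dlog u y + dlog u z"
  unfolding dlog_def
  by (subst suminf_add) (auto intro!: dlog_summable simp: algebra_simps add)

text \<open>The geometric series for \<open>u\<^sup>-\<^sup>1\<close> telescopes against \<open>u\<close>.\<close>

lemma dlog_mult_left:
  assumes "norm (u - 1) < 1"
  shows "dlog u (u * z) = \<sigma> z"
proof -
  let ?f = "\<lambda>k. (-1) ^ k * \<sigma> ((u - 1) ^ k * z)"
  have "(\<lambda>k. ?f k - ?f (Suc k)) sums (?f 0 - 0)"
    by (intro telescope_sums' summable_LIMSEQ_zero dlog_summable assms)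
  moreover have "?f k - ?f (Suc k) = (-1) ^ k * \<sigma> ((u - 1) ^ k * (u * z))" for k
  proof -
    have "(u - 1) ^ k * (u * z) = (u - 1) ^ k * z + (u - 1) ^ Suc k * z"
      by (simp add: algebra_simps power_Suc2 del: power_Suc)
    then have "\<sigma> ((u - 1) ^ k * (u * z)) = \<sigma> ((u - 1) ^ k * z) + \<sigma> ((u - 1) ^ Suc k * z)"
      by (metis add)
    then show ?thesis by (simp only: power_Suc[of "-1 :: real"]) (simp add: algebra_simps)
  qed
  ultimately show ?thesis by (simp add: dlog_def sums_iff)
qed

text \<open>Formally \<open>\<sigma>((uv)\<^sup>-\<^sup>1 av) = \<sigma>(v\<^sup>-\<^sup>1 u\<^sup>-\<^sup>1 av) = \<sigma>(u\<^sup>-\<^sup>1 a)\<close> by the trace property. Without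
  completeness \<open>u\<close> need not have an inverse, so partial sums \<open>z N\<close> of the geometric series for
  \<open>u\<^sup>-\<^sup>1 a\<close> take its place.\<close>

lemma dlog_mult_right:
  assumes "norm (u - 1) < 1" "norm (u * v - 1) < 1" "v * v' = 1"
  shows "dlog (u * v) (a * v) = dlog u a"
proof -
  define x where "x = u - 1"
  define z where "z N = (\<Sum>k<N. (- x) ^ k * a)" for N
  obtain K where K: "K \<ge> 0" "\<And>x. \<bar>\<sigma> x\<bar> \<le> K * norm x" using trace_bound by blast
  \<comment> \<open>The factor \<open>u\<close> can be split off from \<open>a\<close> up to an error that tends to 0.\<close>
  have split: "a = u * z N + (- x) ^ N * a" for N
  proof (induction N)
    case (Suc N)
    have "u * z (Suc N) + (- x) ^ Suc N * a = u * z N + (u + - x) * ((- x) ^ N * a)"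
      by (simp add: z_def algebra_simps)
    also have "u + - x = 1" by (simp add: x_def)
    finally show ?case using Suc by simp
  qed (simp add: z_def)
  have "dlog (u * v) (a * v) = \<sigma> (z N) + dlog (u * v) ((- x) ^ N * a * v)" for N
  proof -
    have zv: "u * z N * v = (u * v) * (v' * z N * v)"
      using assms(3) by (simp add: mult.assoc[symmetric]) (simp add: mult.assoc)
    have "dlog (u * v) (a * v) = dlog (u * v) (u * z N * v + (- x) ^ N * a * v)"
      using split[of N] by (metis distrib_right)
    also have "\<dots> = dlog (u * v) ((u * v) * (v' * z N * v)) + dlog (u * v) ((- x) ^ N * a * v)"
      using assms(2) by (simp add: dlog_add zv)
    also have "dlog (u * v) ((u * v) * (v' * z N * v)) = \<sigma> (v' * z N * v)"
      by (rule dlog_mult_left[OF assms(2)])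
    also have "\<dots> = \<sigma> (z N)"
      using trace_commute[of "v' * z N" v] assms(3) by (simp add: mult.assoc[symmetric])
    finally show ?thesis .
  qed
  moreover have "(\<lambda>N. \<sigma> (z N)) \<longlonglongrightarrow> dlog u a"
  proof -
    have "\<sigma> (z N) = (\<Sum>k<N. (-1) ^ k * \<sigma> ((u - 1) ^ k * a))" for N
    proof -
      have "(- x) ^ k * a = (-1) ^ k *\<^sub>R (x ^ k * a)" for k
        by (cases "even k") auto
      then show ?thesis by (simp add: z_def sum x_def scaleR)
    qed
    then show ?thesis unfolding dlog_def
      using summable_LIMSEQ[OF dlog_summable[OF assms(1)]] by simp
  qed
  moreover have "(\<lambda>N. dlog (u * v) ((- x) ^ N * a * v)) \<longlonglongrightarrow> 0"
  proof (rule Lim_null_comparison)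
    let ?C = "K * norm (a * v) / (1 - norm (u * v - 1))"
    show "\<forall>\<^sub>F N in sequentially. norm (dlog (u * v) ((- x) ^ N * a * v)) \<le> ?C * norm x ^ N"
    proof (intro always_eventually allI)
      fix N
      have "norm ((- x) ^ N * a * v) \<le> norm ((- x) ^ N) * norm (a * v)"
        by (metis mult.assoc norm_mult_ineq)
      also have "\<dots> \<le> norm x ^ N * norm (a * v)"
        using norm_power_ineq[of "- x" N] by (intro mult_right_mono) auto
      finally have "norm ((- x) ^ N * a * v) \<le> norm x ^ N * norm (a * v)" .
      then have "K * norm ((- x) ^ N * a * v) / (1 - norm (u * v - 1))
          \<le> K * (norm x ^ N * norm (a * v)) / (1 - norm (u * v - 1))"
        using K(1) assms(2) by (intro divide_right_mono mult_left_mono) auto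
      then show "norm (dlog (u * v) ((- x) ^ N * a * v)) \<le> ?C * norm x ^ N"
        using dlog_bound[OF K(2,1) assms(2), of "(- x) ^ N * a * v"] by (simp add: mult_ac)
    qed
    show "(\<lambda>N. ?C * norm x ^ N) \<longlonglongrightarrow> 0"
      using assms(1) by (intro tendsto_mult_right_zero LIMSEQ_power_zero) (simp add: x_def)
  qed
  ultimately have "(\<lambda>N. dlog (u * v) (a * v)) \<longlonglongrightarrow> dlog u a + 0"
    using tendsto_add by fastforce
  then show ?thesis by (simp add: LIMSEQ_const_iff)
qed

text \<open>Under the trace all \<open>k + 1\<close> summands of the product rule for \<open>w\<^sup>k\<^sup>+\<^sup>1\<close> agree, although \<open>w\<close> and
  its derivative do not commute.\<close>

lemma has_vector_derivative_trace_power: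
  assumes "(w has_vector_derivative w') (at t within S)"
  shows "((\<lambda>s. \<sigma> (w s ^ Suc k)) has_real_derivative Suc k * \<sigma> (w t ^ k * w')) (at t within S)"
proof -
  define D where "D = rec_nat 0 (\<lambda>k d. w' * w t ^ k + w t * d)"
  have D: "D 0 = 0" "\<And>k. D (Suc k) = w' * w t ^ k + w t * D k" by (simp_all add: D_def)
  have der: "((\<lambda>s. w s ^ k) has_vector_derivative D k) (at t within S)" for k
  proof (induction k)
    case (Suc k)
    show ?case
      using has_vector_derivative_mult[OF assms Suc] by (simp add: D add.commute)
  qed (simp add: D)
  have "\<sigma> (w t ^ m * D (Suc k)) = Suc k * \<sigma> (w t ^ (m + k) * w')" for m k
  proof (induction k arbitrary: m)
    case 0
    then show ?case by (simp add: D)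
  next
    case (Suc k)
    have "\<sigma> (w t ^ m * D (Suc (Suc k))) =
        \<sigma> ((w t ^ m * w') * w t ^ Suc k) + \<sigma> (w t ^ Suc m * D (Suc k))"
      by (subst D(2)) (simp add: distrib_left add mult.assoc power_Suc2 del: power_Suc)
    also have "\<sigma> ((w t ^ m * w') * w t ^ Suc k) = \<sigma> (w t ^ (m + Suc k) * w')"
      by (subst trace_commute) (simp add: mult.assoc[symmetric] power_add[symmetric] add.commute
          del: power_Suc)
    also have "\<sigma> (w t ^ Suc m * D (Suc k)) = Suc k * \<sigma> (w t ^ (m + Suc k) * w')"
      using Suc[of "Suc m"] by simp
    finally show ?case by (simp add: algebra_simps)
  qed
  from this[of 0 k] have "\<sigma> (D (Suc k)) = Suc k * \<sigma> (w t ^ k * w')" by simp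
  moreover have "((\<lambda>s. \<sigma> (w s ^ Suc k)) has_vector_derivative \<sigma> (D (Suc k))) (at t within S)"
    by (rule has_vector_derivative[OF der])
  ultimately show ?thesis by (simp add: has_real_derivative_iff_has_vector_derivative)
qed

lemma logtr_1 [simp]: "logtr 1 = 0"
  by (simp add: logtr_def zero)

lemma logtr_summable:
  assumes "norm (u - 1) < 1"
  shows "summable (\<lambda>k. (-1) ^ k * \<sigma> ((u - 1) ^ Suc k) / Suc k)"
proof -
  obtain K where K: "K \<ge> 0" "\<And>x. \<bar>\<sigma> x\<bar> \<le> K * norm x" using trace_bound by blast
  show ?thesis
  proof (rule summable_comparison_test')
    show "summable (\<lambda>k. (K * norm (u - 1)) * norm (u - 1) ^ k)"
      using assms by (intro summable_mult summable_geometric) auto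
    fix k :: nat
    have "\<bar>\<sigma> ((u - 1) ^ Suc k)\<bar> / Suc k \<le> \<bar>\<sigma> ((u - 1) ^ Suc k)\<bar>"
      by (auto simp: divide_simps mult_le_cancel_left1)
    also have "\<dots> \<le> (K * norm (u - 1)) * norm (u - 1) ^ k"
      using trace_power_bound[OF K(2,1), of "u - 1" k "u - 1"]
      by (simp add: power_Suc2 del: power_Suc)
    finally show "norm ((-1) ^ k * \<sigma> ((u - 1) ^ Suc k) / Suc k) \<le> (K * norm (u - 1)) * norm (u - 1) ^ k"
      by (simp add: abs_mult power_abs)
  qed
qed

lemma logtr_conj:
  assumes "g * g' = 1" "g' * g = 1"
  shows "logtr (g' * u * g) = logtr u"
proof -
  have "(g' * u * g - 1) ^ k = g' * (u - 1) ^ k * g" for k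
  proof (induction k)
    case (Suc k)
    have "(g' * u * g - 1) ^ Suc k = (g' * (u - 1) * g) * (g' * (u - 1) ^ k * g)"
      using Suc assms by (simp add: algebra_simps)
    also have "\<dots> = g' * (u - 1) * (g * g') * (u - 1) ^ k * g" by (simp add: mult.assoc)
    finally show ?case using assms by (simp add: mult.assoc)
  qed (simp add: assms)
  moreover have "\<sigma> (g' * x * g) = \<sigma> x" for x
    using trace_commute[of "g' * x" g] assms by (simp add: mult.assoc[symmetric])
  ultimately show ?thesis unfolding logtr_def by (simp del: power_Suc)
qed

lemma has_derivative_logtr:
  assumes "convex S" "t \<in> S" "\<rho> < 1"
    and w: "\<And>s. s \<in> S \<Longrightarrow> (w has_vector_derivative w' s) (at s within S)"
    and rho: "\<And>s. s \<in> S \<Longrightarrow> norm (w s - 1) \<le> \<rho>"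
    and M: "\<And>s. s \<in> S \<Longrightarrow> norm (w' s) \<le> M"
  shows "((\<lambda>s. logtr (w s)) has_real_derivative dlog (w t) (w' t)) (at t within S)"
proof -
  obtain K where K: "K \<ge> 0" "\<And>x. \<bar>\<sigma> x\<bar> \<le> K * norm x" using trace_bound by blast
  let ?f = "\<lambda>k s. (-1) ^ k * \<sigma> ((w s - 1) ^ Suc k) / Suc k"
  let ?f' = "\<lambda>k s. (-1) ^ k * \<sigma> ((w s - 1) ^ k * w' s)"
  have rho0: "0 \<le> \<rho>" using rho[OF assms(2)] norm_ge_zero order_trans by blast
  have "\<exists>g. \<forall>s\<in>S. (\<lambda>k. ?f k s) sums g s \<and>
      (g has_field_derivative dlog (w s) (w' s)) (at s within S)"
  proof (rule has_field_derivative_series[OF assms(1) _ _ assms(2)])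
    fix k s assume s: "s \<in> S"
    have "((\<lambda>s. w s - 1) has_vector_derivative w' s) (at s within S)"
      using has_vector_derivative_diff[OF w[OF s] has_vector_derivative_const[of 1]] by simp
    from has_vector_derivative_trace_power[OF this, of k]
    have "((\<lambda>s. \<sigma> ((w s - 1) ^ Suc k)) has_real_derivative Suc k * \<sigma> ((w s - 1) ^ k * w' s))
        (at s within S)" .
    from DERIV_cmult[OF this, of "(-1) ^ k / Suc k"]
    show "(?f k has_field_derivative ?f' k s) (at s within S)"
      by (simp add: divide_simps mult.assoc mult.left_commute del: power_Suc of_nat_Suc)
  next
    show "uniform_limit S (\<lambda>n s. \<Sum>k<n. ?f' k s) (\<lambda>s. dlog (w s) (w' s)) sequentially"
      unfolding dlog_def
    proof (rule Weierstrass_m_test)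
      show "summable (\<lambda>k. (K * M) * \<rho> ^ k)"
        using assms(3) rho0 by (intro summable_mult summable_geometric) auto
      fix k s assume s: "s \<in> S"
      have "\<bar>\<sigma> ((w s - 1) ^ k * w' s)\<bar> \<le> (K * norm (w' s)) * norm (w s - 1) ^ k"
        by (rule trace_power_bound[OF K(2,1)])
      also have "\<dots> \<le> (K * M) * \<rho> ^ k"
        using K(1) s M[OF s] rho[OF s] rho0
        by (intro mult_mono power_mono mult_nonneg_nonneg) (auto intro: order_trans[OF norm_ge_zero])
      finally show "norm (?f' k s) \<le> (K * M) * \<rho> ^ k" by (simp add: abs_mult power_abs)
    qed
  next
    show "summable (\<lambda>k. ?f k t)"
      using rho[OF assms(2)] assms(3) by (intro logtr_summable) auto
  qed
  then obtain g where g: "\<And>s. s \<in> S \<Longrightarrow> (\<lambda>k. ?f k s) sums g s"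
    "\<And>s. s \<in> S \<Longrightarrow> (g has_field_derivative dlog (w s) (w' s)) (at s within S)" by blast
  have "logtr (w s) = g s" if "s \<in> S" for s
    using g(1)[OF that] unfolding logtr_def by (rule sums_unique[symmetric])
  then show ?thesis
    by (intro has_field_derivative_transform_within[OF g(2)[OF assms(2)] zero_less_one assms(2)]) auto
qed

text \<open>This covers \<open>t \<mapsto> exp(tx)\<close>; stating it through the differential equation makes it apply
  also where no exponential is available.\<close>

lemma logtr_one_parameter:
  assumes "convex S" "0 \<in> S" "\<rho> < 1" "w 0 = 1" "t \<in> S"
    and w: "\<And>s. s \<in> S \<Longrightarrow> (w has_vector_derivative w s * x) (at s within S)"
    and rho: "\<And>s. s \<in> S \<Longrightarrow> norm (w s - 1) \<le> \<rho>"
  shows "logtr (w t) = t * \<sigma> x"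
proof -
  have M: "norm (w s * x) \<le> 2 * norm x" if "s \<in> S" for s
  proof -
    have "norm (w s) \<le> norm (w s - 1) + norm (1 :: 'b)" by norm
    then have "norm (w s) \<le> 2" using rho[OF that] assms(3) by simp
    then show ?thesis by (meson norm_mult_ineq mult_right_mono norm_ge_zero order_trans)
  qed
  have "((\<lambda>s. logtr (w s) - s * \<sigma> x) has_real_derivative 0) (at s within S)" if "s \<in> S" for s
  proof -
    have "norm (w s - 1) < 1" using rho[OF that] assms(3) by linarith
    then have "dlog (w s) (w s * x) = \<sigma> x" by (rule dlog_mult_left)
    then have "((\<lambda>s. logtr (w s)) has_real_derivative \<sigma> x) (at s within S)"
      using has_derivative_logtr[OF assms(1) that assms(3) w rho M] by simp
    then show ?thesis by (auto intro!: derivative_eq_intros)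
  qed
  from has_field_derivative_zero_constant[OF assms(1) this]
  obtain c where c: "\<And>s. s \<in> S \<Longrightarrow> logtr (w s) - s * \<sigma> x = c" by blast
  show ?thesis using c[OF assms(2)] c[OF assms(5)] assms(4) by simp
qed

text \<open>Along the segment from 1 to \<open>u\<close> the functions \<open>logtr (w t * v)\<close> and \<open>logtr (w t)\<close> have the
  same derivative, so their difference keeps its initial value \<open>logtr v\<close>. The bound \<open>1/4\<close> keeps the
  product within the disc of convergence.\<close>

lemma logtr_mult:
  assumes u: "norm (u - 1) \<le> 1 / 4" and v: "norm (v - 1) \<le> 1 / 4" and v': "v * v' = 1"
  shows "logtr (u * v) = logtr u + logtr v"
proof -
  define a where "a = u - 1"
  define w where "w t = 1 + t *\<^sub>R a" for t :: real
  let ?S = "{0..1::real}"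
  have a: "norm a \<le> 1 / 4" using u by (simp add: a_def)
  have w1: "norm (w t - 1) \<le> 1 / 4" if "t \<in> ?S" for t
    using that a mult_left_le_one_le[of "norm a" t] by (auto simp: w_def)
  have w2: "norm (w t * v - 1) \<le> 9 / 16" if "t \<in> ?S" for t
  proof -
    have "w t * v - 1 = (w t - 1) + (v - 1) + (w t - 1) * (v - 1)" by (simp add: algebra_simps)
    also have "norm \<dots> \<le> norm (w t - 1) + norm (v - 1) + norm (w t - 1) * norm (v - 1)"
      by (meson norm_mult_ineq norm_triangle_mono order_refl)
    also have "norm (w t - 1) * norm (v - 1) \<le> 1 / 4 * (1 / 4)"
      using w1[OF that] v by (intro mult_mono) auto
    finally show ?thesis using w1[OF that] v by simp
  qed
  have dw: "(w has_vector_derivative a) (at t within ?S)" for t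
    unfolding w_def by (auto intro!: derivative_eq_intros)
  have dwv: "((\<lambda>t. w t * v) has_vector_derivative a * v) (at t within ?S)" for t
    using has_vector_derivative_mult[OF dw has_vector_derivative_const[of v]] by simp
  have "((\<lambda>t. logtr (w t * v) - logtr (w t)) has_real_derivative 0) (at t within ?S)"
    if t: "t \<in> ?S" for t
  proof -
    have "((\<lambda>s. logtr (w s * v)) has_real_derivative dlog (w t * v) (a * v)) (at t within ?S)"
      using w2 dwv by (intro has_derivative_logtr[OF _ t, where \<rho> = "9/16" and M = "norm (a * v)"]) auto
    moreover have "((\<lambda>s. logtr (w s)) has_real_derivative dlog (w t) a) (at t within ?S)"
      using w1 dw by (intro has_derivative_logtr[OF _ t, where \<rho> = "1/4" and M = "norm a"]) auto
    moreover have "dlog (w t * v) (a * v) = dlog (w t) a"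
      using w1[OF t] w2[OF t] by (intro dlog_mult_right[OF _ _ v']) auto
    ultimately show ?thesis using DERIV_diff by fastforce
  qed
  from has_field_derivative_zero_constant[OF _ this]
  obtain c where c: "\<And>s. s \<in> ?S \<Longrightarrow> logtr (w s * v) - logtr (w s) = c" by auto
  show ?thesis using c[of 0] c[of 1] by (simp add: w_def a_def)
qed

section \<open>The phase of a path of invertible elements\<close>

text \<open>The algebra has no inversion operation, so a path of invertible elements comes with its path
  of inverses.\<close>

definition inv_path :: "(real \<Rightarrow> 'b) \<Rightarrow> (real \<Rightarrow> 'b) \<Rightarrow> bool" where
  "inv_path f f' \<longleftrightarrow> continuous_on {0..1} f \<and> continuous_on {0..1} f' \<and>
     (\<forall>t\<in>{0..1}. f t * f' t = 1 \<and> f' t * f t = 1)"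

text \<open>\<open>L\<close> is a branch of \<open>\<sigma>(log f)\<close> along the path, up to an additive constant.\<close>

definition lift :: "(real \<Rightarrow> 'b) \<Rightarrow> (real \<Rightarrow> 'b) \<Rightarrow> (real \<Rightarrow> real) \<Rightarrow> bool" where
  "lift f f' L \<longleftrightarrow>
     (\<exists>\<delta>>0. \<forall>s\<in>{0..1}. \<forall>t\<in>{0..1}. \<bar>s - t\<bar> < \<delta> \<longrightarrow> L t - L s = logtr (f' s * f t))"

definition has_phase :: "(real \<Rightarrow> 'b) \<Rightarrow> real \<Rightarrow> bool" where
  "has_phase f d \<longleftrightarrow> (\<exists>f' L. inv_path f f' \<and> lift f f' L \<and> d = L 1 - L 0)"

lemma inv_path_near:
  assumes "inv_path f f'" "\<epsilon> > 0"
  obtains \<delta> where "\<delta> > 0"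
    "\<And>s t. s \<in> {0..1} \<Longrightarrow> t \<in> {0..1} \<Longrightarrow> \<bar>s - t\<bar> < \<delta> \<Longrightarrow> norm (f' s * f t - 1) < \<epsilon>"
proof -
  have "compact (f' ` {0..1})"
    using assms(1) by (intro compact_continuous_image) (auto simp: inv_path_def)
  then obtain M where M: "M > 0" "\<And>s. s \<in> {0..1} \<Longrightarrow> norm (f' s) \<le> M"
    using bounded_pos compact_imp_bounded by (metis imageI)
  have "uniformly_continuous_on {0..1} f"
    using assms(1) by (intro compact_uniformly_continuous) (auto simp: inv_path_def)
  moreover have "\<epsilon> / M > 0" using assms(2) M(1) by simp
  ultimately obtain \<delta> where \<delta>: "\<delta> > 0"
    "\<And>s t. s \<in> {0..1} \<Longrightarrow> t \<in> {0..1} \<Longrightarrow> dist s t < \<delta> \<Longrightarrow> dist (f s) (f t) < \<epsilon> / M"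
    by (metis uniformly_continuous_on_def)
  show ?thesis
  proof (rule that[OF \<delta>(1)])
    fix s t :: real assume st: "s \<in> {0..1}" "t \<in> {0..1}" "\<bar>s - t\<bar> < \<delta>"
    have "f' s * f t - 1 = f' s * (f t - f s)"
      using assms(1) st by (simp add: inv_path_def algebra_simps)
    also have "norm \<dots> \<le> norm (f' s) * norm (f t - f s)" by (rule norm_mult_ineq)
    also have "\<dots> \<le> M * norm (f t - f s)" using M(2)[OF st(1)] by (intro mult_right_mono) auto
    also have "\<dots> < M * (\<epsilon> / M)"
      using \<delta>(2)[OF st(1,2)] st(3) M(1) by (intro mult_strict_left_mono) (auto simp: dist_norm norm_minus_commute)
    finally show "norm (f' s * f t - 1) < \<epsilon>" using M(1) by simp
  qed
qed

lemma locally_constant_unit: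
  fixes D :: "real \<Rightarrow> 'c"
  assumes "\<delta> > 0"
    and "\<And>s t. s \<in> {0..1} \<Longrightarrow> t \<in> {0..1} \<Longrightarrow> \<bar>s - t\<bar> < \<delta> \<Longrightarrow> D s = D t"
  shows "D 0 = D 1"
proof -
  obtain n :: nat where n: "n > 0" "1 / n < \<delta>"
    using assms(1) by (metis ex_inverse_of_nat_less inverse_eq_divide)
  have "D 0 = D (k / n)" if "k \<le> n" for k
    using that
  proof (induction k)
    case (Suc k)
    have "D (k / n) = D (Suc k / n)"
    proof (rule assms(2))
      show "k / n \<in> {0..1}" "Suc k / n \<in> {0..1}"
        using Suc.prems n(1) by (auto simp: divide_simps)
      have "k / n - Suc k / n = - (1 / n)" by (simp add: diff_divide_distrib[symmetric])
      then show "\<bar>k / n - Suc k / n\<bar> < \<delta>" using n by simp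
    qed
    then show ?case using Suc by simp
  qed simp
  from this[of n] show ?thesis using n by simp
qed

lemma inverse_unique_monoid:
  fixes x :: 'b
  assumes "y * x = 1" "x * z = 1" shows "y = z"
  using assms by (metis mult.assoc mult.left_neutral mult.right_neutral)

text \<open>Two lifts differ by a locally constant function.\<close>

lemma has_phase_unique:
  assumes "has_phase f d" "has_phase f e"
  shows "d = e"
proof -
  from assms obtain f' L f'' M where
    f: "inv_path f f'" "inv_path f f''" and L: "lift f f' L" and M: "lift f f'' M"
    and de: "d = L 1 - L 0" "e = M 1 - M 0" unfolding has_phase_def by blast
  have same: "f' s = f'' s" if "s \<in> {0..1}" for s
    by (rule inverse_unique_monoid[of _ "f s"]) (use f that in \<open>simp_all add: inv_path_def\<close>)
  obtain \<delta>1 where \<delta>1: "\<delta>1 > 0" "\<And>s t. s \<in> {0..1} \<Longrightarrow> t \<in> {0..1} \<Longrightarrow> \<bar>s - t\<bar> < \<delta>1 \<Longrightarrow>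
      L t - L s = logtr (f' s * f t)" using L unfolding lift_def by blast
  obtain \<delta>2 where \<delta>2: "\<delta>2 > 0" "\<And>s t. s \<in> {0..1} \<Longrightarrow> t \<in> {0..1} \<Longrightarrow> \<bar>s - t\<bar> < \<delta>2 \<Longrightarrow>
      M t - M s = logtr (f'' s * f t)" using M unfolding lift_def by blast
  have "(\<lambda>t. L t - M t) 0 = (\<lambda>t. L t - M t) 1"
  proof (rule locally_constant_unit)
    show "min \<delta>1 \<delta>2 > 0" using \<delta>1 \<delta>2 by simp
    fix s t :: real assume "s \<in> {0..1}" "t \<in> {0..1}" "\<bar>s - t\<bar> < min \<delta>1 \<delta>2"
    then have "L t - L s = M t - M s" using \<delta>1(2)[of s t] \<delta>2(2)[of s t] same by simp
    then show "L s - M s = L t - M t" by simp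
  qed
  then show ?thesis using de by simp
qed

lemma has_phase_cong:
  assumes "has_phase f d" "\<And>t. t \<in> {0..1} \<Longrightarrow> f t = g t"
  shows "has_phase g d"
proof -
  from assms(1) obtain f' L where "inv_path f f'" "lift f f' L" "d = L 1 - L 0"
    unfolding has_phase_def by blast
  moreover from this have "inv_path g f'"
    using assms(2) continuous_on_cong[of "{0..1}" "{0..1}" f g] unfolding inv_path_def by simp
  moreover have "lift g f' L"
    using \<open>lift f f' L\<close> assms(2) unfolding lift_def by simp
  ultimately show ?thesis unfolding has_phase_def by blast
qed

lemma inv_path_mult:
  "inv_path f f' \<Longrightarrow> inv_path g g' \<Longrightarrow> inv_path (\<lambda>t. f t * g t) (\<lambda>t. g' t * f' t)"
  unfolding inv_path_def
proof (intro conjI ballI, goal_cases)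
  case (3 t)
  have "f t * g t * (g' t * f' t) = f t * (g t * g' t) * f' t" by (simp add: mult.assoc)
  then show ?case using 3 by simp
next
  case (4 t)
  have "g' t * f' t * (f t * g t) = g' t * (f' t * f t) * g t" by (simp add: mult.assoc)
  then show ?case using 4 by simp
qed (auto intro: continuous_on_mult)

text \<open>The sum of the lifts is a lift of the product: the increment
  \<open>g(s)\<^sup>-\<^sup>1 (f(s)\<^sup>-\<^sup>1 f(t)) g(t)\<close> is a conjugate of the increment of \<open>f\<close> times the increment of \<open>g\<close>.\<close>

lemma has_phase_mult:
  assumes "has_phase f d" "has_phase g e"
  shows "has_phase (\<lambda>t. f t * g t) (d + e)"
proof -
  from assms obtain f' L g' M where
    f: "inv_path f f'" and g: "inv_path g g'" and L: "lift f f' L" and M: "lift g g' M"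
    and de: "d = L 1 - L 0" "e = M 1 - M 0" unfolding has_phase_def by blast
  obtain \<delta>1 where \<delta>1: "\<delta>1 > 0" "\<And>s t. s \<in> {0..1} \<Longrightarrow> t \<in> {0..1} \<Longrightarrow> \<bar>s - t\<bar> < \<delta>1 \<Longrightarrow>
      L t - L s = logtr (f' s * f t)" using L unfolding lift_def by blast
  obtain \<delta>2 where \<delta>2: "\<delta>2 > 0" "\<And>s t. s \<in> {0..1} \<Longrightarrow> t \<in> {0..1} \<Longrightarrow> \<bar>s - t\<bar> < \<delta>2 \<Longrightarrow>
      M t - M s = logtr (g' s * g t)" using M unfolding lift_def by blast
  have "compact (g ` {0..1})" "compact (g' ` {0..1})"
    using g by (auto intro!: compact_continuous_image simp: inv_path_def)
  then have "bounded (g ` {0..1})" "bounded (g' ` {0..1})" by (simp_all add: compact_imp_bounded)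
  then obtain C1 C2 where C1: "C1 > 0" "\<And>s. s \<in> {0..1} \<Longrightarrow> norm (g s) \<le> C1"
    and C2: "C2 > 0" "\<And>s. s \<in> {0..1} \<Longrightarrow> norm (g' s) \<le> C2"
    unfolding bounded_pos by blast
  have "1 / (4 * (C1 * C2)) > 0" using C1 C2 by simp
  then obtain \<delta>3 where \<delta>3: "\<delta>3 > 0" "\<And>s t. s \<in> {0..1} \<Longrightarrow> t \<in> {0..1} \<Longrightarrow> \<bar>s - t\<bar> < \<delta>3 \<Longrightarrow>
      norm (f' s * f t - 1) < 1 / (4 * (C1 * C2))" using inv_path_near[OF f] by blast
  obtain \<delta>4 where \<delta>4: "\<delta>4 > 0" "\<And>s t. s \<in> {0..1} \<Longrightarrow> t \<in> {0..1} \<Longrightarrow> \<bar>s - t\<bar> < \<delta>4 \<Longrightarrow>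
      norm (g' s * g t - 1) < 1 / 4" using inv_path_near[OF g, of "1/4"] by auto
  have "lift (\<lambda>t. f t * g t) (\<lambda>t. g' t * f' t) (\<lambda>t. L t + M t)"
    unfolding lift_def
  proof (intro exI[of _ "Min {\<delta>1, \<delta>2, \<delta>3, \<delta>4}"] conjI ballI impI)
    show "Min {\<delta>1, \<delta>2, \<delta>3, \<delta>4} > 0" using \<delta>1 \<delta>2 \<delta>3 \<delta>4 by simp
    fix s t :: real assume st: "s \<in> {0..1}" "t \<in> {0..1}" "\<bar>s - t\<bar> < Min {\<delta>1, \<delta>2, \<delta>3, \<delta>4}"
    have gg: "g s * g' s = 1" "g' s * g s = 1" "g' t * g t = 1" "g t * g' t = 1"
      using g st by (auto simp: inv_path_def)
    let ?k = "f' s * f t"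
    have eq: "g' s * f' s * (f t * g t) = (g' s * ?k * g s) * (g' s * g t)"
      using gg by (metis mult.assoc mult.left_neutral)
    have "g' s * ?k * g s - 1 = g' s * (?k - 1) * g s"
      using gg by (simp add: algebra_simps)
    also have "norm \<dots> \<le> norm (g' s) * norm (?k - 1) * norm (g s)"
      by (meson norm_mult_ineq mult_right_mono norm_ge_zero order_trans)
    also have "\<dots> \<le> C2 * (1 / (4 * (C1 * C2))) * C1"
      using \<delta>3(2)[OF st(1,2)] st C1 C2 by (intro mult_mono) auto
    also have "\<dots> = 1 / 4" using C1(1) C2(1) by simp
    finally have "norm (g' s * ?k * g s - 1) \<le> 1 / 4" .
    moreover have "norm (g' s * g t - 1) \<le> 1 / 4" using \<delta>4(2)[OF st(1,2)] st(3) by simp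
    moreover have "(g' s * g t) * (g' t * g s) = 1"
      using gg by (metis mult.assoc mult.left_neutral)
    ultimately have "logtr (g' s * f' s * (f t * g t)) = logtr (g' s * ?k * g s) + logtr (g' s * g t)"
      unfolding eq by (rule logtr_mult)
    also have "\<dots> = logtr ?k + logtr (g' s * g t)" using gg by (simp add: logtr_conj)
    finally show "L t + M t - (L s + M s) = logtr (g' s * f' s * (f t * g t))"
      using \<delta>1(2)[OF st(1,2)] \<delta>2(2)[OF st(1,2)] st(3) by simp
  qed
  then show ?thesis
    unfolding has_phase_def using inv_path_mult[OF f g] de
    by (intro exI[of _ "\<lambda>t. g' t * f' t"] exI[of _ "\<lambda>t. L t + M t"]) auto
qed

text \<open>Near 1 the function \<open>logtr \<circ> k\<close> itself is a lift.\<close>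

lemma has_phase_near_1:
  assumes "inv_path k k'" "\<And>t. t \<in> {0..1} \<Longrightarrow> norm (k t - 1) \<le> 1 / 4"
  shows "has_phase k (logtr (k 1) - logtr (k 0))"
proof -
  obtain \<delta> where \<delta>: "\<delta> > 0" "\<And>s t. s \<in> {0..1} \<Longrightarrow> t \<in> {0..1} \<Longrightarrow> \<bar>s - t\<bar> < \<delta> \<Longrightarrow>
      norm (k' s * k t - 1) < 1 / 4" using inv_path_near[OF assms(1), of "1/4"] by auto
  have "logtr (k t) - logtr (k s) = logtr (k' s * k t)"
    if st: "s \<in> {0..1}" "t \<in> {0..1}" "\<bar>s - t\<bar> < \<delta>" for s t
  proof -
    have kk: "k s * k' s = 1" "k' s * k s = 1" "k' t * k t = 1" "k t * k' t = 1"
      using assms(1) st by (auto simp: inv_path_def)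
    have "(k' s * k t) * (k' t * k s) = 1" using kk by (metis mult.assoc mult.left_neutral)
    then have "logtr (k s * (k' s * k t)) = logtr (k s) + logtr (k' s * k t)"
      using \<delta>(2)[OF st] assms(2)[OF st(1)] by (intro logtr_mult) auto
    then show ?thesis using kk by (simp add: mult.assoc[symmetric])
  qed
  then have "lift k k' (\<lambda>t. logtr (k t))" unfolding lift_def using \<delta>(1) by blast
  then show ?thesis unfolding has_phase_def using assms(1) by blast
qed

lemma has_phase_const_1: "has_phase (\<lambda>_. 1) 0"
  using has_phase_near_1[of "\<lambda>_. 1" "\<lambda>_. 1"] by (simp add: inv_path_def)

lemma inv_path_inverse: "inv_path f f' \<Longrightarrow> inv_path f' f"
  by (auto simp: inv_path_def)

text \<open>The path \<open>g\<close> is the product of \<open>f\<close> with the path \<open>f\<^sup>-\<^sup>1 g\<close>, which stays near 1.\<close>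

lemma has_phase_transport:
  assumes "has_phase f d" "inv_path f f'" "inv_path g g'"
    and "\<And>t. t \<in> {0..1} \<Longrightarrow> norm (f' t * g t - 1) \<le> 1 / 4"
  shows "has_phase g (d + (logtr (f' 1 * g 1) - logtr (f' 0 * g 0)))"
proof -
  have "inv_path (\<lambda>t. f' t * g t) (\<lambda>t. g' t * f t)"
    by (intro inv_path_mult inv_path_inverse[OF assms(2)] assms(3))
  from has_phase_mult[OF assms(1) has_phase_near_1[OF this assms(4)]]
  show ?thesis
    by (rule has_phase_cong) (use assms(2) in \<open>auto simp: inv_path_def mult.assoc[symmetric]\<close>)
qed

text \<open>A homotopy through invertible elements can be cut into finitely many steps between uniformly
  close paths. The bound \<open>1/8\<close> is the radius on which unitaries have small logarithms.\<close>

lemma homotopy_near: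
  fixes H H' :: "real \<times> real \<Rightarrow> 'b"
  assumes "continuous_on ({0..1} \<times> {0..1}) H" "continuous_on ({0..1} \<times> {0..1}) H'"
    and inv: "\<And>z. z \<in> {0..1} \<times> {0..1} \<Longrightarrow> H z * H' z = 1 \<and> H' z * H z = 1"
  obtains n :: nat where "n > 0" "\<And>k t. k < n \<Longrightarrow> t \<in> {0..1} \<Longrightarrow>
     norm (H' (k / n, t) * H (Suc k / n, t) - 1) \<le> 1 / 8"
    "\<And>s. s \<in> {0..1} \<Longrightarrow> inv_path (\<lambda>t. H (s, t)) (\<lambda>t. H' (s, t))"
proof -
  let ?Q = "{0..1::real} \<times> {0..1::real}"
  have cpt: "compact ?Q" by (intro compact_Times compact_Icc)
  have "compact (H' ` ?Q)" by (intro compact_continuous_image assms cpt)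
  then obtain M where M: "M > 0" "\<And>z. z \<in> ?Q \<Longrightarrow> norm (H' z) \<le> M"
    using bounded_pos compact_imp_bounded by (metis imageI)
  have "uniformly_continuous_on ?Q H" by (intro compact_uniformly_continuous assms cpt)
  moreover have "1 / (8 * M) > 0" using M(1) by simp
  ultimately obtain \<delta> where \<delta>: "\<delta> > 0"
    "\<And>y z. y \<in> ?Q \<Longrightarrow> z \<in> ?Q \<Longrightarrow> dist y z < \<delta> \<Longrightarrow> dist (H y) (H z) < 1 / (8 * M)"
    by (metis uniformly_continuous_on_def)
  obtain n :: nat where n: "n > 0" "1 / n < \<delta>"
    using \<delta>(1) by (metis ex_inverse_of_nat_less inverse_eq_divide)
  show ?thesis
  proof (rule that[OF n(1)])
    fix k t assume k: "k < n" and t: "t \<in> {0..1::real}"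
    let ?y = "(k / n, t)" and ?z = "(Suc k / n, t)"
    have yz: "?y \<in> ?Q" "?z \<in> ?Q" using k t by (auto simp: divide_simps)
    have "Suc k / n - k / n = 1 / n" by (simp add: diff_divide_distrib[symmetric])
    then have "dist ?z ?y < \<delta>" using n by (simp add: dist_Pair_Pair dist_real_def)
    then have d: "norm (H ?z - H ?y) < 1 / (8 * M)" using \<delta>(2)[OF yz(2,1)] by (simp add: dist_norm)
    have "H' ?y * H ?z - 1 = H' ?y * (H ?z - H ?y)" using inv[OF yz(1)] by (simp add: algebra_simps)
    also have "norm \<dots> \<le> norm (H' ?y) * norm (H ?z - H ?y)" by (rule norm_mult_ineq)
    also have "\<dots> \<le> M * (1 / (8 * M))" using M(2)[OF yz(1)] d M(1) by (intro mult_mono) auto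
    finally show "norm (H' ?y * H ?z - 1) \<le> 1 / 8" using M(1) by simp
  next
    fix s :: real assume s: "s \<in> {0..1}"
    have "continuous_on {0..1} (\<lambda>t. H (s, t))" "continuous_on {0..1} (\<lambda>t. H' (s, t))"
      using s by (auto intro!: continuous_on_compose2[OF assms(1)] continuous_on_compose2[OF assms(2)]
          continuous_intros)
    then show "inv_path (\<lambda>t. H (s, t)) (\<lambda>t. H' (s, t))"
      using inv s unfolding inv_path_def by auto
  qed
qed

text \<open>In each small step of the homotopy the phase changes by the difference of \<open>logtr\<close> at the two
  ends, which vanishes because the end points do not move.\<close>

lemma has_phase_homotopy:
  fixes H H' :: "real \<times> real \<Rightarrow> 'b"
  assumes "continuous_on ({0..1} \<times> {0..1}) H" "continuous_on ({0..1} \<times> {0..1}) H'"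
    and inv: "\<And>z. z \<in> {0..1} \<times> {0..1} \<Longrightarrow> H z * H' z = 1 \<and> H' z * H z = 1"
    and ends: "\<And>s. s \<in> {0..1} \<Longrightarrow> H (s, 0) = H (0, 0)" "\<And>s. s \<in> {0..1} \<Longrightarrow> H (s, 1) = H (0, 1)"
    and d: "has_phase (\<lambda>t. H (0, t)) d"
  shows "has_phase (\<lambda>t. H (1, t)) d"
proof -
  obtain n :: nat where n: "n > 0" "\<And>k t. k < n \<Longrightarrow> t \<in> {0..1} \<Longrightarrow>
     norm (H' (k / n, t) * H (Suc k / n, t) - 1) \<le> 1 / 8"
    and ip: "\<And>s. s \<in> {0..1} \<Longrightarrow> inv_path (\<lambda>t. H (s, t)) (\<lambda>t. H' (s, t))"
    using homotopy_near[OF assms(1-3)] by blast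
  have "has_phase (\<lambda>t. H (k / n, t)) d" if "k \<le> n" for k
    using that
  proof (induction k)
    case (Suc k)
    have s: "k / n \<in> {0..1}" "Suc k / n \<in> {0..1}" using Suc.prems n(1) by (auto simp: divide_simps)
    have "H' (k / n, i) * H (Suc k / n, i) = 1" if "i = 0 \<or> i = 1" for i
    proof -
      have "H (k / n, i) = H (0, i)" "H (Suc k / n, i) = H (0, i)" using that ends s by blast+
      moreover have "(k / n, i) \<in> {0..1} \<times> {0..1}" using that s by auto
      ultimately show ?thesis using inv by metis
    qed
    moreover have "norm (H' (k / n, t) * H (Suc k / n, t) - 1) \<le> 1 / 4" if "t \<in> {0..1}" for t
      using n(2)[of k t] Suc.prems that by simp
    ultimately show ?case
      using has_phase_transport[OF _ ip[OF s(1)] ip[OF s(2)]] Suc by simp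
  qed (use d in simp)
  from this[of n] show ?thesis using n(1) by simp
qed

lemma has_phase_one_parameter:
  assumes add: "\<And>s t. w (s + t) = w s * w t" and 0: "w 0 = 1"
    and der: "\<And>t. (w has_vector_derivative w t * x) (at t)"
  shows "has_phase w (\<sigma> x)"
proof -
  have cont: "continuous_on UNIV w"
    by (intro continuous_at_imp_continuous_on ballI has_vector_derivative_continuous[OF der])
  have "isCont w 0" using has_vector_derivative_continuous[OF der] .
  then obtain \<delta> where \<delta>: "\<delta> > 0" "\<And>t. \<bar>t\<bar> < \<delta> \<Longrightarrow> norm (w t - 1) < 1 / 2"
    unfolding continuous_at_eps_delta
    by (metis 0 dist_norm diff_zero half_gt_zero_iff real_norm_def zero_less_one)
  have log: "logtr (w t) = t * \<sigma> x" if "\<bar>t\<bar> < \<delta>" for t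
  proof (rule logtr_one_parameter[where S = "ball 0 \<delta>" and \<rho> = "1 / 2"])
    show "(w has_vector_derivative w s * x) (at s within ball 0 \<delta>)" for s
      by (rule has_vector_derivative_at_within[OF der])
    show "norm (w s - 1) \<le> 1 / 2" if "s \<in> ball 0 \<delta>" for s
      using \<delta>(2)[of s] that by simp
  qed (use \<delta> that 0 in auto)
  have "inv_path w (\<lambda>t. w (- t))"
    unfolding inv_path_def using add[symmetric] 0
    by (auto intro!: continuous_on_compose2[OF cont] continuous_intros)
  moreover have "lift w (\<lambda>t. w (- t)) (\<lambda>t. t * \<sigma> x)"
    unfolding lift_def
  proof (intro exI[of _ \<delta>] conjI ballI impI)
    fix s t :: real assume "\<bar>s - t\<bar> < \<delta>"
    then have "logtr (w (- s + t)) = (- s + t) * \<sigma> x" by (intro log) simp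
    then show "t * \<sigma> x - s * \<sigma> x = logtr (w (- s) * w t)"
      unfolding assms(1)[of "- s" t] by (simp add: algebra_simps)
  qed (rule \<delta>(1))
  ultimately show ?thesis
    unfolding has_phase_def by (intro exI[of _ "\<lambda>t. w (- t)"] exI[of _ "\<lambda>t. t * \<sigma> x"]) simp
qed

end

section \<open>The exponential of a Banach algebra near zero\<close>

lemma norm_exp_minus_one_le:
  fixes x :: "'a::{real_normed_algebra_1,banach}"
  shows "norm (exp x - 1) \<le> exp (norm x) - 1"
proof -
  have "(\<lambda>n. x ^ Suc n /\<^sub>R fact (Suc n)) sums (exp x - 1)"
    using exp_converges[of x] by (subst sums_Suc_iff) simp
  moreover have "(\<lambda>n. norm x ^ Suc n /\<^sub>R fact (Suc n)) sums (exp (norm x) - 1)"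
    using exp_converges[of "norm x"] by (subst sums_Suc_iff) simp
  moreover have "norm (x ^ Suc n /\<^sub>R fact (Suc n)) \<le> norm x ^ Suc n /\<^sub>R fact (Suc n)" for n
    using norm_power_ineq[of x "Suc n"] by (simp add: divide_right_mono del: power_Suc fact_Suc)
  ultimately show ?thesis
    using norm_suminf_le[of "\<lambda>n. x ^ Suc n /\<^sub>R fact (Suc n)" "\<lambda>n. norm x ^ Suc n /\<^sub>R fact (Suc n)"]
    unfolding sums_iff by simp
qed

text \<open>The path \<open>exp(sx) exp((1 - s)y)\<close> from \<open>exp y\<close> to \<open>exp x\<close> has derivative
  \<open>exp(sx) (x - y) exp((1 - s)y)\<close>, which is close to \<open>x - y\<close>.\<close>

lemma exp_minus_id_contraction:
  fixes x y :: "'a::{real_normed_algebra_1,banach}"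
  assumes "norm x \<le> 1 / 4" "norm y \<le> 1 / 4"
  shows "norm ((exp x - x) - (exp y - y)) \<le> 1 / 2 * norm (x - y)"
proof -
  define g where "g s = exp (s *\<^sub>R x) * exp ((1 - s) *\<^sub>R y) - s *\<^sub>R (x - y)" for s :: real
  define g' where "g' s = exp (s *\<^sub>R x) * (x - y) * exp ((1 - s) *\<^sub>R y) - (x - y)" for s :: real
  have der: "(g has_vector_derivative g' s) (at s)" for s
  proof -
    have 1: "((\<lambda>s. exp (s *\<^sub>R x)) has_vector_derivative exp (s *\<^sub>R x) * x) (at s)"
      by (rule exp_scaleR_has_vector_derivative_right)
    have "((\<lambda>s. 1 - s) has_real_derivative -1) (at s)" by (auto intro!: derivative_eq_intros)
    from vector_diff_chain_at[OF this[unfolded has_real_derivative_iff_has_vector_derivative]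
        exp_scaleR_has_vector_derivative_left[of y]]
    have 2: "((\<lambda>s. exp ((1 - s) *\<^sub>R y)) has_vector_derivative - (y * exp ((1 - s) *\<^sub>R y))) (at s)"
      by (simp add: o_def)
    have 3: "((\<lambda>s. s *\<^sub>R (x - y)) has_vector_derivative x - y) (at s)"
      by (auto intro!: derivative_eq_intros)
    show ?thesis
      using has_vector_derivative_diff[OF has_vector_derivative_mult[OF 1 2] 3]
      by (simp add: g_def[abs_def] g'_def algebra_simps)
  qed
  have bound: "norm (g' s) \<le> 1 / 2 * norm (x - y)" if s: "s \<in> {0..1}" for s
  proof -
    let ?a = "s *\<^sub>R x" and ?b = "(1 - s) *\<^sub>R y" and ?z = "x - y"
    have "g' s = (exp ?a - 1) * ?z * exp ?b + ?z * (exp ?b - 1)"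
      by (simp add: g'_def algebra_simps)
    also have "norm \<dots> \<le> norm (exp ?a - 1) * norm ?z * norm (exp ?b) + norm ?z * norm (exp ?b - 1)"
      by (meson norm_triangle_mono norm_mult_ineq mult_right_mono norm_ge_zero order_trans)
    also have "\<dots> \<le> (exp (norm ?a) - 1) * norm ?z * exp (norm ?b) + norm ?z * (exp (norm ?b) - 1)"
      by (intro add_mono mult_mono norm_exp_minus_one_le norm_exp mult_nonneg_nonneg) auto
    also have "\<dots> = (exp (norm ?a + norm ?b) - 1) * norm ?z" by (simp add: exp_add algebra_simps)
    also have "\<dots> \<le> 1 / 2 * norm ?z"
    proof (rule mult_right_mono)
      have "norm ?a \<le> s * (1 / 4)" "norm ?b \<le> (1 - s) * (1 / 4)"
        using s assms mult_left_mono[of "norm x" "1/4" s] mult_left_mono[of "norm y" "1/4" "1 - s"]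
        by simp_all
      from add_mono[OF this] have "norm ?a + norm ?b \<le> 1 / 4" by (simp add: field_simps)
      then have "exp (norm ?a + norm ?b) \<le> exp (1 / 4)" by simp
      also have "\<dots> \<le> 1 + 1 / 4 + (1 / 4)\<^sup>2" by (rule exp_bound) auto
      finally show "exp (norm ?a + norm ?b) - 1 \<le> 1 / 2" by (simp add: power2_eq_square)
    qed simp
    finally show ?thesis .
  qed
  have "norm (g 1 - g 0) \<le> (1 / 2 * norm (x - y)) * 1 - (1 / 2 * norm (x - y)) * 0"
  proof (rule differentiable_bound_general[where f' = g' and \<phi>' = "\<lambda>_. 1 / 2 * norm (x - y)"])
    show "continuous_on {0..1} g"
      using der by (meson continuous_at_imp_continuous_on has_vector_derivative_continuous)
    show "((\<lambda>s. 1 / 2 * norm (x - y) * s) has_vector_derivative 1 / 2 * norm (x - y)) (at s)" for s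
      by (auto intro!: derivative_eq_intros simp flip: has_real_derivative_iff_has_vector_derivative)
    show "norm (g' s) \<le> 1 / 2 * norm (x - y)" if "0 < s" "s < 1" for s
      using bound that by simp
  qed (auto intro!: continuous_intros der)
  then show ?thesis by (simp add: g_def algebra_simps)
qed

lemma exp_inverse_lipschitz:
  fixes x y :: "'a::{real_normed_algebra_1,banach}"
  assumes "norm x \<le> 1 / 4" "norm y \<le> 1 / 4"
  shows "norm (x - y) \<le> 2 * norm (exp x - exp y)"
proof -
  have "x - y = (exp x - exp y) - ((exp x - x) - (exp y - y))" by simp
  then have "norm (x - y) \<le> norm (exp x - exp y) + norm ((exp x - x) - (exp y - y))"
    by (metis norm_triangle_ineq4)
  then show ?thesis using exp_minus_id_contraction[OF assms] by simp
qed

lemma norm_exp_minus_one_le_linear: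
  fixes x :: "'a::{real_normed_algebra_1,banach}"
  assumes "norm x \<le> 1 / 4"
  shows "norm (exp x - 1) \<le> 3 / 2 * norm x"
proof -
  have "exp x - 1 = x + ((exp x - x) - (exp 0 - 0))" by simp
  also have "norm \<dots> \<le> norm x + norm ((exp x - x) - (exp 0 - 0))" by (rule norm_triangle_ineq)
  finally show ?thesis using exp_minus_id_contraction[OF assms, of 0] by simp
qed

text \<open>The logarithm of \<open>u\<close> is the fixed point of the contraction \<open>x \<mapsto> x + (u - exp x)\<close>.\<close>

lemma exp_surj_near_1:
  fixes u :: "'a::{real_normed_algebra_1,banach}"
  assumes "norm (u - 1) \<le> 1 / 8"
  obtains x where "exp x = u" "norm x \<le> 2 * norm (u - 1)"
proof -
  define S where "S = cball (0::'a) (2 * norm (u - 1))"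
  define T where "T x = x + (u - exp x)" for x
  have S: "norm x \<le> 1 / 4" if "x \<in> S" for x using that assms by (simp add: S_def)
  have 0: "0 \<in> S" by (simp add: S_def)
  have T: "T ` S \<subseteq> S"
  proof (clarify)
    fix x assume x: "x \<in> S"
    have "T x = (u - 1) - ((exp x - x) - (exp 0 - 0))" by (simp add: T_def)
    also have "norm \<dots> \<le> norm (u - 1) + norm ((exp x - x) - (exp 0 - 0))" by (rule norm_triangle_ineq4)
    also have "\<dots> \<le> norm (u - 1) + 1 / 2 * norm (x - 0)"
      using exp_minus_id_contraction[OF S[OF x] S[OF 0]] by simp
    also have "\<dots> \<le> 2 * norm (u - 1)" using x by (simp add: S_def)
    finally show "T x \<in> S" by (simp add: S_def)
  qed
  have "dist (T x) (T y) \<le> 1 / 2 * dist x y" if "x \<in> S" "y \<in> S" for x y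
  proof -
    have "T x - T y = - ((exp x - x) - (exp y - y))" by (simp add: T_def)
    then have "norm (T x - T y) = norm ((exp x - x) - (exp y - y))" by (simp only: norm_minus_cancel)
    then show ?thesis using exp_minus_id_contraction[OF S[OF that(1)] S[OF that(2)]]
      by (simp add: dist_norm)
  qed
  then have "\<exists>!x. x \<in> S \<and> T x = x"
    using 0 T by (intro Banach_fix[where c = "1 / 2"]) (auto simp: S_def complete_eq_closed)
  then obtain x where "x \<in> S" "T x = x" by blast
  then show ?thesis using that[of x] by (simp add: S_def T_def)
qed

section \<open>Unitaries of a C*-algebra\<close>

lemma adj_0 [simp]: "adj (0 :: 'a::cstar_algebra) = 0"
  using adj_add[of "0::'a" 0] by simp

lemma adj_minus [simp]: "adj (- x) = - adj (x :: 'a::cstar_algebra)"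
  using adj_add[of x "- x"] by (simp add: eq_neg_iff_add_eq_0 add.commute)

lemma adj_diff: "adj (x - y) = adj x - adj (y :: 'a::cstar_algebra)"
  using adj_add[of x "- y"] by simp

lemma adj_1 [simp]: "adj (1 :: 'a::cstar_algebra) = 1"
  by (metis adj_adj adj_mult mult.left_neutral mult.right_neutral)

lemma adj_scaleR: "adj (r *\<^sub>R x) = r *\<^sub>R adj (x :: 'a::cstar_algebra)"
  by (metis adj_scaleC complex_cnj_complex_of_real scaleC_of_real)

lemma norm_adj [simp]: "norm (adj x) = norm (x :: 'a::cstar_algebra)"
proof -
  have le: "norm y \<le> norm (adj y)" for y :: 'a
  proof (cases "y = 0")
    case False
    have "norm y * norm y \<le> norm (adj y) * norm y"
      using cstar_identity[of y] norm_mult_ineq[of "adj y" y] by (simp add: power2_eq_square)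
    then show ?thesis using False by simp
  qed simp
  show ?thesis using le[of x] le[of "adj x"] by (simp add: adj_adj)
qed

lemma bounded_linear_adj: "bounded_linear (adj :: 'a::cstar_algebra \<Rightarrow> 'a)"
  by (rule bounded_linear_intro[where K = 1]) (auto simp: adj_add adj_scaleR)

lemmas continuous_on_adj [continuous_intros] = bounded_linear.continuous_on[OF bounded_linear_adj]

lemma adj_power: "adj (x ^ n) = adj (x :: 'a::cstar_algebra) ^ n"
  by (induction n) (auto simp: adj_mult power_Suc2 simp del: power_Suc, simp add: power_commutes)

lemma adj_exp: "adj (exp x) = exp (adj (x :: 'a::cstar_algebra))"
proof -
  have "(\<lambda>n. adj (x ^ n /\<^sub>R fact n)) sums adj (exp x)"
    by (rule bounded_linear.sums[OF bounded_linear_adj exp_converges])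
  moreover have "(\<lambda>n. adj (x ^ n /\<^sub>R fact n)) = (\<lambda>n. adj x ^ n /\<^sub>R fact n)"
    by (simp add: adj_scaleR adj_power)
  ultimately show ?thesis using exp_converges[of "adj x"] sums_unique2 by metis
qed

lemma bounded_linear_scaleC: "bounded_linear ((*\<^sub>C) c :: 'a::cstar_algebra \<Rightarrow> 'a)"
proof (rule bounded_linear_intro[where K = "cmod c"])
  show "c *\<^sub>C (r *\<^sub>R x) = r *\<^sub>R (c *\<^sub>C x)" for r and x :: 'a
    by (simp add: scaleC_of_real[symmetric] scaleC_scaleC mult.commute)
qed (auto simp: scaleC_add_right norm_scaleC mult.commute)

lemma bounded_linear_scaleC_left: "bounded_linear (\<lambda>c. c *\<^sub>C (x :: 'a::cstar_algebra))"
proof (rule bounded_linear_intro[where K = "norm x"])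
  show "(r *\<^sub>R c) *\<^sub>C x = r *\<^sub>R (c *\<^sub>C x)" for r c
    by (simp add: scaleC_of_real[symmetric] scaleC_scaleC scaleR_conv_of_real)
qed (auto simp: scaleC_add_left norm_scaleC)

lemma scaleC_minus_left [simp]: "(- c) *\<^sub>C x = - (c *\<^sub>C (x :: 'a::cstar_algebra))"
  by (rule linear_neg[OF bounded_linear.linear[OF bounded_linear_scaleC_left]])

lemma scaleC_minus_right [simp]: "c *\<^sub>C (- x) = - (c *\<^sub>C (x :: 'a::cstar_algebra))"
  by (rule linear_neg[OF bounded_linear.linear[OF bounded_linear_scaleC]])

lemma scaleC_one [simp]: "1 *\<^sub>C x = (x :: 'a::cstar_algebra)"
  using scaleC_of_real[of 1 x] by simp

lemma scaleC_zero_left [simp]: "0 *\<^sub>C x = (0 :: 'a::cstar_algebra)"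
  using scaleC_of_real[of 0 x] by simp

lemma scaleC_zero_right [simp]: "c *\<^sub>C 0 = (0 :: 'a::cstar_algebra)"
  using bounded_linear.linear[OF bounded_linear_scaleC] linear_0 by blast

lemma scaleC_scaleR: "c *\<^sub>C (r *\<^sub>R x) = r *\<^sub>R (c *\<^sub>C (x :: 'a::cstar_algebra))"
  by (rule linear_cmul[OF bounded_linear.linear[OF bounded_linear_scaleC]])

lemma unitariesD: "u \<in> unitaries \<Longrightarrow> adj u * u = 1" "u \<in> unitaries \<Longrightarrow> u * adj u = 1"
  by (auto simp: unitaries_def)

lemma one_unitary [simp]: "1 \<in> unitaries"
  by (simp add: unitaries_def)

lemma unitary_adj: "u \<in> unitaries \<Longrightarrow> adj u \<in> unitaries"
  by (simp add: unitaries_def adj_adj)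

lemma unitary_mult: "u \<in> unitaries \<Longrightarrow> v \<in> unitaries \<Longrightarrow> u * v \<in> unitaries"
  unfolding unitaries_def by (simp add: adj_mult) (metis mult.assoc mult.left_neutral)

lemma norm_unitary: "u \<in> unitaries \<Longrightarrow> norm u = 1"
  using cstar_identity[of u] unitariesD(1)[of u] by (simp add: power2_eq_square)
    (metis abs_norm_cancel norm_one power2_eq_1_iff power2_eq_square abs_1 abs_minus_cancel)

lemma exp_i_unitary: "adj h = h \<Longrightarrow> exp (\<i> *\<^sub>C h) \<in> unitaries"
  using exp_minus_inverse[of "\<i> *\<^sub>C h"] exp_minus_inverse[of "- (\<i> *\<^sub>C h)"]
  by (simp add: unitaries_def adj_exp adj_scaleC)

text \<open>If \<open>exp x = u\<close> with \<open>x\<close> small, then \<open>adj x\<close> and \<open>- x\<close> are small logarithms of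
  \<open>adj u\<close>, hence equal.\<close>

lemma unitary_log:
  assumes "u \<in> unitaries" "norm (u - 1) \<le> 1 / 8"
  obtains h where "adj h = h" "u = exp (\<i> *\<^sub>C h)" "norm h \<le> 2 * norm (u - 1)"
proof -
  obtain x where x: "exp x = u" "norm x \<le> 2 * norm (u - 1)"
    using exp_surj_near_1[OF assms(2)] by blast
  have "exp (- x) = adj u"
    using exp_minus_inverse[of "- x"] x(1) unitariesD(2)[OF assms(1)]
    by (metis minus_minus mult.assoc mult.left_neutral mult.right_neutral)
  then have "exp (adj x) = exp (- x)" using x(1) adj_exp by metis
  then have "norm (adj x - - x) \<le> 0"
    using exp_inverse_lipschitz[of "adj x" "- x"] x(2) assms(2) by simp
  then have "adj x = - x" by (simp add: eq_neg_iff_add_eq_0)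
  then show ?thesis
    using x by (intro that[of "(- \<i>) *\<^sub>C x"]) (auto simp: adj_scaleC scaleC_scaleC norm_scaleC)
qed

section \<open>Tracial states\<close>

lemma tracial_stateD:
  assumes "tracial_state \<tau>"
  shows "\<tau> (x + y) = \<tau> x + \<tau> y" "\<tau> (c *\<^sub>C x) = c * \<tau> x" "\<tau> (adj x * x) \<in> \<real>\<^sub>\<ge>\<^sub>0" "\<tau> 1 = 1"
    "\<tau> (x * y) = \<tau> (y * x)"
  using assms by (auto simp: tracial_state_def)

text \<open>The self-adjoint logarithm \<open>x\<close> of \<open>1 - z\<close> provides the square root \<open>exp(x/2)\<close>, so
  \<open>1 - z\<close> is positive.\<close>

lemma tracial_state_small_selfadjoint:
  assumes \<tau>: "tracial_state \<tau>" and z: "adj z = z" "norm z \<le> 1 / 8"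
  shows "\<tau> z \<in> \<real>" "Re (\<tau> z) \<le> 1"
proof -
  have "norm ((1 - z) - 1) \<le> 1 / 8" using z by simp
  then obtain x where x: "exp x = 1 - z" "norm x \<le> 2 * norm ((1 - z) - 1)"
    by (rule exp_surj_near_1)
  have "exp (adj x) = exp x" using x(1) z(1) by (metis adj_1 adj_diff adj_exp)
  then have "norm (adj x - x) \<le> 0"
    using exp_inverse_lipschitz[of "adj x" x] x(2) z(2) by simp
  then have "adj x = x" by simp
  define y where "y = exp ((1 / 2) *\<^sub>R x)"
  have "adj y = y" using \<open>adj x = x\<close> by (simp add: y_def adj_exp adj_scaleR)
  moreover have "y * y = exp x"
    using exp_add_commuting[of "(1 / 2) *\<^sub>R x" "(1 / 2) *\<^sub>R x"]
    by (simp add: y_def scaleR_left_distrib[symmetric])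
  ultimately have "\<tau> (1 - z) \<in> \<real>\<^sub>\<ge>\<^sub>0" using tracial_stateD(3)[OF \<tau>, of y] x(1) by simp
  moreover have "\<tau> (1 - z) = 1 - \<tau> z"
    using tracial_stateD(1)[OF \<tau>, of "1 - z" z] tracial_stateD(4)[OF \<tau>] by (simp add: eq_diff_eq)
  ultimately have "1 - \<tau> z \<in> \<real>\<^sub>\<ge>\<^sub>0" by simp
  then show "\<tau> z \<in> \<real>" "Re (\<tau> z) \<le> 1"
    by (auto simp: complex_nonneg_Reals_iff complex_is_Real_iff)
qed

lemma tracial_state_scaleR: "tracial_state \<tau> \<Longrightarrow> \<tau> (r *\<^sub>R x) = r * \<tau> x"
  by (metis scaleC_of_real tracial_stateD(2))

text \<open>Rescaling the previous bound; the factor 8 is the reciprocal of the radius on which it holds.\<close>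

lemma tracial_state_selfadjoint:
  assumes \<tau>: "tracial_state \<tau>" and z: "adj z = z"
  shows "\<tau> z \<in> \<real>" "\<bar>Re (\<tau> z)\<bar> \<le> 8 * norm z"
proof -
  define r where "r = 1 / (8 * norm z)"
  show "\<bar>Re (\<tau> z)\<bar> \<le> 8 * norm z"
  proof (cases "z = 0")
    case True
    then show ?thesis using tracial_state_scaleR[OF \<tau>, of 0 z] by simp
  next
    case False
    have "Re (\<tau> (r *\<^sub>R z)) \<le> 1" "Re (\<tau> ((- r) *\<^sub>R z)) \<le> 1"
      using False z by (auto intro!: tracial_state_small_selfadjoint[OF \<tau>] simp: r_def adj_scaleR)
    then have "r * \<bar>Re (\<tau> z)\<bar> \<le> 1" unfolding tracial_state_scaleR[OF \<tau>]
      by (auto simp: abs_if)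
    then show ?thesis using False by (simp add: r_def field_simps)
  qed
  show "\<tau> z \<in> \<real>"
  proof (cases "z = 0")
    case True
    then show ?thesis using tracial_state_scaleR[OF \<tau>, of 0 z] by simp
  next
    case False
    then have "r \<noteq> 0" by (simp add: r_def)
    moreover have "\<tau> (r *\<^sub>R z) \<in> \<real>"
      using False z by (intro tracial_state_small_selfadjoint(1)[OF \<tau>]) (auto simp: r_def adj_scaleR)
    ultimately show ?thesis unfolding tracial_state_scaleR[OF \<tau>]
      by (simp add: complex_is_Real_iff)
  qed
qed

lemma tracial_state_bound:
  assumes \<tau>: "tracial_state \<tau>"
  shows "\<bar>Im (\<tau> x)\<bar> \<le> 8 * norm x"
proof -
  define a where "a = (1 / 2) *\<^sub>R (x + adj x)"
  define b where "b = (- \<i> / 2) *\<^sub>C (x - adj x)"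
  have sa: "adj a = a" "adj b = b"
    by (simp_all add: a_def b_def adj_scaleR adj_add adj_adj adj_scaleC adj_diff add.commute)
      (metis minus_diff_eq scaleC_minus_right)
  have "\<i> *\<^sub>C b = (1 / 2) *\<^sub>R (x - adj x)"
    using scaleC_of_real[of "1 / 2" "x - adj x"] by (simp add: b_def scaleC_scaleC)
  then have "a + \<i> *\<^sub>C b = x" by (simp add: a_def scaleR_right_distrib[symmetric] flip: scaleR_2)
  then have "\<tau> x = \<tau> a + \<i> * \<tau> b" using tracial_stateD[OF \<tau>] by metis
  then have "Im (\<tau> x) = Re (\<tau> b)"
    using tracial_state_selfadjoint(1)[OF \<tau> sa(1)] by (simp add: complex_is_Real_iff)
  moreover have "norm b \<le> norm x"
    using norm_triangle_ineq4[of x "adj x"] by (simp add: b_def norm_scaleC)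
  ultimately show ?thesis using tracial_state_selfadjoint(2)[OF \<tau> sa(2)] by simp
qed

lemma bounded_trace_Im:
  assumes "tracial_state \<tau>"
  shows "bounded_trace (\<lambda>x. Im (\<tau> x))"
proof
  show "\<exists>K. \<forall>x. norm (Im (\<tau> x)) \<le> norm x * K"
    using tracial_state_bound[OF assms] by (intro exI[of _ 8]) (simp add: mult.commute)
qed (use assms in \<open>auto simp: tracial_stateD tracial_state_scaleR\<close>)

section \<open>The normed algebra of finite matrices\<close>

text \<open>The union of all \<open>M\<^sub>n(A)\<close>, with the sum of the norms of the entries as norm, is a normed
  algebra on which the trace is bounded.\<close>

definition finite_mat :: "'a::cstar_algebra imat \<Rightarrow> bool" where
  "finite_mat a \<longleftrightarrow> (\<exists>n. a \<in> Mat n)"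

definition mnorm :: "'a::cstar_algebra imat \<Rightarrow> real" where
  "mnorm a = (\<Sum>(i, j) | a i j \<noteq> 0. norm (a i j))"

lemma Mat_mono: "a \<in> Mat n \<Longrightarrow> n \<le> m \<Longrightarrow> a \<in> Mat m"
  by (simp add: Mat_def)

lemma finite_mat_common2:
  assumes "finite_mat a" "finite_mat b"
  obtains n where "a \<in> Mat n" "b \<in> Mat n"
  using assms unfolding finite_mat_def by (metis Mat_mono max.cobounded1 max.cobounded2)

lemma mmult_sum:
  assumes "\<And>k. k \<ge> n \<Longrightarrow> a i k * b k j = 0"
  shows "mmult a b i j = (\<Sum>k<n. a i k * b k j)"
  unfolding mmult_def
proof (rule sum.mono_neutral_left)
  show "{k. a i k * b k j \<noteq> 0} \<subseteq> {..<n}" using assms by (auto simp flip: not_le)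
qed auto

lemma mmult_Mat_sum: "a \<in> Mat n \<Longrightarrow> mmult a b i j = (\<Sum>k<n. a i k * b k j)"
  by (rule mmult_sum) (simp add: Mat_def)

lemma mmult_in_Mat: "a \<in> Mat n \<Longrightarrow> b \<in> Mat n \<Longrightarrow> mmult a b \<in> Mat n"
  unfolding Mat_def mmult_def by auto

lemma mnorm_Mat:
  assumes "a \<in> Mat n"
  shows "mnorm a = (\<Sum>i<n. \<Sum>j<n. norm (a i j))"
proof -
  have "mnorm a = (\<Sum>(i, j)\<in>{..<n} \<times> {..<n}. norm (a i j))"
    unfolding mnorm_def
  proof (rule sum.mono_neutral_left)
    show "{(i, j). a i j \<noteq> 0} \<subseteq> {..<n} \<times> {..<n}"
      using assms by (auto simp: Mat_def simp flip: not_le)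
  qed auto
  then show ?thesis by (simp add: sum.cartesian_product)
qed

lemma mtrace_Mat:
  assumes "a \<in> Mat n" "\<tau> 0 = 0"
  shows "mtrace \<tau> a = (\<Sum>i<n. \<tau> (a i i))"
  unfolding mtrace_def
proof (rule sum.mono_neutral_left)
  show "{i. a i i \<noteq> 0} \<subseteq> {..<n}" using assms(1) by (auto simp: Mat_def simp flip: not_le)
qed (use assms(2) in auto)

lemma mmult_assoc:
  assumes "a \<in> Mat n" "b \<in> Mat n"
  shows "mmult (mmult a b) c = mmult a (mmult b c)"
proof (intro ext)
  fix i j
  have "mmult (mmult a b) c i j = (\<Sum>k<n. \<Sum>l<n. a i l * b l k * c k j)"
    by (simp add: mmult_Mat_sum[OF mmult_in_Mat[OF assms]] mmult_Mat_sum[OF assms(1)]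
        sum_distrib_right)
  also have "\<dots> = (\<Sum>l<n. \<Sum>k<n. a i l * b l k * c k j)" by (rule sum.swap)
  also have "\<dots> = mmult a (mmult b c) i j"
    by (simp add: mmult_Mat_sum[OF assms(1)] mmult_Mat_sum[OF assms(2)] sum_distrib_left mult.assoc)
  finally show "mmult (mmult a b) c i j = mmult a (mmult b c) i j" .
qed

lemma Mat_add: "a \<in> Mat n \<Longrightarrow> b \<in> Mat n \<Longrightarrow> (\<lambda>i j. a i j + b i j) \<in> Mat n"
  by (simp add: Mat_def)

lemma Mat_scaleR: "a \<in> Mat n \<Longrightarrow> (\<lambda>i j. r *\<^sub>R a i j) \<in> Mat n"
  by (simp add: Mat_def)

lemma mmult_add_left:
  assumes "a \<in> Mat n" "b \<in> Mat n"
  shows "mmult (\<lambda>i j. a i j + b i j) c = (\<lambda>i j. mmult a c i j + mmult b c i j)"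
  by (intro ext) (simp add: mmult_Mat_sum[OF assms(1)] mmult_Mat_sum[OF assms(2)]
      mmult_Mat_sum[OF Mat_add[OF assms]] sum.distrib distrib_right)

lemma mmult_add_right:
  assumes "a \<in> Mat n"
  shows "mmult a (\<lambda>i j. b i j + c i j) = (\<lambda>i j. mmult a b i j + mmult a c i j)"
  by (intro ext) (simp add: mmult_Mat_sum[OF assms] sum.distrib distrib_left)

lemma mmult_scaleR_left:
  assumes "a \<in> Mat n"
  shows "mmult (\<lambda>i j. r *\<^sub>R a i j) b = (\<lambda>i j. r *\<^sub>R mmult a b i j)"
  by (intro ext) (simp add: mmult_Mat_sum[OF assms] mmult_Mat_sum[OF Mat_scaleR[OF assms]]
      scaleR_right.sum)

lemma mmult_scaleR_right:
  assumes "a \<in> Mat n"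
  shows "mmult a (\<lambda>i j. r *\<^sub>R b i j) = (\<lambda>i j. r *\<^sub>R mmult a b i j)"
  by (intro ext) (simp add: mmult_Mat_sum[OF assms] scaleR_right.sum)

lemma mnorm_mmult_le:
  assumes a: "a \<in> Mat n" and b: "b \<in> Mat n"
  shows "mnorm (mmult a b) \<le> mnorm a * mnorm b"
proof -
  have "mnorm (mmult a b) \<le> (\<Sum>i<n. \<Sum>j<n. \<Sum>k<n. norm (a i k) * norm (b k j))"
    unfolding mnorm_Mat[OF mmult_in_Mat[OF a b]] mmult_Mat_sum[OF a]
    by (intro sum_mono order_trans[OF norm_sum] norm_mult_ineq)
  also have "\<dots> = (\<Sum>i<n. \<Sum>k<n. \<Sum>j<n. norm (a i k) * norm (b k j))"
    by (intro sum.cong refl sum.swap)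
  also have "\<dots> = (\<Sum>i<n. \<Sum>k<n. norm (a i k) * (\<Sum>j<n. norm (b k j)))"
    by (simp add: sum_distrib_left)
  also have "\<dots> \<le> (\<Sum>i<n. \<Sum>k<n. norm (a i k) * mnorm b)"
  proof (intro sum_mono mult_left_mono)
    fix k assume "k \<in> {..<n}"
    then show "(\<Sum>j<n. norm (b k j)) \<le> mnorm b"
      unfolding mnorm_Mat[OF b]
      by (intro member_le_sum[where f = "\<lambda>k. \<Sum>j<n. norm (b k j)"]) (auto intro: sum_nonneg)
  qed auto
  also have "\<dots> = mnorm a * mnorm b" by (simp add: mnorm_Mat[OF a] sum_distrib_right)
  finally show ?thesis .
qed

typedef (overloaded) 'a fmat = "{a :: 'a::cstar_algebra imat. finite_mat a}"
  morphisms entries Fmat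
  by (rule exI[of _ "\<lambda>_ _. 0"]) (simp add: finite_mat_def Mat_def)

setup_lifting type_definition_fmat

lemma finite_mat_entrywise:
  assumes "finite_mat a" "finite_mat b" "F 0 0 = 0"
  shows "finite_mat (\<lambda>i j. F (a i j) (b i j))"
proof -
  obtain n where "a \<in> Mat n" "b \<in> Mat n" using finite_mat_common2 assms by blast
  then have "(\<lambda>i j. F (a i j) (b i j)) \<in> Mat n" using assms(3) by (simp add: Mat_def)
  then show ?thesis by (auto simp: finite_mat_def)
qed

instantiation fmat :: (cstar_algebra) real_normed_algebra
begin

lift_definition zero_fmat :: "'a fmat" is "\<lambda>_ _. 0"
  by (simp add: finite_mat_def Mat_def)

lift_definition plus_fmat :: "'a fmat \<Rightarrow> 'a fmat \<Rightarrow> 'a fmat" is "\<lambda>a b i j. a i j + b i j"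
  by (rule finite_mat_entrywise) auto

lift_definition minus_fmat :: "'a fmat \<Rightarrow> 'a fmat \<Rightarrow> 'a fmat" is "\<lambda>a b i j. a i j - b i j"
  by (rule finite_mat_entrywise) auto

lift_definition uminus_fmat :: "'a fmat \<Rightarrow> 'a fmat" is "\<lambda>a i j. - a i j"
  by (auto simp: finite_mat_def Mat_def)

lift_definition scaleR_fmat :: "real \<Rightarrow> 'a fmat \<Rightarrow> 'a fmat" is "\<lambda>r a i j. r *\<^sub>R a i j"
  by (auto simp: finite_mat_def Mat_def)

lift_definition times_fmat :: "'a fmat \<Rightarrow> 'a fmat \<Rightarrow> 'a fmat" is mmult
  by (metis finite_mat_common2 finite_mat_def mmult_in_Mat)

lift_definition norm_fmat :: "'a fmat \<Rightarrow> real" is mnorm .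

definition sgn_fmat :: "'a fmat \<Rightarrow> 'a fmat" where "sgn_fmat x = inverse (norm x) *\<^sub>R x"

definition dist_fmat :: "'a fmat \<Rightarrow> 'a fmat \<Rightarrow> real" where "dist_fmat x y = norm (x - y)"

definition uniformity_fmat :: "('a fmat \<times> 'a fmat) filter" where
  "uniformity_fmat = (INF e\<in>{0<..}. principal {(x, y). dist x y < e})"

definition open_fmat :: "'a fmat set \<Rightarrow> bool" where
  "open_fmat U \<longleftrightarrow> (\<forall>x\<in>U. \<forall>\<^sub>F (x', y) in uniformity. x' = x \<longrightarrow> y \<in> U)"

instance
proof
  fix x y z :: "'a fmat" and r s :: real
  show "x * y * z = x * (y * z)"
    by transfer (erule (1) finite_mat_common2, rule mmult_assoc)
  show "(x + y) * z = x * z + y * z"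
    by transfer (erule (1) finite_mat_common2, rule mmult_add_left)
  show "x * (y + z) = x * y + x * z"
    by transfer (unfold finite_mat_def, erule exE, rule mmult_add_right)
  show "(r *\<^sub>R x) * y = r *\<^sub>R (x * y)"
    by transfer (unfold finite_mat_def, erule exE, rule mmult_scaleR_left)
  show "x * (r *\<^sub>R y) = r *\<^sub>R (x * y)"
    by transfer (unfold finite_mat_def, erule exE, rule mmult_scaleR_right)
  show "norm (x * y) \<le> norm x * norm y"
    by transfer (erule (1) finite_mat_common2, rule mnorm_mmult_le)
  show "norm (x + y) \<le> norm x + norm y"
  proof (transfer, erule (1) finite_mat_common2)
    fix a b :: "'a imat" and n assume ab: "a \<in> Mat n" "b \<in> Mat n"
    then have "(\<lambda>i j. a i j + b i j) \<in> Mat n" by (rule Mat_add)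
    then show "mnorm (\<lambda>i j. a i j + b i j) \<le> mnorm a + mnorm b"
      using ab by (simp add: mnorm_Mat sum.distrib[symmetric] sum_mono norm_triangle_ineq)
  qed
  show "norm x = 0 \<longleftrightarrow> x = 0"
  proof (transfer)
    fix a :: "'a imat" assume "finite_mat a"
    then obtain n where n: "a \<in> Mat n" by (auto simp: finite_mat_def)
    then have "mnorm a = 0 \<longleftrightarrow> (\<forall>i<n. \<forall>j<n. a i j = 0)"
      by (simp add: mnorm_Mat sum_nonneg_eq_0_iff sum_nonneg Ball_def)
    also have "\<dots> \<longleftrightarrow> a = (\<lambda>_ _. 0)"
      using n by (auto simp: Mat_def fun_eq_iff) (meson not_less)
    finally show "mnorm a = 0 \<longleftrightarrow> a = (\<lambda>_ _. 0)" .
  qed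
  show "norm (r *\<^sub>R x) = \<bar>r\<bar> * norm x"
  proof (transfer)
    fix r :: real and a :: "'a imat" assume "finite_mat a"
    then obtain n where n: "a \<in> Mat n" by (auto simp: finite_mat_def)
    then have "(\<lambda>i j. r *\<^sub>R a i j) \<in> Mat n" by (simp add: Mat_def)
    then show "mnorm (\<lambda>i j. r *\<^sub>R a i j) = \<bar>r\<bar> * mnorm a"
      using n by (simp add: mnorm_Mat sum_distrib_left)
  qed
qed (simp_all add: sgn_fmat_def dist_fmat_def uniformity_fmat_def open_fmat_def,
    (transfer, simp add: algebra_simps)+)

end

text \<open>Adjoining a unit provides room for the elements of \<open>U\<^sub>\<infinity>(A)\<close>, which agree with the infinite
  identity matrix up to a finite matrix.\<close>

datatype 'b unitization = Adjoin (scalar: real) (nonscalar: 'b)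

instantiation unitization :: (real_normed_algebra) real_normed_algebra_1
begin

definition "0 = Adjoin 0 0"
definition "1 = Adjoin 1 0"
definition "x + y = Adjoin (scalar x + scalar y) (nonscalar x + nonscalar y)"
definition "x - y = Adjoin (scalar x - scalar y) (nonscalar x - nonscalar y)"
definition "- x = Adjoin (- scalar x) (- nonscalar x)"
definition "r *\<^sub>R x = Adjoin (r * scalar x) (r *\<^sub>R nonscalar x)"
definition "x * y = Adjoin (scalar x * scalar y)
  (scalar x *\<^sub>R nonscalar y + scalar y *\<^sub>R nonscalar x + nonscalar x * nonscalar y)"
definition "norm x = \<bar>scalar x\<bar> + norm (nonscalar x)"
definition sgn_unitization :: "'a unitization \<Rightarrow> 'a unitization" where
  "sgn_unitization x = inverse (norm x) *\<^sub>R x"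
definition dist_unitization :: "'a unitization \<Rightarrow> 'a unitization \<Rightarrow> real" where
  "dist_unitization x y = norm (x - y)"
definition uniformity_unitization :: "('a unitization \<times> 'a unitization) filter" where
  "uniformity_unitization = (INF e\<in>{0<..}. principal {(x, y). dist x y < e})"
definition open_unitization :: "'a unitization set \<Rightarrow> bool" where
  "open_unitization U \<longleftrightarrow> (\<forall>x\<in>U. \<forall>\<^sub>F (x', y) in uniformity. x' = x \<longrightarrow> y \<in> U)"

lemmas unitization_simps = zero_unitization_def one_unitization_def plus_unitization_def
  minus_unitization_def uminus_unitization_def scaleR_unitization_def times_unitization_def
  norm_unitization_def

instance
proof
  fix x y :: "'a unitization"
  show "norm (x * y) \<le> norm x * norm y"
  proof -
    let ?a = "nonscalar x" and ?b = "nonscalar y"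
    have "norm (scalar x *\<^sub>R ?b + scalar y *\<^sub>R ?a + ?a * ?b)
        \<le> \<bar>scalar x\<bar> * norm ?b + \<bar>scalar y\<bar> * norm ?a + norm ?a * norm ?b"
      by (intro norm_triangle_mono norm_mult_ineq) auto
    then show ?thesis by (simp add: unitization_simps abs_mult algebra_simps)
  qed
  show "norm (x + y) \<le> norm x + norm y"
    using norm_triangle_ineq[of "nonscalar x" "nonscalar y"] abs_triangle_ineq[of "scalar x" "scalar y"]
    by (simp add: unitization_simps)
  show "norm x = 0 \<longleftrightarrow> x = 0"
    by (cases x) (auto simp: unitization_simps add_nonneg_eq_0_iff)
qed (auto simp: unitization_simps algebra_simps abs_mult sgn_unitization_def dist_unitization_def
    uniformity_unitization_def open_unitization_def unitization.expand intro!: unitization.expand)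

end

section \<open>The stable unitary group inside a normed algebra\<close>

text \<open>The elements of \<open>U_mat n\<close> and the exponentials of elements of \<open>Mat n\<close> have this shape.\<close>

definition UMat :: "nat \<Rightarrow> 'a::cstar_algebra imat set" where
  "UMat n = {u. \<forall>i j. n \<le> i \<or> n \<le> j \<longrightarrow> u i j = mone i j}"

text \<open>The matrix \<open>u = 1 + (u - 1)\<close>, with 1 read as the adjoined unit.\<close>

definition emb :: "'a::cstar_algebra imat \<Rightarrow> 'a fmat unitization" where
  "emb u = Adjoin 1 (Fmat (\<lambda>i j. u i j - mone i j))"

lemma entries_Fmat: "a \<in> Mat n \<Longrightarrow> entries (Fmat a) = a"
  by (rule Fmat_inverse) (auto simp: finite_mat_def)

lemma Fmat_add: "a \<in> Mat n \<Longrightarrow> b \<in> Mat n \<Longrightarrow> Fmat a + Fmat b = Fmat (\<lambda>i j. a i j + b i j)"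
  by (rule entries_inject[THEN iffD1]) (simp add: plus_fmat.rep_eq entries_Fmat entries_Fmat[OF Mat_add])

lemma Fmat_mult: "a \<in> Mat n \<Longrightarrow> b \<in> Mat n \<Longrightarrow> Fmat a * Fmat b = Fmat (mmult a b)"
  by (rule entries_inject[THEN iffD1])
    (simp add: times_fmat.rep_eq entries_Fmat entries_Fmat[OF mmult_in_Mat])

lemma Fmat_scaleR: "a \<in> Mat n \<Longrightarrow> r *\<^sub>R Fmat a = Fmat (\<lambda>i j. r *\<^sub>R a i j)"
  by (rule entries_inject[THEN iffD1])
    (simp add: scaleR_fmat.rep_eq entries_Fmat entries_Fmat[OF Mat_scaleR])

lemma Fmat_diff:
  assumes "a \<in> Mat n" "b \<in> Mat n"
  shows "Fmat a - Fmat b = Fmat (\<lambda>i j. a i j - b i j)"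
proof (rule entries_inject[THEN iffD1])
  have "(\<lambda>i j. a i j - b i j) \<in> Mat n" using assms by (simp add: Mat_def)
  then show "entries (Fmat a - Fmat b) = entries (Fmat (\<lambda>i j. a i j - b i j))"
    using assms by (simp add: minus_fmat.rep_eq entries_Fmat)
qed

lemma norm_Fmat: "a \<in> Mat n \<Longrightarrow> norm (Fmat a) = (\<Sum>i<n. \<Sum>j<n. norm (a i j))"
  by (simp add: norm_fmat.rep_eq entries_Fmat mnorm_Mat)

lemma UMat_minus_mone: "u \<in> UMat n \<Longrightarrow> (\<lambda>i j. u i j - mone i j) \<in> Mat n"
  by (simp add: UMat_def Mat_def)

lemma emb_mone [simp]: "emb mone = 1"
  by (simp add: emb_def one_unitization_def zero_fmat_def)

lemma emb_mmult:
  assumes u: "u \<in> UMat n" and v: "v \<in> UMat n"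
  shows "emb (mmult u v) = emb u * emb v"
proof -
  define a where "a i j = u i j - mone i j" for i j
  define b where "b i j = v i j - mone i j" for i j
  have a: "a \<in> Mat n" and b: "b \<in> Mat n"
    using UMat_minus_mone[OF u] UMat_minus_mone[OF v] by (simp_all add: a_def[abs_def] b_def[abs_def])
  have "mmult u v i j - mone i j = b i j + a i j + mmult a b i j" for i j
  proof -
    define N where "N = Suc (n + i + j)"
    have aN: "a \<in> Mat N" using Mat_mono[OF a] by (simp add: N_def)
    have "mmult u v i j = (\<Sum>k<N. u i k * v k j)"
      using u by (intro mmult_sum) (auto simp: UMat_def mone_def N_def)
    also have "\<dots> = (\<Sum>k<N. mone i k * mone k j + mone i k * b k j + a i k * mone k j + a i k * b k j)"
      by (intro sum.cong) (auto simp: a_def b_def algebra_simps)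
    also have "\<dots> = (\<Sum>k<N. mone i k * mone k j) + (\<Sum>k<N. mone i k * b k j) +
        (\<Sum>k<N. a i k * mone k j) + mmult a b i j"
      by (simp add: sum.distrib mmult_Mat_sum[OF aN])
    also have "(\<Sum>k<N. mone i k * mone k j) = (\<Sum>k<N. if k = i then mone i j else 0)"
      by (intro sum.cong) (auto simp: mone_def)
    also have "\<dots> = mone i j" by (simp add: N_def)
    also have "(\<Sum>k<N. mone i k * b k j) = (\<Sum>k<N. if k = i then b i j else 0)"
      by (intro sum.cong) (auto simp: mone_def)
    also have "\<dots> = b i j" by (simp add: N_def)
    also have "(\<Sum>k<N. a i k * mone k j) = (\<Sum>k<N. if k = j then a i j else 0)"
      by (intro sum.cong) (auto simp: mone_def)
    also have "\<dots> = a i j" by (simp add: N_def)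
    finally show ?thesis by simp
  qed
  then have "(\<lambda>i j. mmult u v i j - mone i j) = (\<lambda>i j. b i j + a i j + mmult a b i j)" by simp
  then have "Fmat (\<lambda>i j. mmult u v i j - mone i j) = Fmat b + Fmat a + Fmat a * Fmat b"
    by (simp add: Fmat_mult[OF a b] Fmat_add[OF b a] Fmat_add[OF Mat_add[OF b a] mmult_in_Mat[OF a b]])
  then show ?thesis
    by (simp add: emb_def times_unitization_def a_def[abs_def] b_def[abs_def])
qed

lemma continuous_on_emb:
  fixes G :: "'c::topological_space \<Rightarrow> 'a::cstar_algebra imat"
  assumes "\<And>x. x \<in> S \<Longrightarrow> G x \<in> UMat n"
    and cont: "\<And>i j. continuous_on S (\<lambda>x. G x i j)"
  shows "continuous_on S (\<lambda>x. emb (G x))"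
  unfolding continuous_on_def
proof
  fix x assume x: "x \<in> S"
  have d: "dist (emb (G y)) (emb (G x)) = (\<Sum>i<n. \<Sum>j<n. norm (G y i j - G x i j))" if "y \<in> S" for y
  proof -
    have "(\<lambda>i j. G y i j - G x i j) \<in> Mat n"
      using assms(1)[OF x] assms(1)[OF that] by (simp add: UMat_def Mat_def)
    moreover have "Fmat (\<lambda>i j. G y i j - mone i j) - Fmat (\<lambda>i j. G x i j - mone i j) =
        Fmat (\<lambda>i j. G y i j - G x i j)"
      using Fmat_diff[OF UMat_minus_mone[OF assms(1)[OF that]] UMat_minus_mone[OF assms(1)[OF x]]]
      by simp
    ultimately show ?thesis
      by (simp add: dist_norm emb_def minus_unitization_def norm_unitization_def norm_Fmat)
  qed
  have "((\<lambda>y. \<Sum>i<n. \<Sum>j<n. norm (G y i j - G x i j)) \<longlongrightarrow> (\<Sum>i<n. \<Sum>j<n. norm (G x i j - G x i j)))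
      (at x within S)"
    using cont x by (intro tendsto_intros) (simp add: continuous_on_def)
  then have "((\<lambda>y. \<Sum>i<n. \<Sum>j<n. norm (G y i j - G x i j)) \<longlongrightarrow> 0) (at x within S)" by simp
  then have "((\<lambda>y. dist (emb (G y)) (emb (G x))) \<longlongrightarrow> 0) (at x within S)"
    by (rule Lim_transform_eventually) (simp add: eventually_at_topological d, blast)
  then show "((\<lambda>y. emb (G y)) \<longlongrightarrow> emb (G x)) (at x within S)"
    by (rule tendsto_dist_iff[THEN iffD2])
qed

lemma U_mat_subset_UMat: "U_mat n \<subseteq> UMat n"
  by (auto simp: U_mat_def UMat_def)

lemma continuous_on_entry: "continuous_on S (\<lambda>u :: 'a::topological_space imat. u i j)"
  by (rule continuous_on_product_then_coordinatewise[of S "\<lambda>u. u i"],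
      rule continuous_on_product_then_coordinatewise[of S "\<lambda>u. u"], rule continuous_on_id)

lemma madj_UMat: "u \<in> UMat n \<Longrightarrow> madj u \<in> UMat n"
  by (auto simp: UMat_def madj_def mone_def)

text \<open>The universal property of the inductive limit topology.\<close>

lemma continuous_map_U_inf:
  fixes F :: "'a::cstar_algebra imat \<Rightarrow> 'b::topological_space"
  assumes "\<And>n. continuous_on (U_mat n) F"
  shows "continuous_map U_inf_topology euclidean F"
proof -
  have top: "topspace U_inf_topology = (U_inf :: 'a imat set)"
  proof -
    have "openin U_inf_topology (U_inf :: 'a imat set)"
    proof -
      have "U_inf \<inter> U_mat n = (U_mat n :: 'a imat set)" for n by (auto simp: U_inf_def)
      then show ?thesis by (simp add: openin_U_inf_topology)
    qed
    then show ?thesis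
      using openin_subset openin_U_inf_topology openin_topspace by blast
  qed
  show ?thesis
    unfolding continuous_map_def top
  proof (intro conjI allI impI)
    fix V :: "'b set" assume "openin euclidean V"
    then have "openin (top_of_set (U_mat n)) (U_mat n \<inter> F -` V)" for n
      using assms[of n] by (simp add: continuous_openin_preimage_gen)
    moreover have "{x \<in> U_inf. F x \<in> V} \<inter> U_mat n = U_mat n \<inter> F -` V" for n
      by (auto simp: U_inf_def)
    ultimately show "openin U_inf_topology {x \<in> U_inf. F x \<in> V}"
      unfolding openin_U_inf_topology by auto
  qed simp
qed

lemma continuous_map_emb: "continuous_map U_inf_topology euclidean emb"
  using U_mat_subset_UMat
  by (intro continuous_map_U_inf continuous_on_emb continuous_on_entry) blast

lemma continuous_map_emb_madj:
  "continuous_map U_inf_topology euclidean (\<lambda>u. emb (madj u))"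
  using U_mat_subset_UMat madj_UMat
  by (intro continuous_map_U_inf continuous_on_emb)
    (blast, auto simp: madj_def intro!: continuous_intros continuous_on_entry)

lemma emb_madj:
  assumes "u \<in> U_inf"
  shows "emb u * emb (madj u) = 1" "emb (madj u) * emb u = 1"
proof -
  obtain n where n: "u \<in> U_mat n" using assms by (auto simp: U_inf_def)
  then have "u \<in> UMat n" "madj u \<in> UMat n" using U_mat_subset_UMat madj_UMat by blast+
  then show "emb u * emb (madj u) = 1" "emb (madj u) * emb u = 1"
    using n by (simp_all flip: emb_mmult add: U_mat_def)
qed

text \<open>The adjoined unit gets trace 0, which keeps the functional bounded and tracial.\<close>

definition emb_trace :: "('a::cstar_algebra \<Rightarrow> complex) \<Rightarrow> 'a fmat unitization \<Rightarrow> real" where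
  "emb_trace \<tau> x = Im (mtrace \<tau> (entries (nonscalar x)))"

lemma tracial_state_0: "tracial_state \<tau> \<Longrightarrow> \<tau> 0 = 0"
  using tracial_state_scaleR[of \<tau> 0 0] by simp

lemma tracial_state_sum: "tracial_state \<tau> \<Longrightarrow> \<tau> (sum f I) = (\<Sum>i\<in>I. \<tau> (f i))"
  by (induction I rule: infinite_finite_induct) (auto simp: tracial_state_0 tracial_stateD(1))

lemma mtrace_tracial:
  "tracial_state \<tau> \<Longrightarrow> a \<in> Mat n \<Longrightarrow> mtrace \<tau> a = (\<Sum>i<n. \<tau> (a i i))"
  by (rule mtrace_Mat) (simp_all add: tracial_state_0)

lemma mtrace_mmult_commute:
  assumes "tracial_state \<tau>" "a \<in> Mat n" "b \<in> Mat n"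
  shows "mtrace \<tau> (mmult a b) = mtrace \<tau> (mmult b a)"
proof -
  have "mtrace \<tau> (mmult a b) = (\<Sum>i<n. \<Sum>k<n. \<tau> (a i k * b k i))"
    by (simp add: mtrace_tracial[OF assms(1) mmult_in_Mat[OF assms(2,3)]] mmult_Mat_sum[OF assms(2)]
        tracial_state_sum[OF assms(1)])
  also have "\<dots> = (\<Sum>k<n. \<Sum>i<n. \<tau> (b k i * a i k))"
    by (subst sum.swap) (simp add: tracial_stateD(5)[OF assms(1), of "a _ _"])
  also have "\<dots> = mtrace \<tau> (mmult b a)"
    by (simp add: mtrace_tracial[OF assms(1) mmult_in_Mat[OF assms(3,2)]] mmult_Mat_sum[OF assms(3)]
        tracial_state_sum[OF assms(1)])
  finally show ?thesis .
qed

lemma mtrace_add: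
  assumes "tracial_state \<tau>" "a \<in> Mat n" "b \<in> Mat n"
  shows "mtrace \<tau> (\<lambda>i j. a i j + b i j) = mtrace \<tau> a + mtrace \<tau> b"
  using assms(1) by (simp add: mtrace_tracial[OF assms(1,2)] mtrace_tracial[OF assms(1,3)] mtrace_tracial[OF assms(1) Mat_add[OF assms(2,3)]]
      tracial_stateD(1) sum.distrib)

lemma mtrace_scaleR:
  assumes "tracial_state \<tau>" "a \<in> Mat n"
  shows "mtrace \<tau> (\<lambda>i j. r *\<^sub>R a i j) = r * mtrace \<tau> a"
  using assms(1) by (simp add: mtrace_tracial[OF assms(1,2)] mtrace_tracial[OF assms(1) Mat_scaleR[OF assms(2)]]
      tracial_state_scaleR sum_distrib_left)

lemma Mat_scaleC: "a \<in> Mat n \<Longrightarrow> mscale c a \<in> Mat n"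
  by (simp add: Mat_def mscale_def)

lemma mtrace_scaleC:
  assumes "tracial_state \<tau>" "a \<in> Mat n"
  shows "mtrace \<tau> (mscale c a) = c * mtrace \<tau> a"
  using assms(1) by (simp add: mtrace_tracial[OF assms(1,2)] mtrace_tracial[OF assms(1) Mat_scaleC[OF assms(2)]]
      tracial_stateD(2) sum_distrib_left mscale_def)

lemma fmat_common2:
  obtains n where "entries x \<in> Mat n" "entries y \<in> Mat n"
proof -
  have "finite_mat (entries x)" "finite_mat (entries y)" using entries by blast+
  then show ?thesis by (rule finite_mat_common2) (rule that)
qed

lemma entries_arith:
  "entries (x + y) = (\<lambda>i j. entries x i j + entries y i j)"
  "entries (r *\<^sub>R x) = (\<lambda>i j. r *\<^sub>R entries x i j)"
  "entries (x * y) = mmult (entries x) (entries y)"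
  by (simp_all add: plus_fmat.rep_eq scaleR_fmat.rep_eq times_fmat.rep_eq)

lemma bounded_trace_emb:
  assumes \<tau>: "tracial_state \<tau>"
  shows "bounded_trace (emb_trace \<tau>)"
proof -
  define tr where "tr x = Im (mtrace \<tau> (entries x))" for x :: "'a fmat"
  have add: "tr (x + y) = tr x + tr y" for x y
    by (rule fmat_common2[of x y]) (simp add: tr_def entries_arith mtrace_add[OF \<tau>])
  have scale: "tr (r *\<^sub>R x) = r * tr x" for r x
    by (rule fmat_common2[of x x]) (simp add: tr_def entries_arith mtrace_scaleR[OF \<tau>])
  have comm: "tr (x * y) = tr (y * x)" for x y
    by (rule fmat_common2[of x y]) (simp add: tr_def entries_arith mtrace_mmult_commute[OF \<tau>, of "entries x"])
  have bound: "\<bar>tr x\<bar> \<le> 8 * norm x" for x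
  proof -
    obtain n where n: "entries x \<in> Mat n" using fmat_common2 by blast
    have "\<bar>tr x\<bar> \<le> (\<Sum>i<n. \<bar>Im (\<tau> (entries x i i))\<bar>)"
      by (simp add: tr_def mtrace_tracial[OF \<tau> n])
    also have "\<dots> \<le> (\<Sum>i<n. \<Sum>j<n. 8 * norm (entries x i j))"
    proof (rule sum_mono)
      fix i assume i: "i \<in> {..<n}"
      have "\<bar>Im (\<tau> (entries x i i))\<bar> \<le> 8 * norm (entries x i i)" by (rule tracial_state_bound[OF \<tau>])
      also have "\<dots> \<le> (\<Sum>j<n. 8 * norm (entries x i j))"
        using i by (intro member_le_sum[where f = "\<lambda>j. 8 * norm (entries x i j)"]) auto
      finally show "\<bar>Im (\<tau> (entries x i i))\<bar> \<le> (\<Sum>j<n. 8 * norm (entries x i j))" .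
    qed
    also have "\<dots> = 8 * norm x"
      by (simp add: norm_fmat.rep_eq mnorm_Mat[OF n] sum_distrib_left)
    finally show ?thesis .
  qed
  have eq: "emb_trace \<tau> x = tr (nonscalar x)" for x by (simp add: emb_trace_def tr_def)
  show ?thesis
  proof
    fix x y :: "'a fmat unitization" and r :: real
    show "emb_trace \<tau> (x + y) = emb_trace \<tau> x + emb_trace \<tau> y"
      by (simp add: eq plus_unitization_def add)
    show "emb_trace \<tau> (r *\<^sub>R x) = r *\<^sub>R emb_trace \<tau> x"
      by (simp add: eq scaleR_unitization_def scale)
    show "emb_trace \<tau> (x * y) = emb_trace \<tau> (y * x)"
      by (simp add: eq times_unitization_def add scale comm[of "nonscalar x"])
    show "\<exists>K. \<forall>x. norm (emb_trace \<tau> x) \<le> norm x * K"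
    proof (intro exI[of _ 8] allI)
      fix x :: "'a fmat unitization"
      show "norm (emb_trace \<tau> x) \<le> norm x * 8"
        using bound[of "nonscalar x"] by (simp add: eq norm_unitization_def)
    qed
  qed
qed

text \<open>The non-unital embedding of \<open>A\<close> as the upper left corner. It preserves products and traces, so
  that the series \<open>logtr\<close> for \<open>u\<close> and for \<open>corner u\<close> agree term by term.\<close>

definition corner0 :: "'a::cstar_algebra \<Rightarrow> 'a fmat unitization" where
  "corner0 x = Adjoin 0 (Fmat (\<lambda>i j. if i = 0 \<and> j = 0 then x else 0))"

lemma corner0_Mat: "(\<lambda>i j. if i = 0 \<and> j = 0 then x else 0) \<in> Mat 1"
  by (simp add: Mat_def)

lemma emb_corner: "emb (corner u) = 1 + corner0 (u - 1)"
proof -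
  have "(\<lambda>i j. corner u i j - mone i j) = (\<lambda>i j. if i = 0 \<and> j = 0 then u - 1 else 0)"
    by (auto simp: corner_def mone_def intro!: ext)
  then show ?thesis by (simp add: emb_def corner0_def one_unitization_def plus_unitization_def)
qed

lemma corner0_mult: "corner0 x * corner0 y = corner0 (x * y)"
proof -
  have "mmult (\<lambda>i j. if i = 0 \<and> j = 0 then x else 0) (\<lambda>i j. if i = 0 \<and> j = 0 then y else 0) =
      (\<lambda>i j. if i = 0 \<and> j = 0 then x * y else 0)"
    by (intro ext) (simp add: mmult_Mat_sum[OF corner0_Mat])
  then show ?thesis
    by (simp add: corner0_def times_unitization_def Fmat_mult[OF corner0_Mat corner0_Mat])
qed

lemma corner0_power: "corner0 x ^ Suc k = corner0 (x ^ Suc k)"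
  by (induction k) (simp_all add: corner0_mult)

lemma emb_trace_corner0:
  assumes "tracial_state \<tau>"
  shows "emb_trace \<tau> (corner0 x) = Im (\<tau> x)"
  by (simp add: emb_trace_def corner0_def entries_Fmat[OF corner0_Mat]
      mtrace_tracial[OF assms corner0_Mat])

lemma corner_UMat: "corner u \<in> UMat 1"
  by (simp add: corner_def UMat_def mone_def)

lemma emb_corner_mult: "emb (corner u) * emb (corner v) = emb (corner (u * v))"
proof -
  have add: "corner0 x + corner0 y = corner0 (x + y)" for x y :: 'a
  proof -
    have "(\<lambda>i j. (if i = 0 \<and> j = 0 then x else 0) + (if i = 0 \<and> j = 0 then y else 0)) =
        (\<lambda>i j :: nat. if i = (0 :: nat) \<and> j = 0 then x + y else 0)" by (intro ext) simp
    then show ?thesis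
      by (simp add: corner0_def plus_unitization_def Fmat_add[OF corner0_Mat corner0_Mat])
  qed
  have "emb (corner u) * emb (corner v) =
      1 + (corner0 (u - 1) + corner0 (v - 1) + corner0 ((u - 1) * (v - 1)))"
    by (simp add: emb_corner algebra_simps corner0_mult)
  also have "corner0 (u - 1) + corner0 (v - 1) + corner0 ((u - 1) * (v - 1)) = corner0 (u * v - 1)"
    unfolding add by (rule arg_cong[where f = corner0]) (simp add: algebra_simps)
  finally show ?thesis by (simp add: emb_corner)
qed

lemma emb_corner_1 [simp]: "emb (corner (1 :: 'a::cstar_algebra)) = 1"
proof -
  have "corner 1 = (mone :: 'a imat)" by (auto simp: corner_def mone_def intro!: ext)
  then show ?thesis by simp
qed

lemma continuous_on_emb_corner:
  "continuous_on S f \<Longrightarrow> continuous_on S (\<lambda>t. emb (corner (f t)))"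
proof (rule continuous_on_emb[OF corner_UMat])
  fix i j :: nat assume f: "continuous_on S f"
  show "continuous_on S (\<lambda>t. corner (f t) i j)"
    by (cases "i = 0 \<and> j = 0") (use f in \<open>auto simp: corner_def\<close>)
qed

lemma logtr_emb_corner:
  assumes "tracial_state \<tau>"
  shows "bounded_trace.logtr (emb_trace \<tau>) (emb (corner u)) = bounded_trace.logtr (\<lambda>x. Im (\<tau> x)) u"
  unfolding bounded_trace.logtr_def[OF bounded_trace_emb[OF assms]]
    bounded_trace.logtr_def[OF bounded_trace_Im[OF assms]]
  by (simp add: emb_corner corner0_power emb_trace_corner0[OF assms] del: power_Suc)

lemma has_phase_emb_corner:
  assumes \<tau>: "tracial_state \<tau>" and d: "bounded_trace.has_phase (\<lambda>x. Im (\<tau> x)) f d"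
  shows "bounded_trace.has_phase (emb_trace \<tau>) (\<lambda>t. emb (corner (f t))) d"
proof -
  interpret A: bounded_trace "\<lambda>x. Im (\<tau> x)" by (rule bounded_trace_Im[OF \<tau>])
  interpret M: bounded_trace "emb_trace \<tau>" by (rule bounded_trace_emb[OF \<tau>])
  obtain f' L where f: "A.inv_path f f'" and L: "A.lift f f' L" and dL: "d = L 1 - L 0"
    using d unfolding A.has_phase_def by blast
  have "M.inv_path (\<lambda>t. emb (corner (f t))) (\<lambda>t. emb (corner (f' t)))"
    using f unfolding A.inv_path_def M.inv_path_def
    by (auto simp: emb_corner_mult intro: continuous_on_emb_corner)
  moreover have "M.lift (\<lambda>t. emb (corner (f t))) (\<lambda>t. emb (corner (f' t))) L"
    using L unfolding A.lift_def M.lift_def by (simp add: emb_corner_mult logtr_emb_corner[OF \<tau>])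
  ultimately show ?thesis unfolding M.has_phase_def using dL by blast
qed

section \<open>The phase of a Bott loop\<close>

lemma mpower_projection:
  assumes "p \<in> Mat n" "mmult p p = p"
  shows "mpower (mscale c p) (Suc k) = mscale (c ^ Suc k) p"
proof (induction k)
  case 0
  have "mmult (mscale c p) mone = mscale c p"
  proof (intro ext)
    fix i j
    have "mmult (mscale c p) mone i j = (\<Sum>k<n + Suc j. if k = j then mscale c p i j else 0)"
      by (subst mmult_Mat_sum[OF Mat_mono[OF Mat_scaleC[OF assms(1)] le_add1, of _ "Suc j"]])
        (intro sum.cong, auto simp: mone_def)
    then show "mmult (mscale c p) mone i j = mscale c p i j" by simp
  qed
  then show ?case by (simp add: mpower_def)
next
  case (Suc k)
  have "mpower (mscale c p) (Suc (Suc k)) = mmult (mscale c p) (mscale (c ^ Suc k) p)"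
    using Suc by (simp add: mpower_def)
  also have "\<dots> = mscale (c * c ^ Suc k) (mmult p p)"
  proof (intro ext)
    fix i j
    show "mmult (mscale c p) (mscale (c ^ Suc k) p) i j = mscale (c * c ^ Suc k) (mmult p p) i j"
      unfolding mmult_Mat_sum[OF Mat_scaleC[OF assms(1)]]
      by (simp add: mscale_def mmult_Mat_sum[OF assms(1)] mult_scaleC_left mult_scaleC_right
          scaleC_scaleC linear_sum[OF bounded_linear.linear[OF bounded_linear_scaleC]]
          mult.commute[of _ c] del: power_Suc)
  qed
  finally show ?case using assms(2) by simp
qed

text \<open>All positive powers of \<open>cp\<close> are multiples of \<open>p\<close>, so the exponential series is
  \<open>1 + (exp c - 1) p\<close>.\<close>

lemma mexp_projection:
  assumes "p \<in> Mat n" "mmult p p = p"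
  shows "mexp (mscale c p) i j = mone i j + mscale (exp c - 1) p i j"
proof -
  have "(\<lambda>k. (c ^ k /\<^sub>R fact k) *\<^sub>C p i j) sums (exp c *\<^sub>C p i j)"
    by (rule bounded_linear.sums[OF bounded_linear_scaleC_left exp_converges])
  moreover have "(\<lambda>k. if k = 0 then mone i j - p i j else 0) sums (mone i j - p i j)"
    using sums_If_finite_set[of "{0::nat}" "\<lambda>_. mone i j - p i j"] by simp
  ultimately have "(\<lambda>k. (c ^ k /\<^sub>R fact k) *\<^sub>C p i j + (if k = 0 then mone i j - p i j else 0))
      sums (exp c *\<^sub>C p i j + (mone i j - p i j))" by (rule sums_add)
  moreover have "(c ^ k /\<^sub>R fact k) *\<^sub>C p i j + (if k = 0 then mone i j - p i j else 0) =
      mpower (mscale c p) k i j /\<^sub>R fact k" for k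
  proof (cases k)
    case 0
    then show ?thesis by (simp add: mpower_def)
  next
    case (Suc m)
    have "mpower (mscale c p) k i j = c ^ k *\<^sub>C p i j"
      using mpower_projection[OF assms, of c m] Suc by (simp add: mscale_def)
    then have "mpower (mscale c p) k i j /\<^sub>R fact k =
        complex_of_real (inverse (fact k)) *\<^sub>C (c ^ k *\<^sub>C p i j)"
      by (simp only: scaleC_of_real)
    also have "\<dots> = (c ^ k /\<^sub>R fact k) *\<^sub>C p i j"
      by (simp only: scaleC_scaleC scaleR_conv_of_real)
    finally show ?thesis using Suc by simp
  qed
  ultimately have "mexp (mscale c p) i j = exp c *\<^sub>C p i j + (mone i j - p i j)"
    unfolding mexp_def by (simp add: sums_iff)
  also have "\<dots> = mone i j + (exp c *\<^sub>C p i j + (- 1) *\<^sub>C p i j)" by simp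
  also have "exp c *\<^sub>C p i j + (- 1) *\<^sub>C p i j = mscale (exp c - 1) p i j"
    unfolding mscale_def by (subst scaleC_add_left[symmetric]) simp
  finally show ?thesis .
qed

text \<open>The path is the one-parameter group \<open>1 + (exp(ct) - 1) p\<close>, with generator \<open>cp\<close>. The map \<open>\<kappa>\<close>,
  \<open>z \<mapsto> zp\<close>, transports multiplication and differentiation from the complex numbers.\<close>

lemma has_phase_mexp:
  assumes \<tau>: "tracial_state \<tau>" and p: "p \<in> Mat n" "mmult p p = p"
  shows "bounded_trace.has_phase (emb_trace \<tau>) (\<lambda>t. emb (mexp (mscale (c * complex_of_real t) p)))
    (Im (c * mtrace \<tau> p))"
proof -
  interpret M: bounded_trace "emb_trace \<tau>" by (rule bounded_trace_emb[OF \<tau>])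
  define \<kappa> where "\<kappa> c = Adjoin 0 (Fmat (mscale c p))" for c
  have emb: "emb (mexp (mscale c p)) = 1 + \<kappa> (exp c - 1)" for c
  proof -
    have "(\<lambda>i j. mexp (mscale c p) i j - mone i j) = mscale (exp c - 1) p"
      by (intro ext) (simp add: mexp_projection[OF p])
    then show ?thesis by (simp add: emb_def \<kappa>_def one_unitization_def plus_unitization_def)
  qed
  have add: "\<kappa> (c + d) = \<kappa> c + \<kappa> d" for c d
    by (simp add: \<kappa>_def plus_unitization_def Fmat_add[OF Mat_scaleC[OF p(1)] Mat_scaleC[OF p(1)]])
      (simp add: mscale_def[abs_def] scaleC_add_left)
  have scale: "\<kappa> (r *\<^sub>R c) = r *\<^sub>R \<kappa> c" for r c
    by (simp add: \<kappa>_def scaleR_unitization_def Fmat_scaleR[OF Mat_scaleC[OF p(1)]])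
      (simp add: mscale_def[abs_def] scaleC_of_real[symmetric] scaleC_scaleC scaleR_conv_of_real)
  have mult: "\<kappa> c * \<kappa> d = \<kappa> (c * d)" for c d
  proof -
    have "mmult (mscale c p) (mscale d p) = mscale (c * d) (mmult p p)"
    proof (intro ext)
      fix i j
      show "mmult (mscale c p) (mscale d p) i j = mscale (c * d) (mmult p p) i j"
        unfolding mmult_Mat_sum[OF Mat_scaleC[OF p(1)]]
        by (simp add: mscale_def mmult_Mat_sum[OF p(1)] mult_scaleC_left mult_scaleC_right
            scaleC_scaleC linear_sum[OF bounded_linear.linear[OF bounded_linear_scaleC]]
            mult.commute[of d])
    qed
    then show ?thesis
      using p(2) by (simp add: \<kappa>_def times_unitization_def Fmat_mult[OF Mat_scaleC[OF p(1)] Mat_scaleC[OF p(1)]])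
  qed
  have norm: "norm (\<kappa> c) = cmod c * norm (Fmat p)" for c
    by (simp add: \<kappa>_def norm_unitization_def norm_Fmat[OF Mat_scaleC[OF p(1)]] norm_Fmat[OF p(1)]
        mscale_def norm_scaleC sum_distrib_left)
  have lin: "bounded_linear \<kappa>"
    by (rule bounded_linear_intro[where K = "norm (Fmat p)"]) (auto simp: add scale norm)
  have diff: "\<kappa> (c - d) = \<kappa> c - \<kappa> d" for c d
    by (rule linear_diff[OF bounded_linear.linear[OF lin]])
  define w where "w t = emb (mexp (mscale (c * complex_of_real t) p))" for t
  have w: "w t = 1 + (\<kappa> (exp (c * complex_of_real t)) - \<kappa> 1)" for t
    by (simp add: w_def emb diff)
  have "M.has_phase w (emb_trace \<tau> (\<kappa> c))"
  proof (rule M.has_phase_one_parameter)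
    show "w (s + t) = w s * w t" for s t
      by (simp add: w algebra_simps mult exp_add)
    show "w 0 = 1" by (simp add: w)
    show "(w has_vector_derivative w t * \<kappa> c) (at t)" for t
    proof -
      have "((\<lambda>t. exp (c * complex_of_real t)) has_vector_derivative exp (c * complex_of_real t) * c) (at t)"
        by (rule has_vector_derivative_real_field) (auto intro!: derivative_eq_intros)
      from bounded_linear.has_vector_derivative[OF lin this]
      have "((\<lambda>t. 1 + (\<kappa> (exp (c * complex_of_real t)) - \<kappa> 1)) has_vector_derivative
          \<kappa> (exp (c * complex_of_real t) * c)) (at t)"
        by (auto intro!: derivative_eq_intros)
      then show ?thesis by (simp add: w[abs_def] distrib_right left_diff_distrib mult)
    qed
  qed
  moreover have "emb_trace \<tau> (\<kappa> c) = Im (c * mtrace \<tau> p)"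
    by (simp add: emb_trace_def \<kappa>_def entries_Fmat[OF Mat_scaleC[OF p(1)]] mtrace_scaleC[OF \<tau> p(1)])
  ultimately show ?thesis by (simp add: w_def[abs_def])
qed

lemma has_phase_bott_loop:
  assumes \<tau>: "tracial_state \<tau>" and p: "p \<in> projections" and q: "q \<in> projections"
  shows "bounded_trace.has_phase (emb_trace \<tau>) (\<lambda>t. emb (bott_loop p q t))
    (2 * pi * Re (mtrace \<tau> p - mtrace \<tau> q))"
proof -
  interpret M: bounded_trace "emb_trace \<tau>" by (rule bounded_trace_emb[OF \<tau>])
  have "finite_mat p" "finite_mat q" using p q by (auto simp: projections_def finite_mat_def)
  then obtain n where n: "p \<in> Mat n" "q \<in> Mat n" by (rule finite_mat_common2)
  have pp: "mmult p p = p" "mmult q q = q" using p q by (auto simp: projections_def)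
  have U: "mexp (mscale c r) \<in> UMat n" if "r \<in> Mat n" "mmult r r = r" for c r
    using mexp_projection[OF that] that(1) by (simp add: UMat_def Mat_def mscale_def)
  have "emb (bott_loop p q t) = emb (mexp (mscale (2 * pi * \<i> * complex_of_real t) p)) *
      emb (mexp (mscale ((- (2 * pi * \<i>)) * complex_of_real t) q))" for t
    unfolding bott_loop_def by (subst emb_mmult[OF U[OF n(1) pp(1)] U[OF n(2) pp(2)]]) simp
  then show ?thesis
    using M.has_phase_mult[OF has_phase_mexp[OF \<tau> n(1) pp(1), of "2 * pi * \<i>"]
        has_phase_mexp[OF \<tau> n(2) pp(2), of "- (2 * pi * \<i>)"]]
    by (simp add: algebra_simps)
qed

text \<open>Both loops, and the homotopy between them, are moved into the normed algebra, where the phase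
  is a homotopy invariant; there the phase of \<open>corner \<circ> f\<close> is that of \<open>f\<close>.\<close>

lemma phase_homotopic_bott_loop:
  assumes \<tau>: "tracial_state \<tau>" and p: "p \<in> projections" and q: "q \<in> projections"
    and f: "bounded_trace.has_phase (\<lambda>x. Im (\<tau> x)) f d"
    and hom: "(corner \<circ> f, bott_loop p q) \<in> loop_rel U_inf_topology mone"
  shows "d = 2 * pi * Re (mtrace \<tau> p - mtrace \<tau> q)"
proof -
  interpret M: bounded_trace "emb_trace \<tau>" by (rule bounded_trace_emb[OF \<tau>])
  obtain h where h: "continuous_map (prod_topology (top_of_set {0..1::real}) (top_of_set {0..1})) U_inf_topology h"
    "\<forall>t. h (0, t) = corner (f t)" "\<forall>t. h (1, t) = bott_loop p q t"
    "\<forall>s\<in>{0..1}. h (s, 0) = mone \<and> h (s, 1) = mone"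
    using hom unfolding loop_rel_def homotopic_with_def o_def mem_Collect_eq case_prod_conv
    by blast
  have top: "prod_topology (top_of_set {0..1}) (top_of_set {0..1}) =
      top_of_set ({0..1::real} \<times> {0..1::real})"
    by (simp add: subtopology_Times)
  have U: "h z \<in> U_inf" if "z \<in> {0..1} \<times> {0..1}" for z
  proof -
    have "h z \<in> topspace U_inf_topology"
      using h(1) that unfolding top continuous_map_def by auto
    then show ?thesis using openin_U_inf_topology openin_topspace by blast
  qed
  have c: "continuous_on ({0..1} \<times> {0..1}) (\<lambda>z. emb (h z))"
    "continuous_on ({0..1} \<times> {0..1}) (\<lambda>z. emb (madj (h z)))"
    using continuous_map_compose[OF h(1) continuous_map_emb]
      continuous_map_compose[OF h(1) continuous_map_emb_madj]
    unfolding top by (simp_all add: o_def)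
  have "M.has_phase (\<lambda>t. emb (h (1, t))) d"
  proof (rule M.has_phase_homotopy[OF c])
    show "M.has_phase (\<lambda>t. emb (h (0, t))) d" using has_phase_emb_corner[OF \<tau> f] by (simp add: h(2))
  qed (use U h(4) in \<open>simp_all add: emb_madj\<close>)
  then show ?thesis
    using has_phase_bott_loop[OF \<tau> p q] M.has_phase_unique by (simp add: h(3))
qed

section \<open>The phase of a unitary path\<close>

context
  fixes \<tau> :: "'a::cstar_algebra \<Rightarrow> complex"
  assumes \<tau>: "tracial_state \<tau>"
begin

interpretation bounded_trace "\<lambda>x. Im (\<tau> x)" by (rule bounded_trace_Im[OF \<tau>])

lemma logtr_exp:
  assumes "norm x \<le> 1 / 4"
  shows "logtr (exp x) = Im (\<tau> x)"
proof -
  have "logtr (exp (1 *\<^sub>R x)) = 1 * Im (\<tau> x)"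
  proof (rule logtr_one_parameter[where S = "{0..1}" and \<rho> = "3 / 8"])
    show "((\<lambda>t. exp (t *\<^sub>R x)) has_vector_derivative exp (s *\<^sub>R x) * x) (at s within {0..1})" for s
      by (rule has_vector_derivative_at_within[OF exp_scaleR_has_vector_derivative_right])
    fix s :: real assume "s \<in> {0..1}"
    then have "s * norm x \<le> norm x" by (intro mult_left_le_one_le) auto
    then have "norm (s *\<^sub>R x) \<le> 1 / 4" using assms \<open>s \<in> {0..1}\<close> by simp
    from norm_exp_minus_one_le_linear[OF this] this
    show "norm (exp (s *\<^sub>R x) - 1) \<le> 3 / 8" by linarith
  qed auto
  then show ?thesis by simp
qed

lemma has_phase_exp: "has_phase (\<lambda>t. exp (t *\<^sub>R x)) (Im (\<tau> x))"
proof (rule has_phase_one_parameter)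
  show "exp ((s + t) *\<^sub>R x) = exp (s *\<^sub>R x) * exp (t *\<^sub>R x)" for s t
    by (simp add: scaleR_left_distrib exp_add_commuting)
qed (simp_all add: exp_scaleR_has_vector_derivative_right)

lemma Im_trace_i: "Im (\<tau> (\<i> *\<^sub>C h)) = Re (\<tau> h)"
  by (simp add: tracial_stateD(2)[OF \<tau>])

lemma inv_path_unitary:
  assumes "continuous_on {0..1} f" "f ` {0..1} \<subseteq> unitaries"
  shows "inv_path f (\<lambda>t. adj (f t))"
  using assms unfolding inv_path_def by (auto intro!: continuous_intros simp: unitaries_def)

text \<open>The paths \<open>t \<mapsto> f(kt/n)\<close>, for \<open>k = 0, ..., n\<close>, lead from the constant path to \<open>f\<close> in small
  steps. Each step multiplies the end point by some \<open>exp(ih)\<close> and adds \<open>\<tau>(h)\<close> to the phase.\<close>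

lemma unitary_path_factorization:
  assumes f: "continuous_on {0..1} f" "f ` {0..1} \<subseteq> unitaries" "f 0 = 1"
  shows "\<exists>hs. (\<forall>h\<in>set hs. adj h = h) \<and> f 1 = prod_list (map (\<lambda>h. exp (\<i> *\<^sub>C h)) hs) \<and>
    has_phase f (Re (\<tau> (sum_list hs)))"
proof -
  let ?H = "\<lambda>(s, t). f (s * t)" and ?H' = "\<lambda>(s, t). adj (f (s * t))"
  have mem: "s * t \<in> {0..1}" if "s \<in> {0..1}" "t \<in> {0..1}" for s t :: real
    using that mult_le_one[of s t] by auto
  have c: "continuous_on ({0..1} \<times> {0..1}) ?H" "continuous_on ({0..1} \<times> {0..1}) ?H'"
    using mem by (auto simp: case_prod_unfold intro!: continuous_intros continuous_on_compose2[OF f(1)])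
  have u: "f (s * t) \<in> unitaries" if "s \<in> {0..1}" "t \<in> {0..1}" for s t
    using f(2) mem[OF that] by blast
  obtain n :: nat where n: "n > 0" "\<And>k t. k < n \<Longrightarrow> t \<in> {0..1} \<Longrightarrow>
     norm (?H' (k / n, t) * ?H (Suc k / n, t) - 1) \<le> 1 / 8"
    and ip: "\<And>s. s \<in> {0..1} \<Longrightarrow> inv_path (\<lambda>t. ?H (s, t)) (\<lambda>t. ?H' (s, t))"
  proof (rule homotopy_near[OF c])
    show "?H z * ?H' z = 1 \<and> ?H' z * ?H z = 1" if "z \<in> {0..1} \<times> {0..1}" for z
      using that u by (auto simp: unitaries_def)
  qed blast
  have "\<exists>hs. (\<forall>h\<in>set hs. adj h = h) \<and> f (k / n) = prod_list (map (\<lambda>h. exp (\<i> *\<^sub>C h)) hs) \<and>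
      has_phase (\<lambda>t. f (k / n * t)) (Re (\<tau> (sum_list hs)))" if "k \<le> n" for k
    using that
  proof (induction k)
    case 0
    show ?case
      using has_phase_const_1 f(3) by (intro exI[of _ "[]"]) (simp add: tracial_state_0[OF \<tau>])
  next
    case (Suc k)
    then obtain hs where hs: "\<forall>h\<in>set hs. adj h = h"
      "f (k / n) = prod_list (map (\<lambda>h. exp (\<i> *\<^sub>C h)) hs)"
      "has_phase (\<lambda>t. f (k / n * t)) (Re (\<tau> (sum_list hs)))" by auto
    have s: "k / n \<in> {0..1}" "Suc k / n \<in> {0..1}" using Suc.prems n(1) by (auto simp: divide_simps)
    define w where "w = adj (f (k / n)) * f (Suc k / n)"
    have uu: "f (k / n) \<in> unitaries" "f (Suc k / n) \<in> unitaries" using f(2) s by blast+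
    have "w \<in> unitaries" unfolding w_def by (intro unitary_mult unitary_adj uu)
    moreover have "norm (w - 1) \<le> 1 / 8" using n(2)[of k 1] Suc.prems by (simp add: w_def)
    ultimately obtain h where h: "adj h = h" "w = exp (\<i> *\<^sub>C h)" "norm h \<le> 2 * norm (w - 1)"
      by (rule unitary_log)
    have "norm (\<i> *\<^sub>C h) \<le> 1 / 4" using h(3) \<open>norm (w - 1) \<le> 1 / 8\<close> by (simp add: norm_scaleC)
    then have "logtr w = Re (\<tau> h)" using logtr_exp h(2) Im_trace_i by simp
    moreover have "has_phase (\<lambda>t. f (Suc k / n * t)) (Re (\<tau> (sum_list hs)) +
        (logtr (adj (f (k / n * 1)) * f (Suc k / n * 1)) - logtr (adj (f (k / n * 0)) * f (Suc k / n * 0))))"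
    proof (rule has_phase_transport[OF hs(3)])
      show "inv_path (\<lambda>t. f (k / n * t)) (\<lambda>t. adj (f (k / n * t)))"
        "inv_path (\<lambda>t. f (Suc k / n * t)) (\<lambda>t. adj (f (Suc k / n * t)))"
        using ip[OF s(1)] ip[OF s(2)] by simp_all
      show "norm (adj (f (k / n * t)) * f (Suc k / n * t) - 1) \<le> 1 / 4" if "t \<in> {0..1}" for t
        using n(2)[of k t] Suc.prems that by simp
    qed
    ultimately have "has_phase (\<lambda>t. f (Suc k / n * t)) (Re (\<tau> (sum_list hs)) + Re (\<tau> h))"
      using f(3) by (simp add: w_def)
    moreover have "f (Suc k / n) = f (k / n) * w"
      using unitariesD(2)[OF uu(1)] by (simp add: w_def mult.assoc[symmetric])
    ultimately show ?case
      using hs h by (intro exI[of _ "hs @ [h]"]) (auto simp: tracial_stateD(1)[OF \<tau>])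
  qed
  from this[of n] show ?thesis using n(1) by simp
qed

end

section \<open>Traces of K-theory classes\<close>

lemma sum_double: "(\<Sum>i<2 * n. f i) = (\<Sum>i<n. f (2 * i) + f (Suc (2 * i)))"
  for f :: "nat \<Rightarrow> 'b::comm_monoid_add"
  by (induction n) (simp_all add: add.assoc)

lemma msum_Mat:
  assumes "p \<in> Mat n" "q \<in> Mat n"
  shows "msum p q \<in> Mat (2 * n)"
proof -
  have "n \<le> i div 2" if "2 * n \<le> i" for i :: nat using that by simp
  then show ?thesis using assms unfolding Mat_def msum_def by auto
qed

lemma mmult_msum:
  assumes "p \<in> Mat n" "q \<in> Mat n"
  shows "mmult (msum p q) (msum p' q') = msum (mmult p p') (mmult q q')"
  by (intro ext) (simp add: mmult_Mat_sum[OF msum_Mat[OF assms]] mmult_Mat_sum[OF assms(1)]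
      mmult_Mat_sum[OF assms(2)] sum_double msum_def)

lemma madj_msum: "madj (msum p q) = msum (madj p) (madj q)"
  by (auto simp: madj_def msum_def intro!: ext)

lemma projections_common:
  assumes "p \<in> projections" "q \<in> projections"
  obtains n where "p \<in> Mat n" "q \<in> Mat n"
  using assms finite_mat_common2[of p q] by (auto simp: projections_def finite_mat_def)

lemma msum_projections:
  assumes "p \<in> projections" "q \<in> projections"
  shows "msum p q \<in> projections"
proof -
  obtain n where "p \<in> Mat n" "q \<in> Mat n" using assms by (rule projections_common)
  then show ?thesis
    using assms msum_Mat by (auto simp: projections_def madj_msum mmult_msum)
qed

lemma mvn_equiv_refl: "p \<in> projections \<Longrightarrow> mvn_equiv p p"
  unfolding mvn_equiv_def projections_def mem_Collect_eq by metis

lemma K0_rel_refl: "p \<in> projections \<Longrightarrow> q \<in> projections \<Longrightarrow> ((p, q), (p, q)) \<in> K0_rel"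
  unfolding K0_rel_def using mvn_equiv_refl msum_projections by blast

context
  fixes \<tau> :: "'a::cstar_algebra \<Rightarrow> complex"
  assumes \<tau>: "tracial_state \<tau>"
begin

lemma mtrace_msum:
  assumes "p \<in> projections" "q \<in> projections"
  shows "mtrace \<tau> (msum p q) = mtrace \<tau> p + mtrace \<tau> q"
proof -
  obtain n where n: "p \<in> Mat n" "q \<in> Mat n" using assms by (rule projections_common)
  then show ?thesis
    by (simp add: mtrace_tracial[OF \<tau> msum_Mat[OF n]] mtrace_tracial[OF \<tau> n(1)]
        mtrace_tracial[OF \<tau> n(2)] sum_double msum_def sum.distrib)
qed

lemma mtrace_mvn_equiv: "mvn_equiv p q \<Longrightarrow> mtrace \<tau> p = mtrace \<tau> q"
proof -
  assume "mvn_equiv p q"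
  then obtain n v where v: "v \<in> Mat n" "mmult (madj v) v = p" "mmult v (madj v) = q"
    by (auto simp: mvn_equiv_def)
  then have "madj v \<in> Mat n" by (simp add: Mat_def madj_def)
  then show ?thesis using mtrace_mmult_commute[OF \<tau>] v by metis
qed

lemma mtrace_K0_rel:
  assumes "((p, q), (p', q')) \<in> K0_rel"
  shows "mtrace \<tau> p - mtrace \<tau> q = mtrace \<tau> p' - mtrace \<tau> q'"
proof -
  obtain r where r: "r \<in> projections" "mvn_equiv (msum (msum p q') r) (msum (msum p' q) r)"
    and P: "p \<in> projections" "q \<in> projections" "p' \<in> projections" "q' \<in> projections"
    using assms by (auto simp: K0_rel_def)
  show ?thesis
    using mtrace_mvn_equiv[OF r(2)] r(1) P by (simp add: mtrace_msum msum_projections) (simp add: algebra_simps)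
qed

lemma K0_classD:
  assumes "X \<in> carrier K0" "(p, q) \<in> X"
  shows "p \<in> projections" "q \<in> projections" "K0_trace \<tau> X = Re (mtrace \<tau> p - mtrace \<tau> q)"
proof -
  obtain a b where X: "X = K0_rel `` {(a, b)}"
    using assms(1) by (auto simp: K0_def quotient_def)
  then show "p \<in> projections" "q \<in> projections" using assms(2) by (auto simp: K0_rel_def)
  have "Re (mtrace \<tau> p' - mtrace \<tau> q') = Re (mtrace \<tau> p - mtrace \<tau> q)" if "(p', q') \<in> X" for p' q'
  proof -
    have "mtrace \<tau> p' - mtrace \<tau> q' = mtrace \<tau> a - mtrace \<tau> b"
      "mtrace \<tau> p - mtrace \<tau> q = mtrace \<tau> a - mtrace \<tau> b"
      using that assms(2) mtrace_K0_rel unfolding X by (metis Image_singleton_iff)+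
    then show ?thesis by simp
  qed
  note same = this
  have "the_elem ((\<lambda>(p, q). Re (mtrace \<tau> p - mtrace \<tau> q)) ` X) =
      (\<lambda>(p, q). Re (mtrace \<tau> p - mtrace \<tau> q)) (p, q)"
  proof (rule the_elem_image_unique)
    fix y assume "y \<in> X"
    then show "(\<lambda>(p, q). Re (mtrace \<tau> p - mtrace \<tau> q)) y = (\<lambda>(p, q). Re (mtrace \<tau> p - mtrace \<tau> q)) (p, q)"
      using same[of "fst y" "snd y"] by (simp add: case_prod_unfold)
  qed (use assms(2) in blast)
  then show "K0_trace \<tau> X = Re (mtrace \<tau> p - mtrace \<tau> q)" by (simp add: K0_trace_def)
qed

text \<open>The unit matrices of all sizes have different traces.\<close>

lemma infinite_K0: "infinite (carrier (K0 :: ('a imat \<times> 'a imat) set monoid))"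
proof -
  define P where "P n i j = (if i = j \<and> i < n then 1 else 0 :: 'a)" for n i j :: nat
  have M: "P n \<in> Mat n" for n by (simp add: P_def Mat_def)
  have "mmult (P n) (P n) i j = P n i j" for n i j
  proof -
    have "mmult (P n) (P n) i j = (\<Sum>k<n. if k = i then P n i j else 0)"
      unfolding mmult_Mat_sum[OF M] by (intro sum.cong) (auto simp: P_def)
    then show ?thesis by (simp add: P_def)
  qed
  then have "mmult (P n) (P n) = P n" for n by (intro ext)
  moreover have "madj (P n) = P n" for n by (auto simp: madj_def P_def intro!: ext)
  ultimately have proj: "P n \<in> projections" for n using M by (auto simp: projections_def)
  define C where "C n = K0_rel `` {(P n, P 0)}" for n
  have C: "C n \<in> carrier K0" for n
    using proj by (auto simp: C_def K0_def intro!: quotientI)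
  have "K0_trace \<tau> (C n) = n" for n
  proof -
    have "(P n, P 0) \<in> C n" unfolding C_def using K0_rel_refl[OF proj proj] by blast
    from K0_classD(3)[OF C this] show ?thesis
      by (simp add: mtrace_tracial[OF \<tau> M] P_def tracial_stateD(4)[OF \<tau>])
  qed
  then have "inj C" by (metis injI of_nat_eq_iff)
  then have "infinite (range C)" by (rule range_inj_infinite)
  then show ?thesis using C by (meson finite_subset image_subsetI)
qed

end

section \<open>Loops of phase zero are null-homotopic\<close>

lemma loop_rel_sym: "(f, g) \<in> loop_rel X x \<Longrightarrow> (g, f) \<in> loop_rel X x"
  by (simp add: loop_rel_def homotopic_with_sym)

lemma loop_rel_trans: "(f, g) \<in> loop_rel X x \<Longrightarrow> (g, h) \<in> loop_rel X x \<Longrightarrow> (f, h) \<in> loop_rel X x"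
  unfolding loop_rel_def mem_Collect_eq case_prod_conv by (rule homotopic_with_trans)

lemma loop_rel_refl: "f \<in> loops X x \<Longrightarrow> (f, f) \<in> loop_rel X x"
  by (simp add: loop_rel_def loops_def pathin_def)

lemma loop_rel_Image_eq:
  "f \<in> loops X x \<Longrightarrow> loop_rel X x `` {f} = loop_rel X x `` {g} \<Longrightarrow> (f, g) \<in> loop_rel X x"
  using loop_rel_refl loop_rel_sym by (metis Image_singleton_iff)

lemma loop_rel_Image_eqI:
  "(f, g) \<in> loop_rel X x \<Longrightarrow> loop_rel X x `` {f} = loop_rel X x `` {g}"
  using loop_rel_sym[of f g X x] loop_rel_trans[of f g X x] loop_rel_trans[of g f X x] by blast

lemma loop_rel_cong:
  assumes "(f, g) \<in> loop_rel X x" "\<And>t. t \<in> {0..1} \<Longrightarrow> f' t = f t \<and> g' t = g t"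
  shows "(f', g') \<in> loop_rel X x"
  using assms(1) unfolding loop_rel_def mem_Collect_eq case_prod_conv
  by (rule homotopic_with_eq) (use assms(2) in auto)

lemma loops_unitaries:
  "f \<in> loops (top_of_set unitaries) 1 \<longleftrightarrow>
     continuous_on {0..1} f \<and> f ` {0..1} \<subseteq> unitaries \<and> f 0 = 1 \<and> f 1 = 1"
  by (auto simp: loops_def pathin_def)

lemma loops_mult:
  assumes "f \<in> loops (top_of_set unitaries) 1" "g \<in> loops (top_of_set unitaries) 1"
  shows "(\<lambda>t. f t * g t) \<in> loops (top_of_set (unitaries :: 'a::cstar_algebra set)) 1"
  using assms unfolding loops_unitaries by (auto intro!: continuous_intros intro: unitary_mult)

lemma loops_adj:
  assumes "f \<in> loops (top_of_set unitaries) 1"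
  shows "(\<lambda>t. adj (f t)) \<in> loops (top_of_set (unitaries :: 'a::cstar_algebra set)) 1"
  using assms unfolding loops_unitaries by (auto intro!: continuous_intros intro: unitary_adj)

lemma loop_rel_mult:
  assumes "(f, f') \<in> loop_rel (top_of_set unitaries) 1" "(g, g') \<in> loop_rel (top_of_set unitaries) 1"
  shows "(\<lambda>t. f t * g t, \<lambda>t. f' t * g' t) \<in> loop_rel (top_of_set (unitaries :: 'a::cstar_algebra set)) 1"
proof -
  let ?P = "prod_topology (top_of_set {0..1::real}) (top_of_set {0..1::real})"
  obtain h where h: "continuous_map ?P (top_of_set unitaries) h"
    "\<forall>t. h (0, t) = f t" "\<forall>t. h (1, t) = f' t" "\<forall>s\<in>{0..1}. h (s, 0) = 1 \<and> h (s, 1) = 1"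
    using assms(1) unfolding loop_rel_def homotopic_with_def mem_Collect_eq case_prod_conv by blast
  obtain k where k: "continuous_map ?P (top_of_set unitaries) k"
    "\<forall>t. k (0, t) = g t" "\<forall>t. k (1, t) = g' t" "\<forall>s\<in>{0..1}. k (s, 0) = 1 \<and> k (s, 1) = 1"
    using assms(2) unfolding loop_rel_def homotopic_with_def mem_Collect_eq case_prod_conv by blast
  have "continuous_map ?P (top_of_set unitaries) (\<lambda>z. h z * k z)"
    using h(1) k(1) unfolding prod_topology_subtopology subtopology_subtopology
    by (auto simp: continuous_map_in_subtopology intro!: continuous_intros intro: unitary_mult)
  then show ?thesis
    unfolding loop_rel_def homotopic_with_def mem_Collect_eq case_prod_conv
    using h(2-4) k(2-4) by (intro exI[of _ "\<lambda>z. h z * k z"]) auto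
qed

lemma the_elem_default: "the_elem S \<noteq> (THE x. False) \<Longrightarrow> \<exists>x. S = {x}"
  by (rule ccontr) (simp add: the_elem_def)

lemma inv_into_default: "y \<notin> f ` A \<Longrightarrow> inv_into A f y = (SOME x. False)"
proof -
  assume "y \<notin> f ` A"
  then have "(\<lambda>x. x \<in> A \<and> f x = y) = (\<lambda>_. False)" by auto
  then show ?thesis by (simp add: inv_into_def)
qed

text \<open>The values that \<open>B_map\<close> can take at a class for which its definition does not produce a Bott
  loop: \<open>THE x. False\<close> is the value of \<open>the_elem\<close> at every set that is not a singleton, be it in
  \<open>induced_pi1\<close> or in \<open>bott_map\<close>; \<open>{}\<close> is the class of a path that is not a loop; and \<open>SOME x. False\<close>
  is the value of \<open>inv_into\<close> outside the range of \<open>bott_map\<close>.\<close>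

definition exceptional :: "('a::cstar_algebra imat \<times> 'a imat) set set" where
  "exceptional = {inv_into (carrier K0) bott_map (THE x. False),
     inv_into (carrier K0) bott_map {}, SOME x. False}"

lemma B_map_nonexceptional:
  fixes C :: "(real \<Rightarrow> 'a::cstar_algebra) set"
  assumes "f \<in> C" "B_map C \<notin> exceptional"
  shows "\<exists>(p, q) \<in> B_map C. (corner \<circ> f, bott_loop p q) \<in> loop_rel U_inf_topology mone"
proof -
  let ?R = "loop_rel (U_inf_topology :: 'a imat topology) mone"
  define c where "c = induced_pi1 (U_inf_topology :: 'a imat topology) mone corner C"
  have B: "B_map C = inv_into (carrier K0) bott_map c" by (simp add: B_map_def c_def)
  have c: "c \<noteq> (THE x. False)" "c \<noteq> {}"
    using assms(2) by (auto simp: B exceptional_def)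
  have "c = ?R `` {corner \<circ> f}"
  proof -
    obtain y where "(\<lambda>p. ?R `` {corner \<circ> p}) ` C = {y}"
      using the_elem_default[OF c(1)[unfolded c_def induced_pi1_def]] by blast
    note y = this
    have "?R `` {corner \<circ> f} \<in> (\<lambda>p. ?R `` {corner \<circ> p}) ` C" by (rule imageI[OF assms(1)])
    then have "y = ?R `` {corner \<circ> f}" unfolding y by simp
    with y show ?thesis unfolding c_def induced_pi1_def by (simp only: the_elem_eq)
  qed
  have "c \<in> bott_map ` carrier K0"
  proof (rule ccontr)
    assume "c \<notin> bott_map ` carrier K0"
    from inv_into_default[OF this] show False using assms(2) by (simp add: B exceptional_def)
  qed
  then have bott: "bott_map (B_map C) = c" unfolding B by (rule f_inv_into_f)
  then obtain y where y: "(\<lambda>(p, q). ?R `` {bott_loop p q}) ` B_map C = {y}"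
    using the_elem_default[OF c(1)[folded bott, unfolded bott_map_def]] by blast
  then have "y = c" using bott unfolding bott_map_def by simp
  with y have "(\<lambda>(p, q). ?R `` {bott_loop p q}) ` B_map C = {c}" by simp
  then have "c \<in> (\<lambda>(p, q). ?R `` {bott_loop p q}) ` B_map C" by simp
  then obtain p q where pq: "(p, q) \<in> B_map C" "c = ?R `` {bott_loop p q}"
    by (auto simp: image_iff)
  obtain g where "g \<in> c" using c(2) by blast
  have "(corner \<circ> f, g) \<in> ?R" using \<open>g \<in> c\<close> \<open>c = ?R `` {corner \<circ> f}\<close> by simp
  moreover have "(bott_loop p q, g) \<in> ?R" using \<open>g \<in> c\<close> unfolding pq(2) by simp
  ultimately have "(corner \<circ> f, bott_loop p q) \<in> ?R" by (blast intro: loop_rel_sym loop_rel_trans)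
  then show ?thesis using pq(1) by blast
qed

text \<open>Choose \<open>f\<close> such that neither \<open>[f]\<close> nor \<open>[fg]\<close> is exceptional. Both classes then have phase
  \<open>2\<pi> \<tau>\<^sub>*(B_map _)\<close>, and these phases agree, so the classes agree.\<close>

lemma phase_zero_null:
  fixes \<tau> :: "'a::cstar_algebra \<Rightarrow> complex"
  assumes \<tau>: "tracial_state \<tau>"
    and B: "bij_betw B_map (carrier (fundamental_group (top_of_set (unitaries :: 'a set)) 1)) (carrier K0)"
    and inj: "inj_on (K0_trace \<tau>) (carrier K0)"
    and g: "g \<in> loops (top_of_set unitaries) 1"
    and g0: "bounded_trace.has_phase (\<lambda>x. Im (\<tau> x)) g 0"
  shows "(g, \<lambda>_. 1) \<in> loop_rel (top_of_set unitaries) 1"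
proof -
  interpret bounded_trace "\<lambda>x. Im (\<tau> x)" by (rule bounded_trace_Im[OF \<tau>])
  define L where "L = loops (top_of_set (unitaries :: 'a set)) 1"
  define R where "R = loop_rel (top_of_set (unitaries :: 'a set)) 1"
  define G where "G = L // R"
  have G: "carrier (fundamental_group (top_of_set (unitaries :: 'a set)) 1) = G"
    by (simp add: fundamental_group_def G_def L_def R_def)
  have infG: "infinite G"
    using infinite_K0[OF \<tau>] bij_betw_finite[OF B] G by simp
  define E where "E = {D \<in> G. B_map D \<in> exceptional}"
  have "finite E"
  proof -
    have "finite (B_map -` exceptional \<inter> G)"
      using B G by (intro finite_vimage_IntI) (auto simp: exceptional_def bij_betw_def)
    then show ?thesis by (rule finite_subset[rotated]) (auto simp: E_def)
  qed
  have phase: "d = 2 * pi * K0_trace \<tau> (B_map (R `` {f}))"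
    if f: "f \<in> L" "has_phase f d" "R `` {f} \<notin> E" for f d
  proof -
    have RG: "R `` {f} \<in> G" using f(1) by (auto simp: G_def intro: quotientI)
    then have K: "B_map (R `` {f}) \<in> carrier K0" using B G bij_betwE by blast
    have "f \<in> R `` {f}" using loop_rel_refl[OF f(1)[unfolded L_def]] by (simp add: R_def)
    moreover have "B_map (R `` {f}) \<notin> exceptional" using f(3) RG by (simp add: E_def)
    ultimately obtain p q where pq: "(p, q) \<in> B_map (R `` {f})"
      "(corner \<circ> f, bott_loop p q) \<in> loop_rel U_inf_topology mone"
      using B_map_nonexceptional by blast
    show ?thesis
      using phase_homotopic_bott_loop[OF \<tau> K0_classD(1,2)[OF \<tau> K pq(1)] f(2) pq(2)]
        K0_classD(3)[OF \<tau> K pq(1)] by simp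
  qed
  \<comment> \<open>Right multiplication by \<open>g\<close> on homotopy classes, through chosen representatives. It is injective,
    so only finitely many classes are moved into \<open>E\<close>.\<close>
  define rep where "rep D = (SOME f. f \<in> L \<and> R `` {f} = D)" for D
  have rep: "rep D \<in> L" "R `` {rep D} = D" if "D \<in> G" for D
  proof -
    have "\<exists>f. f \<in> L \<and> R `` {f} = D" using that by (auto simp: G_def quotient_def)
    then show "rep D \<in> L" "R `` {rep D} = D" unfolding rep_def by (metis (mono_tags, lifting) someI_ex)+
  qed
  define m where "m D = R `` {\<lambda>t. rep D t * g t}" for D
  have L_mult: "(\<lambda>t. f t * g t) \<in> L" if "f \<in> L" for f
    using loops_mult that g unfolding L_def by blast
  have unit: "g t \<in> unitaries" if "t \<in> {0..1}" for t
    using g that unfolding loops_unitaries by blast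
  have "inj_on m G"
  proof
    fix D D' assume D: "D \<in> G" "D' \<in> G" "m D = m D'"
    have "(\<lambda>t. rep D t * g t, \<lambda>t. rep D' t * g t) \<in> R"
      using L_mult[OF rep(1)[OF D(1)]] D(3) unfolding R_def L_def m_def by (rule loop_rel_Image_eq)
    from loop_rel_mult[OF this[unfolded R_def] loop_rel_refl[OF loops_adj[OF g]]]
    have "(rep D, rep D') \<in> R"
      unfolding R_def by (rule loop_rel_cong) (simp add: mult.assoc unit unitariesD)
    then show "D = D'" using rep(2) D(1,2) loop_rel_Image_eqI unfolding R_def by metis
  qed
  then have "finite (m -` E \<inter> G)" using \<open>finite E\<close> by (rule finite_vimage_IntI[rotated])
  then have "infinite (G - (E \<union> (m -` E \<inter> G)))"
    using infG \<open>finite E\<close> by (intro Diff_infinite_finite) auto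
  then obtain D where D: "D \<in> G" "D \<notin> E" "m D \<notin> E"
    using infinite_imp_nonempty by blast
  define f where "f = rep D"
  have f: "f \<in> L" "R `` {f} = D" using rep D(1) by (simp_all add: f_def)
  obtain d where d: "has_phase f d"
    using unitary_path_factorization[OF \<tau>, of f] f(1) unfolding L_def loops_unitaries by blast
  have fg: "has_phase (\<lambda>t. f t * g t) (d + 0)" by (rule has_phase_mult[OF d g0])
  have mD: "m D = R `` {\<lambda>t. f t * g t}" by (simp add: m_def f_def)
  have mG: "m D \<in> G" using L_mult[OF f(1)] by (auto simp: mD G_def intro: quotientI)
  have "K0_trace \<tau> (B_map D) = K0_trace \<tau> (B_map (m D))"
    using phase[OF f(1) d] phase[OF L_mult[OF f(1)] fg] D f(2) mD by simp
  moreover have "B_map D \<in> carrier K0" "B_map (m D) \<in> carrier K0"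
    using B G D(1) mG bij_betwE by blast+
  ultimately have "B_map D = B_map (m D)" using inj by (meson inj_onD)
  then have "D = m D" using B G D(1) mG by (meson bij_betw_def inj_onD)
  then have "(\<lambda>t. f t * g t, f) \<in> R"
    using loop_rel_Image_eq[of "\<lambda>t. f t * g t" "top_of_set unitaries" 1 f] L_mult[OF f(1)] f(2) mD
    unfolding R_def L_def by simp
  from loop_rel_mult[OF loop_rel_refl[OF loops_adj[OF f(1)[unfolded L_def]]] this[unfolded R_def]]
  show ?thesis
  proof (rule loop_rel_cong)
    fix t :: real assume "t \<in> {0..1}"
    then have "f t \<in> unitaries" using f(1) unfolding L_def loops_unitaries by blast
    then show "g t = adj (f t) * (f t * g t) \<and> 1 = adj (f t) * f t"
      by (simp add: mult.assoc[symmetric] unitariesD)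
  qed
qed

section \<open>The group of products of traceless exponentials\<close>

lemma exp_scaleC_one: "exp (c *\<^sub>C (1 :: 'a::cstar_algebra)) = exp c *\<^sub>C 1"
proof -
  have "(c *\<^sub>C (1 :: 'a)) ^ n = c ^ n *\<^sub>C 1" for n
    by (induction n) (simp_all add: mult_scaleC_left scaleC_scaleC)
  then have "(c *\<^sub>C (1 :: 'a)) ^ n /\<^sub>R fact n = (c ^ n /\<^sub>R fact n) *\<^sub>C 1" for n
    by (simp only: scaleC_of_real[symmetric] scaleC_scaleC scaleR_conv_of_real)
  then have "(\<lambda>n. (c ^ n /\<^sub>R fact n) *\<^sub>C (1 :: 'a)) sums exp (c *\<^sub>C 1)"
    using exp_converges[of "c *\<^sub>C (1 :: 'a)"] by simp
  moreover have "(\<lambda>n. (c ^ n /\<^sub>R fact n) *\<^sub>C (1 :: 'a)) sums (exp c *\<^sub>C 1)"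
    by (rule bounded_linear.sums[OF bounded_linear_scaleC_left exp_converges])
  ultimately show ?thesis by (rule sums_unique2)
qed

lemma exp_i_shift: "exp (\<i> *\<^sub>C (h + r *\<^sub>R 1)) = cis r *\<^sub>C exp (\<i> *\<^sub>C (h :: 'a::cstar_algebra))"
proof -
  have "\<i> *\<^sub>C (h + r *\<^sub>R 1) = \<i> *\<^sub>C h + (\<i> * r) *\<^sub>C 1"
    by (simp add: scaleC_add_right scaleC_scaleC flip: scaleC_of_real)
  then have "exp (\<i> *\<^sub>C (h + r *\<^sub>R 1)) = exp (\<i> *\<^sub>C h) * exp ((\<i> * r) *\<^sub>C 1)"
    by (simp only:) (rule exp_add_commuting,
        simp add: mult_scaleC_left mult_scaleC_right scaleC_scaleC mult_ac)
  also have "\<dots> = cis r *\<^sub>C exp (\<i> *\<^sub>C h)"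
    by (simp add: exp_scaleC_one mult_scaleC_right cis_conv_exp)
  finally show ?thesis .
qed

lemma adj_scaleR_one [simp]: "adj (r *\<^sub>R (1 :: 'a::cstar_algebra)) = r *\<^sub>R 1"
  by (simp add: adj_scaleR)

lemma SU_one: "1 \<in> SU \<tau>"
  unfolding SU_def by (auto intro!: exI[of _ "[]"])

lemma SU_mult: "u \<in> SU \<tau> \<Longrightarrow> v \<in> SU \<tau> \<Longrightarrow> u * v \<in> SU \<tau>"
proof -
  assume "u \<in> SU \<tau>" "v \<in> SU \<tau>"
  then obtain hs ks where "set hs \<subseteq> sa_ker \<tau>" "u = prod_list (map (\<lambda>h. exp (\<i> *\<^sub>C h)) hs)"
    "set ks \<subseteq> sa_ker \<tau>" "v = prod_list (map (\<lambda>h. exp (\<i> *\<^sub>C h)) ks)"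
    unfolding SU_def by blast
  then show ?thesis unfolding SU_def by (auto intro!: exI[of _ "hs @ ks"])
qed

lemma SU_exp: "h \<in> sa_ker \<tau> \<Longrightarrow> exp (\<i> *\<^sub>C h) \<in> SU \<tau>"
  unfolding SU_def by (auto intro!: exI[of _ "[h]"])

lemma SU_induct [consumes 1, case_names one exp]:
  assumes "u \<in> SU \<tau>" "P 1"
    and "\<And>h u. h \<in> sa_ker \<tau> \<Longrightarrow> u \<in> SU \<tau> \<Longrightarrow> P u \<Longrightarrow> P (u * exp (\<i> *\<^sub>C h))"
  shows "P u"
proof -
  obtain hs where hs: "set hs \<subseteq> sa_ker \<tau>" "u = prod_list (map (\<lambda>h. exp (\<i> *\<^sub>C h)) hs)"
    using assms(1) unfolding SU_def by blast
  have "P (prod_list (map (\<lambda>h. exp (\<i> *\<^sub>C h)) hs))" using hs(1)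
  proof (induction hs rule: rev_induct)
    case (snoc h hs)
    then have "prod_list (map (\<lambda>h. exp (\<i> *\<^sub>C h)) hs) \<in> SU \<tau>" unfolding SU_def by auto
    then show ?case using snoc assms(3) by simp
  qed (use assms(2) in simp)
  then show ?thesis using hs(2) by simp
qed

lemma SU_unitary: "u \<in> SU \<tau> \<Longrightarrow> u \<in> unitaries"
  by (induction rule: SU_induct) (auto intro: unitary_mult exp_i_unitary simp: sa_ker_def)

context
  fixes \<tau> :: "'a::cstar_algebra \<Rightarrow> complex"
  assumes \<tau>: "tracial_state \<tau>"
begin

lemma sa_ker_minus: "h \<in> sa_ker \<tau> \<Longrightarrow> - h \<in> sa_ker \<tau>"
  using tracial_state_scaleR[OF \<tau>, of "-1" h] by (simp add: sa_ker_def)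

lemma SU_adj: "u \<in> SU \<tau> \<Longrightarrow> adj u \<in> SU \<tau>"
proof (induction rule: SU_induct)
  case (exp h u)
  have "adj (exp (\<i> *\<^sub>C h)) = exp (\<i> *\<^sub>C (- h))"
    using exp(1) by (simp add: adj_exp adj_scaleC sa_ker_def)
  then show ?case
    using SU_mult[OF SU_exp[OF sa_ker_minus[OF exp(1)]] exp(3)] by (simp add: adj_mult)
qed (simp add: SU_one)

lemma group_SU: "group (SU_group \<tau>)"
proof (rule groupI)
  show "\<exists>y\<in>carrier (SU_group \<tau>). y \<otimes>\<^bsub>SU_group \<tau>\<^esub> x = \<one>\<^bsub>SU_group \<tau>\<^esub>" if "x \<in> carrier (SU_group \<tau>)" for x
    using that SU_adj SU_unitary unitariesD(1) by (fastforce simp: SU_group_def)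
qed (auto simp: SU_group_def SU_one SU_mult mult.assoc)

lemma Re_trace_shift: "Re (\<tau> (h - r *\<^sub>R 1)) = Re (\<tau> h) - r"
  using tracial_stateD(1)[OF \<tau>, of "h - r *\<^sub>R 1" "r *\<^sub>R 1"]
  by (simp add: tracial_state_scaleR[OF \<tau>] tracial_stateD(4)[OF \<tau>])

lemma sa_kerI: "adj h = h \<Longrightarrow> Re (\<tau> h) = 0 \<Longrightarrow> h \<in> sa_ker \<tau>"
  using tracial_state_selfadjoint(1)[OF \<tau>] by (auto simp: sa_ker_def complex_eq_iff complex_is_Real_iff)

lemma sa_ker_shift: "adj h = h \<Longrightarrow> h - Re (\<tau> h) *\<^sub>R 1 \<in> sa_ker \<tau>"
  by (rule sa_kerI) (simp_all add: adj_diff Re_trace_shift)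

lemma exp_i_traceless: "exp (\<i> *\<^sub>C (h - r *\<^sub>R 1)) = cis (- r) *\<^sub>C exp (\<i> *\<^sub>C (h :: 'a))"
  using exp_i_shift[of h "- r"] by simp

text \<open>The scalar is distributed over the factors: each \<open>exp(ih)\<close> becomes \<open>exp(i(h - \<tau>(h)))\<close>.\<close>

lemma scaled_product_in_SU:
  "\<forall>h\<in>set hs. adj h = h \<Longrightarrow>
   cis (- Re (\<tau> (sum_list hs))) *\<^sub>C prod_list (map (\<lambda>h. exp (\<i> *\<^sub>C h)) hs) \<in> SU \<tau>"
proof (induction hs)
  case Nil
  then show ?case by (simp add: tracial_state_0[OF \<tau>] SU_one)
next
  case (Cons h hs)
  have "cis (- Re (\<tau> (sum_list (h # hs)))) *\<^sub>C prod_list (map (\<lambda>h. exp (\<i> *\<^sub>C h)) (h # hs)) =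
      exp (\<i> *\<^sub>C (h - Re (\<tau> h) *\<^sub>R 1)) *
      (cis (- Re (\<tau> (sum_list hs))) *\<^sub>C prod_list (map (\<lambda>h. exp (\<i> *\<^sub>C h)) hs))"
    by (simp add: exp_i_traceless mult_scaleC_left mult_scaleC_right scaleC_scaleC cis_mult
        tracial_stateD(1)[OF \<tau>] add.commute)
  moreover have "adj h = h" using Cons.prems by simp
  ultimately show ?case using Cons SU_mult[OF SU_exp[OF sa_ker_shift[OF \<open>adj h = h\<close>]]] by simp
qed

section \<open>Splitting off the phase\<close>

interpretation bounded_trace "\<lambda>x. Im (\<tau> x)" by (rule bounded_trace_Im[OF \<tau>])

definition phase :: "(real \<Rightarrow> 'a) \<Rightarrow> real" where
  "phase f = (THE d. has_phase f d)"

definition split_phase :: "(real \<Rightarrow> 'a) \<Rightarrow> real \<times> 'a" where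
  "split_phase f = (phase f, cis (- phase f) *\<^sub>C f 1)"

lemma phase_eqI: "has_phase f d \<Longrightarrow> phase f = d"
  unfolding phase_def using has_phase_unique by blast

lemma based_pathsD:
  assumes "f \<in> based_paths"
  shows "continuous_on {0..1} f" "f ` {0..1} \<subseteq> unitaries" "f 0 = 1" "f \<in> extensional {0..1}"
    "\<And>t. t \<in> {0..1} \<Longrightarrow> f t \<in> unitaries"
  using assms by (auto simp: based_paths_def)

lemma restrict_based_paths:
  assumes "continuous_on {0..1} f" "\<And>t. t \<in> {0..1} \<Longrightarrow> f t \<in> unitaries" "f 0 = 1"
  shows "restrict f {0..1} \<in> based_paths"
  using assms continuous_on_cong[of "{0..1}" "{0..1}" f "restrict f {0..1}"]
  by (auto simp: based_paths_def)

lemma has_phase_restrict: "has_phase f d \<Longrightarrow> has_phase (restrict f {0..1}) d"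
  by (erule has_phase_cong) simp

lemma has_phase_phase: "f \<in> based_paths \<Longrightarrow> has_phase f (phase f)"
  using unitary_path_factorization[OF \<tau>] based_pathsD phase_eqI by metis

lemma based_paths_mult:
  assumes "f \<in> based_paths" "g \<in> based_paths"
  shows "(\<lambda>t\<in>{0..1}. f t * g t) \<in> based_paths"
  using based_pathsD[OF assms(1)] based_pathsD[OF assms(2)]
  by (intro restrict_based_paths continuous_intros unitary_mult) auto

lemma phase_mult:
  assumes "f \<in> based_paths" "g \<in> based_paths"
  shows "phase (\<lambda>t\<in>{0..1}. f t * g t) = phase f + phase g"
  by (intro phase_eqI has_phase_restrict has_phase_mult has_phase_phase assms)

lemma exp_path:
  assumes "adj h = h"
  shows "(\<lambda>t\<in>{0..1}. exp (t *\<^sub>R (\<i> *\<^sub>C h))) \<in> based_paths"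
    "phase (\<lambda>t\<in>{0..1}. exp (t *\<^sub>R (\<i> *\<^sub>C h))) = Re (\<tau> h)"
proof -
  show "(\<lambda>t\<in>{0..1}. exp (t *\<^sub>R (\<i> *\<^sub>C h))) \<in> based_paths"
  proof (rule restrict_based_paths)
    show "continuous_on {0..1} (\<lambda>t. exp (t *\<^sub>R (\<i> *\<^sub>C h)))"
      by (intro continuous_at_imp_continuous_on ballI)
        (rule has_vector_derivative_continuous[OF exp_scaleR_has_vector_derivative_right])
    show "exp (t *\<^sub>R (\<i> *\<^sub>C h)) \<in> unitaries" for t
      using exp_i_unitary[of "t *\<^sub>R h"] assms by (simp add: scaleC_scaleR adj_scaleR)
  qed simp
  show "phase (\<lambda>t\<in>{0..1}. exp (t *\<^sub>R (\<i> *\<^sub>C h))) = Re (\<tau> h)"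
    using has_phase_exp[OF \<tau>, of "\<i> *\<^sub>C h"] by (intro phase_eqI has_phase_restrict) (simp add: Im_trace_i[OF \<tau>])
qed

lemma split_phase_carrier: "f \<in> based_paths \<Longrightarrow> snd (split_phase f) \<in> SU \<tau>"
proof -
  assume f: "f \<in> based_paths"
  obtain hs where hs: "\<forall>h\<in>set hs. adj h = h" "f 1 = prod_list (map (\<lambda>h. exp (\<i> *\<^sub>C h)) hs)"
    "has_phase f (Re (\<tau> (sum_list hs)))"
    using unitary_path_factorization[OF \<tau> based_pathsD(1-3)[OF f]] by blast
  then show ?thesis
    using scaled_product_in_SU[OF hs(1)] phase_eqI[OF hs(3)] by (simp add: split_phase_def)
qed

text \<open>Since \<open>h\<close> and the scalar \<open>r\<close> change the two components independently, this gives both the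
  surjectivity and the openness of \<open>split_phase\<close>.\<close>

lemma split_phase_mult_exp:
  fixes r :: real
  assumes f: "f \<in> based_paths" and h: "h \<in> sa_ker \<tau>"
  defines "g \<equiv> (\<lambda>t\<in>{0..1}. f t * exp (t *\<^sub>R (\<i> *\<^sub>C (h + r *\<^sub>R 1))))"
  shows "g \<in> based_paths" "split_phase g = (phase f + r, snd (split_phase f) * exp (\<i> *\<^sub>C h))"
proof -
  let ?k = "\<lambda>t\<in>{0..1}. exp (t *\<^sub>R (\<i> *\<^sub>C (h + r *\<^sub>R 1)))"
  have sa: "adj (h + r *\<^sub>R 1) = h + r *\<^sub>R 1" using h by (simp add: adj_add sa_ker_def)
  have r: "Re (\<tau> (h + r *\<^sub>R 1)) = r" using h Re_trace_shift[of h "- r"] by (simp add: sa_ker_def)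
  have g: "g = (\<lambda>t\<in>{0..1}. f t * ?k t)" unfolding g_def by auto
  show "g \<in> based_paths" unfolding g by (intro based_paths_mult f exp_path sa)
  have "phase g = phase f + r" unfolding g using phase_mult[OF f exp_path(1)[OF sa]] exp_path(2)[OF sa] r by simp
  moreover have "g 1 = cis r *\<^sub>C (f 1 * exp (\<i> *\<^sub>C h))"
    by (simp add: g_def exp_i_shift mult_scaleC_right)
  ultimately show "split_phase g = (phase f + r, snd (split_phase f) * exp (\<i> *\<^sub>C h))"
    by (simp add: split_phase_def scaleC_scaleC mult_scaleC_left cis_mult)
qed

lemma group_path_group: "group (path_group :: (real \<Rightarrow> 'a) monoid)"
proof (rule groupI)
  show "\<one>\<^bsub>path_group\<^esub> \<in> carrier (path_group :: (real \<Rightarrow> 'a) monoid)"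
    unfolding path_group_def by (auto intro: restrict_based_paths)
  fix f g h :: "real \<Rightarrow> 'a"
  assume f: "f \<in> carrier path_group"
  then have f': "f \<in> based_paths" by (simp add: path_group_def)
  show "\<one>\<^bsub>path_group\<^esub> \<otimes>\<^bsub>path_group\<^esub> f = f"
    using based_pathsD(4)[OF f'] by (auto simp: path_group_def extensional_def fun_eq_iff)
  show "\<exists>g\<in>carrier path_group. g \<otimes>\<^bsub>path_group\<^esub> f = \<one>\<^bsub>path_group\<^esub>"
  proof
    show "(\<lambda>t\<in>{0..1}. adj (f t)) \<in> carrier path_group"
      using based_pathsD[OF f'] unfolding path_group_def
      by (auto intro!: restrict_based_paths continuous_intros unitary_adj)
    show "(\<lambda>t\<in>{0..1}. adj (f t)) \<otimes>\<^bsub>path_group\<^esub> f = \<one>\<^bsub>path_group\<^esub>"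
      using unitariesD(1)[OF based_pathsD(5)[OF f']] by (auto simp: path_group_def fun_eq_iff)
  qed
  assume "g \<in> carrier path_group"
  then show "f \<otimes>\<^bsub>path_group\<^esub> g \<in> carrier path_group"
    using f by (simp add: path_group_def based_paths_mult)
  assume "h \<in> carrier path_group"
  show "f \<otimes>\<^bsub>path_group\<^esub> g \<otimes>\<^bsub>path_group\<^esub> h = f \<otimes>\<^bsub>path_group\<^esub> (g \<otimes>\<^bsub>path_group\<^esub> h)"
    by (auto simp: path_group_def mult.assoc)
qed

abbreviation (input) target :: "(real \<times> 'a) monoid" where
  "target \<equiv> add_group \<times>\<times> SU_group \<tau>"

lemma group_add_group: "group (add_group :: real monoid)"
  by (rule groupI) (auto simp: add_group_def intro: exI[of _ "- _"])

lemma group_hom_split_phase: "group_hom path_group target split_phase"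
proof (intro group_hom.intro group_hom_axioms.intro)
  show "group (path_group :: (real \<Rightarrow> 'a) monoid)" by (rule group_path_group)
  show "group target" by (intro DirProd_group group_add_group group_SU)
  show "split_phase \<in> hom path_group target"
  proof (rule homI)
    fix f :: "real \<Rightarrow> 'a" assume "f \<in> carrier path_group"
    then show "split_phase f \<in> carrier target"
      using split_phase_carrier[of f]
      by (auto simp: path_group_def add_group_def SU_group_def mem_Times_iff)
  next
    fix f g :: "real \<Rightarrow> 'a" assume "f \<in> carrier path_group" "g \<in> carrier path_group"
    then have "phase (\<lambda>t\<in>{0..1}. f t * g t) = phase f + phase g"
      by (intro phase_mult) (auto simp: path_group_def)
    then show "split_phase (f \<otimes>\<^bsub>path_group\<^esub> g) = split_phase f \<otimes>\<^bsub>target\<^esub> split_phase g"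
      by (simp add: split_phase_def path_group_def add_group_def SU_group_def
          mult_scaleC_left mult_scaleC_right scaleC_scaleC cis_mult add.commute)
  qed
qed

lemma split_phase_surj: "split_phase ` based_paths = UNIV \<times> SU \<tau>"
proof
  show "split_phase ` based_paths \<subseteq> UNIV \<times> SU \<tau>"
    using split_phase_carrier by (simp add: image_subset_iff mem_Times_iff)
  have "\<exists>f\<in>based_paths. split_phase f = (r, u)" if "u \<in> SU \<tau>" for r u
  proof -
    have "\<exists>f\<in>based_paths. split_phase f = (0, u)" using that
    proof (induction rule: SU_induct)
      case one
      define c where "c = restrict (\<lambda>_. 1 :: 'a) {0..1 :: real}"
      have "c \<in> based_paths" unfolding c_def by (rule restrict_based_paths) auto
      moreover have "phase c = 0"
        unfolding c_def by (intro phase_eqI has_phase_restrict has_phase_const_1)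
      moreover have "c 1 = 1" by (simp add: c_def)
      ultimately show ?case by (intro bexI[of _ c]) (simp_all add: split_phase_def)
    next
      case (exp h u)
      then obtain f where f: "f \<in> based_paths" "split_phase f = (0, u)" by blast
      have "phase f = 0" using f(2) by (simp add: split_phase_def)
      then show ?case
        using split_phase_mult_exp[OF f(1) exp(1), of 0] f(2) by (metis add_0 snd_conv)
    qed
    then obtain f where f: "f \<in> based_paths" "split_phase f = (0, u)" by blast
    have "0 \<in> sa_ker \<tau>" by (simp add: sa_ker_def tracial_state_0[OF \<tau>])
    from split_phase_mult_exp[OF f(1) this, of r] show ?thesis
      using f(2) by (intro bexI) (auto simp: split_phase_def)
  qed
  then show "UNIV \<times> SU \<tau> \<subseteq> split_phase ` based_paths" by (auto simp: image_iff) (metis)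
qed

lemma null_loops_phase:
  assumes "f \<in> null_loops"
  shows "phase f = 0" "f 1 = 1"
proof -
  have f: "f \<in> based_paths" and hp: "homotopic_paths unitaries f (\<lambda>_. 1)"
    using assms by (auto simp: null_loops_def)
  show "f 1 = 1" using homotopic_paths_imp_pathfinish[OF hp] by (simp add: pathfinish_def)
  obtain h where h: "continuous_on ({0..1} \<times> {0..1}) h" "h \<in> {0..1} \<times> {0..1} \<rightarrow> unitaries"
    "\<forall>t\<in>{0..1}. h (0, t) = f t" "\<forall>t\<in>{0..1}. h (1, t) = 1"
    "\<forall>s\<in>{0..1::real}. pathstart (h \<circ> Pair s) = pathstart f \<and> pathfinish (h \<circ> Pair s) = pathfinish f"
    using hp unfolding homotopic_paths image_subset_iff_funcset by blast
  have "has_phase (\<lambda>t. h (1, t)) (phase f)"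
  proof (rule has_phase_homotopy[where H' = "\<lambda>z. adj (h z)"])
    show "continuous_on ({0..1} \<times> {0..1}) (\<lambda>z. adj (h z))" by (intro continuous_intros h)
    show "h z * adj (h z) = 1 \<and> adj (h z) * h z = 1" if "z \<in> {0..1} \<times> {0..1}" for z
      using h(2) that by (auto simp: unitaries_def)
    show "has_phase (\<lambda>t. h (0, t)) (phase f)"
      by (rule has_phase_cong[OF has_phase_phase[OF f]]) (use h(3) in auto)
  qed (use h(1,3,5) in \<open>auto simp: pathstart_def pathfinish_def\<close>)
  then have "has_phase (\<lambda>_. 1) (phase f)" by (rule has_phase_cong) (use h(4) in auto)
  then show "phase f = 0" using has_phase_unique has_phase_const_1 by blast
qed

lemma kernel_split_phase:
  assumes B: "bij_betw B_map (carrier (fundamental_group (top_of_set (unitaries :: 'a set)) 1)) (carrier K0)"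
    and inj: "inj_on (K0_trace \<tau>) (carrier K0)"
  shows "kernel path_group target split_phase = null_loops"
proof
  show "null_loops \<subseteq> kernel path_group target split_phase"
    using null_loops_phase
    by (auto simp: kernel_def path_group_def split_phase_def add_group_def SU_group_def null_loops_def)
  show "kernel path_group target split_phase \<subseteq> null_loops"
  proof
    fix f assume "f \<in> kernel path_group target split_phase"
    then have f: "f \<in> based_paths" "phase f = 0" "f 1 = 1"
      by (auto simp: kernel_def path_group_def split_phase_def add_group_def SU_group_def)
    then have "f \<in> loops (top_of_set unitaries) 1"
      using based_pathsD[OF f(1)] by (simp add: loops_unitaries)
    moreover have "has_phase f 0" using has_phase_phase[OF f(1)] f(2) by simp
    ultimately have "(f, \<lambda>_. 1) \<in> loop_rel (top_of_set unitaries) 1" by (rule phase_zero_null[OF \<tau> B inj])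
    then have "homotopic_paths unitaries f (\<lambda>_. 1)"
      using f(3) based_pathsD(3)[OF f(1)]
      by (simp add: loop_rel_def homotopic_paths_def pathstart_def pathfinish_def)
    then show "f \<in> null_loops" using f(1) by (simp add: null_loops_def)
  qed
qed

section \<open>Continuity and openness\<close>

lemma path_dist_ge:
  assumes "f \<in> based_paths" "g \<in> based_paths" "t \<in> {0..1}"
  shows "dist (f t) (g t) \<le> path_dist f (g :: real \<Rightarrow> 'a)"
proof -
  have "continuous_on {0..1} (\<lambda>t. dist (f t) (g t))"
    using based_pathsD(1) assms by (intro continuous_intros) auto
  then have "bdd_above ((\<lambda>t. dist (f t) (g t)) ` {0..1})"
    by (intro bounded_imp_bdd_above compact_imp_bounded compact_continuous_image) auto
  from cSUP_upper[OF assms(3) this] show ?thesis using assms by (simp add: path_dist_def)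
qed

lemma path_dist_le:
  assumes "f \<in> based_paths" "g \<in> based_paths" "\<And>t. t \<in> {0..1} \<Longrightarrow> dist (f t) (g t) \<le> c"
  shows "path_dist f (g :: real \<Rightarrow> 'a) \<le> c"
  unfolding path_dist_def using assms by (auto intro!: cSUP_least)

lemma openin_path_topology:
  "openin path_topology W \<longleftrightarrow> W \<subseteq> based_paths \<and>
     (\<forall>f\<in>W. \<exists>\<delta>>0. \<forall>g\<in>based_paths. path_dist f g < \<delta> \<longrightarrow> g \<in> (W :: (real \<Rightarrow> 'a) set))"
proof -
  interpret Metric_space "based_paths :: (real \<Rightarrow> 'a) set" path_dist by (rule Metric_space_based_paths)
  have "mball f r \<subseteq> W \<longleftrightarrow> (\<forall>g\<in>based_paths. path_dist f g < r \<longrightarrow> g \<in> W)"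
    if "f \<in> based_paths" for f r
    using that by (auto simp: in_mball)
  then have "(\<forall>f\<in>W. \<exists>r>0. mball f r \<subseteq> W) \<longleftrightarrow>
      (\<forall>f\<in>W. \<exists>r>0. \<forall>g\<in>based_paths. path_dist f g < r \<longrightarrow> g \<in> W)" if "W \<subseteq> based_paths"
    using that by (simp add: subset_iff)
  moreover have "openin mtopology W \<longleftrightarrow> W \<subseteq> based_paths \<and> (\<forall>f\<in>W. \<exists>r>0. mball f r \<subseteq> W)"
    by (auto simp: openin_mtopology)
  ultimately show ?thesis unfolding path_topology_def by blast
qed

lemma topspace_path_topology: "topspace path_topology = (based_paths :: (real \<Rightarrow> 'a) set)"
  using Metric_space.topspace_mtopology[OF Metric_space_based_paths] by (simp add: path_topology_def)

text \<open>Here \<open>g = f k\<close> with \<open>k\<close> uniformly near 1, so the phase of \<open>k\<close> is \<open>\<tau>(a)\<close> for the logarithm \<open>ia\<close>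
  of \<open>k(1)\<close>, and \<open>h = a - \<tau>(a)\<close>. The constants come from \<open>\<parallel>a\<parallel> < 2\<delta>\<close> and
  \<open>\<bar>\<tau>(a)\<bar> \<le> 8 \<parallel>a\<parallel>\<close>.\<close>

lemma split_phase_near:
  assumes f: "f \<in> based_paths" and g: "g \<in> based_paths" and d: "path_dist f g < \<delta>" "\<delta> \<le> 1 / 8"
  shows "\<exists>h\<in>sa_ker \<tau>. norm h < 18 * \<delta> \<and> \<bar>phase g - phase f\<bar> < 16 * \<delta> \<and>
    snd (split_phase g) = snd (split_phase f) * exp (\<i> *\<^sub>C h)"
proof -
  have near: "norm (adj (f t) * g t - 1) < \<delta>" if "t \<in> {0..1}" for t
  proof -
    have ft: "f t \<in> unitaries" using based_pathsD(5)[OF f that] .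
    have "adj (f t) * g t - 1 = adj (f t) * (g t - f t)"
      using unitariesD(1)[OF ft] by (simp add: algebra_simps)
    then have "norm (adj (f t) * g t - 1) \<le> norm (adj (f t)) * norm (g t - f t)"
      by (simp only: norm_mult_ineq)
    also have "\<dots> = dist (f t) (g t)" by (simp add: norm_unitary[OF ft] dist_norm norm_minus_commute)
    also have "\<dots> < \<delta>" using path_dist_ge[OF f g that] d(1) by linarith
    finally show ?thesis .
  qed
  define w where "w = adj (f 1) * g 1"
  have f1: "f 1 \<in> unitaries" and g1: "g 1 \<in> unitaries"
    using based_pathsD(5)[OF f, of 1] based_pathsD(5)[OF g, of 1] by simp_all
  have w: "w \<in> unitaries" "norm (w - 1) < \<delta>"
    using near[of 1] unitary_mult[OF unitary_adj[OF f1] g1] by (auto simp: w_def)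
  then obtain h where h: "adj h = h" "w = exp (\<i> *\<^sub>C h)" "norm h \<le> 2 * norm (w - 1)"
    using unitary_log[of w] d(2) by force
  define r where "r = Re (\<tau> h)"
  have nh: "norm h < 2 * \<delta>" using h(3) w(2) by linarith
  have r: "\<bar>r\<bar> < 16 * \<delta>" using tracial_state_selfadjoint(2)[OF \<tau> h(1)] nh by (simp add: r_def)
  have "logtr w = r"
    using logtr_exp[OF \<tau>, of "\<i> *\<^sub>C h"] nh d(2) by (simp add: h(2) norm_scaleC Im_trace_i[OF \<tau>] r_def)
  moreover have "has_phase g (phase f + (logtr (adj (f 1) * g 1) - logtr (adj (f 0) * g 0)))"
  proof (rule has_phase_transport[OF has_phase_phase[OF f]])
    show "norm (adj (f t) * g t - 1) \<le> 1 / 4" if "t \<in> {0..1}" for t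
      using near[OF that] d(2) by linarith
  qed (rule inv_path_unitary[OF \<tau> based_pathsD(1,2)[OF f]] inv_path_unitary[OF \<tau> based_pathsD(1,2)[OF g]])+
  ultimately have pg: "phase g = phase f + r"
    using based_pathsD(3)[OF f] based_pathsD(3)[OF g] by (intro phase_eqI) (simp add: w_def)
  have "norm (h - r *\<^sub>R 1) \<le> norm h + \<bar>r\<bar>" using norm_triangle_ineq4[of h "r *\<^sub>R 1"] by simp
  then have "norm (h - r *\<^sub>R 1) < 18 * \<delta>" using nh r by linarith
  moreover have "h - r *\<^sub>R 1 \<in> sa_ker \<tau>" unfolding r_def by (rule sa_ker_shift[OF h(1)])
  moreover have "snd (split_phase g) = snd (split_phase f) * exp (\<i> *\<^sub>C (h - r *\<^sub>R 1))"
  proof -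
    have "g 1 = f 1 * exp (\<i> *\<^sub>C h)"
      using unitariesD(2)[OF f1] by (simp add: h(2)[symmetric] w_def mult.assoc[symmetric])
    then show ?thesis
      by (simp add: split_phase_def pg exp_i_traceless mult_scaleC_left mult_scaleC_right scaleC_scaleC
          cis_mult add.commute)
  qed
  ultimately show ?thesis using r pg by (intro bexI[of _ "h - r *\<^sub>R 1"]) auto
qed

lemma topspace_SU: "topspace (SU_topology \<tau>) = SU \<tau>"
proof -
  have "openin (SU_topology \<tau>) (SU \<tau>)"
    unfolding openin_SU_topology SU_nhd_def
    by (auto intro!: exI[of _ 1] SU_mult SU_exp)
  then show ?thesis by (metis openin_SU_topology openin_subset openin_topspace subset_antisym)
qed

lemma continuous_map_split_phase:
  "continuous_map path_topology (prod_topology euclideanreal (SU_topology \<tau>)) split_phase"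
proof -
  have "continuous_map path_topology euclideanreal (\<lambda>f. phase f)"
    unfolding continuous_map_def topspace_path_topology
  proof (intro conjI allI impI)
    fix V :: "real set" assume "openin euclideanreal V"
    then have V: "open V" by simp
    show "openin path_topology {f \<in> based_paths. phase f \<in> V}"
      unfolding openin_path_topology
    proof (intro conjI ballI)
      fix f assume "f \<in> {f \<in> based_paths. phase f \<in> V}"
      then have f: "f \<in> based_paths" "phase f \<in> V" by auto
      obtain e where e: "e > 0" "\<And>x. \<bar>x - phase f\<bar> < e \<Longrightarrow> x \<in> V"
        using V f(2) by (metis open_real)
      define \<delta> where "\<delta> = min (1 / 8) (e / 16)"
      have "g \<in> {f \<in> based_paths. phase f \<in> V}" if "g \<in> based_paths" "path_dist f g < \<delta>" for g
        using split_phase_near[OF f(1) that] e(2)[of "phase g"] that(1) by (force simp: \<delta>_def)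
      moreover have "\<delta> > 0" using e(1) by (simp add: \<delta>_def)
      ultimately show "\<exists>\<delta>>0. \<forall>g\<in>based_paths. path_dist f g < \<delta> \<longrightarrow> g \<in> {f \<in> based_paths. phase f \<in> V}"
        by blast
    qed auto
  qed auto
  moreover have "continuous_map path_topology (SU_topology \<tau>) (\<lambda>f. snd (split_phase f))"
    unfolding continuous_map_def topspace_path_topology topspace_SU
  proof (intro conjI allI impI)
    fix V assume V: "openin (SU_topology \<tau>) V"
    show "openin path_topology {f \<in> based_paths. snd (split_phase f) \<in> V}"
      unfolding openin_path_topology
    proof (intro conjI ballI)
      fix f assume "f \<in> {f \<in> based_paths. snd (split_phase f) \<in> V}"
      then have f: "f \<in> based_paths" "snd (split_phase f) \<in> V" by auto
      obtain e where e: "e > 0" "(\<lambda>v. snd (split_phase f) * v) ` SU_nhd \<tau> e \<subseteq> V"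
        using V f(2) unfolding openin_SU_topology by blast
      define \<delta> where "\<delta> = min (1 / 8) (e / 18)"
      have "\<delta> \<le> 1 / 8" by (simp add: \<delta>_def)
      have "g \<in> {f \<in> based_paths. snd (split_phase f) \<in> V}" if g: "g \<in> based_paths" "path_dist f g < \<delta>" for g
      proof -
        obtain h where "h \<in> sa_ker \<tau>" "norm h < 18 * \<delta>"
          "snd (split_phase g) = snd (split_phase f) * exp (\<i> *\<^sub>C h)"
          using split_phase_near[OF f(1) g] \<open>\<delta> \<le> 1 / 8\<close> by blast
        moreover have "18 * \<delta> \<le> e" by (simp add: \<delta>_def)
        ultimately have "exp (\<i> *\<^sub>C h) \<in> SU_nhd \<tau> e" unfolding SU_nhd_def by fastforce
        then show ?thesis
          using e(2) g(1) \<open>snd (split_phase g) = _\<close> by auto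
      qed
      moreover have "\<delta> > 0" using e(1) by (simp add: \<delta>_def)
      ultimately show "\<exists>\<delta>>0. \<forall>g\<in>based_paths. path_dist f g < \<delta> \<longrightarrow>
          g \<in> {f \<in> based_paths. snd (split_phase f) \<in> V}"
        by blast
    qed auto
  qed (use split_phase_carrier in auto)
  ultimately have "continuous_map path_topology (prod_topology euclideanreal (SU_topology \<tau>))
      (\<lambda>f. (phase f, snd (split_phase f)))"
    by (rule continuous_map_pairedI)
  then show ?thesis by (simp add: split_phase_def[abs_def])
qed

text \<open>The translates are not only neighbourhoods of \<open>u\<close> but open: for \<open>h, k\<close> in \<open>sa_ker \<tau>\<close>, with \<open>k\<close>
  small, the logarithm \<open>il\<close> of \<open>exp(ih) exp(ik)\<close> has trace zero because the trace of the logarithm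
  is additive, and \<open>l\<close> is within \<open>3 \<parallel>k\<parallel>\<close> of \<open>h\<close>.\<close>

lemma openin_translate_SU_nhd:
  assumes u: "u \<in> SU \<tau>" and \<delta>: "\<delta> \<le> 1 / 24"
  shows "openin (SU_topology \<tau>) ((\<lambda>v. u * v) ` SU_nhd \<tau> \<delta>)"
  unfolding openin_SU_topology
proof (intro conjI ballI)
  show "(\<lambda>v. u * v) ` SU_nhd \<tau> \<delta> \<subseteq> SU \<tau>"
    using u by (auto simp: SU_nhd_def intro!: SU_mult SU_exp)
  fix v assume "v \<in> (\<lambda>v. u * v) ` SU_nhd \<tau> \<delta>"
  then obtain h where h: "h \<in> sa_ker \<tau>" "norm h < \<delta>" "v = u * exp (\<i> *\<^sub>C h)"
    by (auto simp: SU_nhd_def)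
  define \<epsilon> where "\<epsilon> = (\<delta> - norm h) / 3"
  have \<epsilon>0: "\<epsilon> > 0" using h(2) by (simp add: \<epsilon>_def)
  have "\<delta> - norm h \<le> 1 / 24" using \<delta> norm_ge_zero[of h] by linarith
  then have \<epsilon>: "\<epsilon> \<le> 1 / 72" by (simp add: \<epsilon>_def)
  have "v * exp (\<i> *\<^sub>C k) \<in> (\<lambda>v. u * v) ` SU_nhd \<tau> \<delta>" if k: "k \<in> sa_ker \<tau>" "norm k < \<epsilon>" for k
  proof -
    let ?a = "\<i> *\<^sub>C h" and ?b = "\<i> *\<^sub>C k"
    have ab: "norm ?a < 1 / 24" "norm ?b < 1 / 72" "norm ?b < \<epsilon>" "norm ?a = norm h"
      using h(2) k(2) \<delta> \<epsilon> by (auto simp: norm_scaleC)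
    have ua: "exp ?a \<in> unitaries" "exp ?b \<in> unitaries"
      using h(1) k(1) by (auto intro: exp_i_unitary simp: sa_ker_def)
    have na: "norm (exp ?a - 1) \<le> 1 / 16" and nb: "norm (exp ?b - 1) \<le> 1 / 48"
      and nb': "norm (exp ?b - 1) \<le> 3 / 2 * norm ?b"
      using norm_exp_minus_one_le_linear[of ?a] norm_exp_minus_one_le_linear[of ?b] ab by auto
    define w where "w = exp ?a * exp ?b"
    have w: "w \<in> unitaries" unfolding w_def by (intro unitary_mult ua)
    have wa: "norm (w - exp ?a) \<le> norm (exp ?b - 1)"
    proof -
      have "w - exp ?a = exp ?a * (exp ?b - 1)" by (simp add: w_def algebra_simps)
      then have "norm (w - exp ?a) \<le> norm (exp ?a) * norm (exp ?b - 1)" by (simp only: norm_mult_ineq)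
      then show ?thesis using norm_unitary[OF ua(1)] by simp
    qed
    have "norm (w - 1) \<le> norm (w - exp ?a) + norm (exp ?a - 1)"
      using norm_triangle_ineq[of "w - exp ?a" "exp ?a - 1"] by simp
    then have w1: "norm (w - 1) \<le> 1 / 8" using wa na nb by linarith
    obtain l where l: "adj l = l" "w = exp (\<i> *\<^sub>C l)" "norm l \<le> 2 * norm (w - 1)"
      by (rule unitary_log[OF w w1])
    have nl: "norm (\<i> *\<^sub>C l) \<le> 1 / 4" using l(3) w1 by (simp add: norm_scaleC)
    have "Re (\<tau> l) = logtr w"
      using logtr_exp[OF \<tau> nl] by (simp add: l(2) Im_trace_i[OF \<tau>])
    also have "\<dots> = logtr (exp ?a) + logtr (exp ?b)"
      unfolding w_def using na nb unitariesD(2)[OF ua(2)] by (intro logtr_mult) auto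
    also have "\<dots> = 0"
      using logtr_exp[OF \<tau>, of ?a] logtr_exp[OF \<tau>, of ?b] ab h(1) k(1)
      by (simp add: Im_trace_i[OF \<tau>] sa_ker_def)
    finally have "l \<in> sa_ker \<tau>" using l(1) by (intro sa_kerI) auto
    moreover have "norm l < \<delta>"
    proof -
      have "norm (l - h) = norm (\<i> *\<^sub>C l - ?a)"
        using norm_scaleC[of \<i> "l - h"] by (simp add: linear_diff[OF bounded_linear.linear[OF bounded_linear_scaleC]])
      also have "\<dots> \<le> 2 * norm (w - exp ?a)"
        unfolding l(2) using nl ab by (intro exp_inverse_lipschitz) auto
      also have "\<dots> \<le> 3 * norm ?b" using wa nb' by linarith
      finally have "norm (l - h) < 3 * \<epsilon>" using ab by linarith
      then show ?thesis using norm_triangle_ineq2[of l h] by (simp add: \<epsilon>_def)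
    qed
    ultimately have "w \<in> SU_nhd \<tau> \<delta>" unfolding SU_nhd_def using l(2) by blast
    moreover have "v * exp ?b = u * w" by (simp add: h(3) w_def mult.assoc)
    ultimately show ?thesis by blast
  qed
  then show "\<exists>\<epsilon>>0. (\<lambda>x. v * x) ` SU_nhd \<tau> \<epsilon> \<subseteq> (\<lambda>v. u * v) ` SU_nhd \<tau> \<delta>"
    using \<epsilon>0 by (intro exI[of _ \<epsilon>]) (auto simp: SU_nhd_def)
qed

lemma open_map_split_phase:
  "open_map path_topology (prod_topology euclideanreal (SU_topology \<tau>)) split_phase"
  unfolding open_map_def
proof (intro allI impI)
  fix W :: "(real \<Rightarrow> 'a) set" assume "openin path_topology W"
  then have W: "W \<subseteq> based_paths"
    "\<And>f. f \<in> W \<Longrightarrow> \<exists>\<delta>>0. \<forall>g\<in>based_paths. path_dist f g < \<delta> \<longrightarrow> g \<in> W"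
    unfolding openin_path_topology by blast+
  show "openin (prod_topology euclideanreal (SU_topology \<tau>)) (split_phase ` W)"
    unfolding openin_prod_topology_alt
  proof (intro allI impI)
    fix r u assume "(r, u) \<in> split_phase ` W"
    then obtain f where f: "f \<in> W" "split_phase f = (r, u)" by force
    then have fb: "f \<in> based_paths" and r: "r = phase f" and u: "u = snd (split_phase f)"
      using W(1) by (auto simp: split_phase_def)
    obtain e where e: "e > 0" "\<And>g. g \<in> based_paths \<Longrightarrow> path_dist f g < e \<Longrightarrow> g \<in> W"
      using W(2)[OF f(1)] by blast
    define \<delta> where "\<delta> = min (1 / 24) (e / 4)"
    have \<delta>: "\<delta> > 0" "\<delta> \<le> 1 / 24" "4 * \<delta> \<le> e" using e(1) by (auto simp: \<delta>_def)
    have uS: "u \<in> SU \<tau>" using split_phase_carrier[OF fb] u by simp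
    have "ball r \<delta> \<times> (\<lambda>v. u * v) ` SU_nhd \<tau> \<delta> \<subseteq> split_phase ` W"
    proof (clarify)
      fix s v assume s: "s \<in> ball r \<delta>" and "v \<in> SU_nhd \<tau> \<delta>"
      then obtain h where h: "h \<in> sa_ker \<tau>" "norm h < \<delta>" "v = exp (\<i> *\<^sub>C h)"
        by (auto simp: SU_nhd_def)
      define x where "x = \<i> *\<^sub>C (h + (s - r) *\<^sub>R 1)"
      define g where "g = (\<lambda>t\<in>{0..1}. f t * exp (t *\<^sub>R x))"
      have g: "g \<in> based_paths" "split_phase g = (s, u * v)"
        using split_phase_mult_exp[OF fb h(1), of "s - r"] h(3) by (auto simp: g_def x_def r u)
      have "norm (h + (s - r) *\<^sub>R 1) \<le> norm h + \<bar>s - r\<bar>"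
        using norm_triangle_ineq[of h "(s - r) *\<^sub>R 1"] by simp
      then have x: "norm x < 2 * \<delta>"
        using h(2) s by (simp add: x_def norm_scaleC dist_real_def abs_minus_commute)
      have "dist (f t) (g t) \<le> 3 * \<delta>" if t: "t \<in> {0..1}" for t
      proof -
        have "t * norm x \<le> norm x" using t by (intro mult_left_le_one_le) auto
        then have tx: "norm (t *\<^sub>R x) < 2 * \<delta>" using x t by simp
        have "f t - g t = - (f t * (exp (t *\<^sub>R x) - 1))" using t by (simp add: g_def algebra_simps)
        then have "norm (f t - g t) \<le> norm (f t) * norm (exp (t *\<^sub>R x) - 1)"
          by (simp only: norm_minus_cancel norm_mult_ineq)
        also have "\<dots> \<le> 3 / 2 * norm (t *\<^sub>R x)"
          using norm_exp_minus_one_le_linear[of "t *\<^sub>R x"] tx \<delta>(2)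
          by (simp add: norm_unitary[OF based_pathsD(5)[OF fb t]])
        finally show ?thesis using tx by (simp add: dist_norm)
      qed
      then have "path_dist f g \<le> 3 * \<delta>" by (rule path_dist_le[OF fb g(1)])
      then have "g \<in> W" using \<delta> by (intro e(2) g(1)) linarith
      then show "(s, u * v) \<in> split_phase ` W" using g(2) by (metis imageI)
    qed
    moreover have "u \<in> (\<lambda>v. u * v) ` SU_nhd \<tau> \<delta>"
    proof -
      have "exp (\<i> *\<^sub>C 0) \<in> SU_nhd \<tau> \<delta>"
        unfolding SU_nhd_def using \<delta>(1) by (auto simp: sa_ker_def tracial_state_0[OF \<tau>] intro!: exI[of _ 0])
      then show ?thesis by (intro image_eqI[of _ _ "exp (\<i> *\<^sub>C 0)"]) auto
    qed
    ultimately show "\<exists>U V. openin euclideanreal U \<and> openin (SU_topology \<tau>) V \<and> r \<in> U \<and> u \<in> V \<and>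
        U \<times> V \<subseteq> split_phase ` W"
      using openin_translate_SU_nhd[OF uS \<delta>(2)] \<delta>(1)
      by (intro exI[of _ "ball r \<delta>"] exI[of _ "(\<lambda>v. u * v) ` SU_nhd \<tau> \<delta>"]) auto
  qed
qed

text \<open>A continuous open homomorphism onto induces a homeomorphic isomorphism from the quotient by its
  kernel, as open sets of the quotient are those with open union.\<close>

lemma univ_cover_iso_homeomorphism:
  assumes ker: "kernel path_group target split_phase = null_loops"
  shows "\<exists>\<phi>. \<phi> \<in> iso (univ_cover :: (real \<Rightarrow> 'a) set monoid) target \<and>
    homeomorphic_map univ_cover_topology (prod_topology euclideanreal (SU_topology \<tau>)) \<phi>"
proof -
  interpret \<Phi>: group_hom path_group target split_phase by (rule group_hom_split_phase)
  define Q where "Q = rcosets\<^bsub>path_group\<^esub> (null_loops :: (real \<Rightarrow> 'a) set)"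
  let ?T = "prod_topology euclideanreal (SU_topology \<tau>)"
  let ?\<phi> = "\<lambda>C. the_elem (split_phase ` C)"
  have carrier: "carrier path_group = (based_paths :: (real \<Rightarrow> 'a) set)" by (simp add: path_group_def)
  have carrier_t: "carrier target = UNIV \<times> SU \<tau>" by (simp add: add_group_def SU_group_def)
  have sub: "subgroup null_loops (path_group :: (real \<Rightarrow> 'a) monoid)"
    using \<Phi>.subgroup_kernel ker by simp
  have iso: "?\<phi> \<in> iso (univ_cover :: (real \<Rightarrow> 'a) set monoid) target"
    using \<Phi>.FactGroup_iso_set split_phase_surj unfolding ker univ_cover_def carrier carrier_t by blast
  have disj: "disjoint Q" unfolding Q_def by (rule \<Phi>.G.rcos_disjoint[OF sub])
  have UQ: "\<Union>Q = based_paths" unfolding Q_def using \<Phi>.G.rcosets_part_G[OF sub] carrier by simp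
  have coset: "split_phase (n \<otimes>\<^bsub>path_group\<^esub> a) = split_phase a"
    if n: "n \<in> null_loops" and a: "a \<in> carrier path_group" for n a
  proof -
    have nk: "n \<in> carrier path_group" "split_phase n = \<one>\<^bsub>target\<^esub>"
      using n unfolding ker[symmetric] kernel_def by blast+
    have "split_phase (n \<otimes>\<^bsub>path_group\<^esub> a) = split_phase n \<otimes>\<^bsub>target\<^esub> split_phase a"
      by (rule \<Phi>.hom_mult[OF nk(1) a])
    also have "\<dots> = split_phase a"
      unfolding nk(2) by (rule \<Phi>.H.l_one[OF \<Phi>.hom_closed[OF a]])
    finally show ?thesis .
  qed
  have val: "?\<phi> C = split_phase f" if "C \<in> Q" "f \<in> C" for C f
  proof -
    obtain a where a: "a \<in> carrier path_group" "C = null_loops #>\<^bsub>path_group\<^esub> a"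
      using \<open>C \<in> Q\<close> unfolding Q_def RCOSETS_def by blast
    have const: "split_phase g = split_phase a" if "g \<in> C" for g
      using that coset[OF _ a(1)] unfolding a(2) r_coset_def by auto
    show ?thesis
    proof (rule the_elem_image_unique)
      show "C \<noteq> {}" using \<open>f \<in> C\<close> by blast
      show "split_phase g = split_phase f" if "g \<in> C" for g
        using const[OF that] const[OF \<open>f \<in> C\<close>] by simp
    qed
  qed
  have img: "?\<phi> ` W = split_phase ` \<Union>W" if "W \<subseteq> Q" for W
  proof
    have ne: "C \<noteq> {}" if "C \<in> Q" for C
      using that subgroup.rcosets_non_empty[OF sub] unfolding Q_def by blast
    show "?\<phi> ` W \<subseteq> split_phase ` \<Union>W"
    proof
      fix y assume "y \<in> ?\<phi> ` W"
      then obtain C where C: "C \<in> W" "y = ?\<phi> C" by blast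
      then obtain f where "f \<in> C" using ne \<open>W \<subseteq> Q\<close> by blast
      then show "y \<in> split_phase ` \<Union>W" using C val \<open>W \<subseteq> Q\<close> by blast
    qed
    show "split_phase ` \<Union>W \<subseteq> ?\<phi> ` W"
    proof
      fix y assume "y \<in> split_phase ` \<Union>W"
      then obtain C f where "C \<in> W" "f \<in> C" "y = split_phase f" by blast
      then show "y \<in> ?\<phi> ` W" using val[of C f] \<open>W \<subseteq> Q\<close> by (metis imageI subsetD)
    qed
  qed
  have openin: "openin univ_cover_topology W \<longleftrightarrow> W \<subseteq> Q \<and> openin path_topology (\<Union>W)" for W
    unfolding univ_cover_topology_def Q_def[symmetric] by (rule openin_partition_topology[OF disj])
  have top: "topspace univ_cover_topology = Q"
  proof
    show "topspace univ_cover_topology \<subseteq> Q" using openin openin_topspace by blast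
    have "openin path_topology (\<Union>Q)" unfolding UQ topspace_path_topology[symmetric] by simp
    then show "Q \<subseteq> topspace univ_cover_topology" using openin openin_subset by blast
  qed
  have "homeomorphic_map univ_cover_topology ?T ?\<phi>"
  proof (rule bijective_open_imp_homeomorphic_map)
    show "continuous_map univ_cover_topology ?T ?\<phi>"
      unfolding continuous_map_def top
    proof (intro conjI allI impI)
      show "?\<phi> \<in> Q \<rightarrow> topspace ?T"
        using img[of Q] split_phase_surj unfolding UQ by (auto simp: topspace_SU)
      fix V assume "openin ?T V"
      then have "openin path_topology {f \<in> based_paths. split_phase f \<in> V}"
        using continuous_map_split_phase unfolding continuous_map_def topspace_path_topology by blast
      moreover have "{f \<in> based_paths. split_phase f \<in> V} = \<Union>{C \<in> Q. ?\<phi> C \<in> V}"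
      proof (intro equalityI subsetI)
        fix f assume "f \<in> {f \<in> based_paths. split_phase f \<in> V}"
        then obtain C where "C \<in> Q" "f \<in> C" "split_phase f \<in> V" unfolding UQ[symmetric] by blast
        then show "f \<in> \<Union>{C \<in> Q. ?\<phi> C \<in> V}" using val[of C f] by auto
      next
        fix f assume "f \<in> \<Union>{C \<in> Q. ?\<phi> C \<in> V}"
        then obtain C where "C \<in> Q" "f \<in> C" "?\<phi> C \<in> V" by blast
        then show "f \<in> {f \<in> based_paths. split_phase f \<in> V}"
          using val[of C f] unfolding UQ[symmetric] by auto
      qed
      ultimately show "openin univ_cover_topology {C \<in> Q. ?\<phi> C \<in> V}" unfolding openin by auto
    qed
    show "open_map univ_cover_topology ?T ?\<phi>"
      unfolding open_map_def openin using img open_map_split_phase unfolding open_map_def by metis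
    show "?\<phi> ` topspace univ_cover_topology = topspace ?T"
      unfolding top img[OF subset_refl] UQ split_phase_surj by (simp add: topspace_SU)
    have "carrier univ_cover = Q" by (simp add: univ_cover_def FactGroup_def Q_def)
    then show "inj_on ?\<phi> (topspace univ_cover_topology)"
      using iso unfolding top iso_def bij_betw_def by simp
  qed
  with iso show ?thesis by blast
qed

end

theorem theorem5p5:
  fixes \<tau> :: "'a::cstar_algebra \<Rightarrow> complex"
  assumes "simple_cstar TYPE('a)"
    and "separable_space (euclidean :: 'a topology)"
    and "(unitaries :: 'a set) = connected_component_set unitaries 1"
    and "(B_map :: (real \<Rightarrow> 'a) set \<Rightarrow> _)
           \<in> iso (fundamental_group (top_of_set unitaries) 1) K0"
    and "tracial_state \<tau>"
    and "SU \<tau> = {u \<in> connected_component_set unitaries 1.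
           corner u \<in> kernel U_inf0_group (add_group Mod K0_trace_range \<tau>) (dhs_det \<tau>)}"
    and "inj_on (K0_trace \<tau>) (carrier K0)"
  shows "\<exists>\<phi>. \<phi> \<in> iso (univ_cover :: (real \<Rightarrow> 'a) set monoid)
               ((add_group :: real monoid) \<times>\<times> SU_group \<tau>) \<and>
             homeomorphic_map univ_cover_topology
               (prod_topology euclideanreal (SU_topology \<tau>)) \<phi>"
proof (rule univ_cover_iso_homeomorphism[OF assms(5) kernel_split_phase[OF assms(5) _ assms(7)]])
  show "bij_betw B_map (carrier (fundamental_group (top_of_set (unitaries :: 'a set)) 1)) (carrier K0)"
    using assms(4) by (simp add: iso_def)
qed

end
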